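(* Let $G$ be a locally finite graph, and let $T \subseteq \hat{V}(G)$ be discrete in $|G|$. If every finite cut of $G$ such that $T$ lives on one of its sides has even size, then $|G|$ contains a set $\mathcal{A}$ of pairwise edge-disjoint graphic $T$-arcs such that for every $t \in T$, the number of $t$–$(T\setminus\{t\})$ arcs in $\mathcal{A}$ is equal to $\lambda_G(t, T\setminus\{t\})$.
   Context: Graphs may have parallel edges but no loops. $G$ is locally finite if every vertex is incident with finitely many edges. $\Omega(G)$ denotes the set of ends of $G$ (equivalence classes of rays, two rays being equivalent if no finite vertex set separates them), $\hat{V}(G) := V(G)\cup\Omega(G)$, and $|G|$ denotes the Freudenthal (end) compactification of $G$ (the 1-complex of $G$ with its ends added, with the standard topology). A cut of $G$ is a set $E_G(A,B)$ of all edges between the two classes of a bipartition $\{A,B\}$ of $V(G)$; $A$ and $B$ are its sides. A set $X \subseteq \hat{V}(G)$ lives in a vertex set $C$ if all vertices of $X$ lie in $C$ and every ray of every end in $X$ has a tail in $G[C]$. For $X,Y\subseteq \hat V(G)$, a finite cut is an $X$–$Y$ cut if $X$ and $Y$ live in distinct sides of it. For $x \in \hat V(G)$ not in the closure of $Y$ in $|G|$, $\lambda_G(x,Y)$ denotes the least size of a finite $\{x\}$–$Y$ cut. An arc is a subspace of $|G|$ homeomorphic to $[0,1]$. A $T$-arc is an arc whose endpoints lie in $T$ and none of whose inner points lie in $T$. An $X$–$Y$ arc is an arc meeting $X$ in exactly one endpoint and $Y$ in exactly the other endpoint. An arc is graphic if it is defined by a finite path, by a ray together with its end, or by a double ray whose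 two tails lie in distinct ends together with these two ends. Two arcs are edge-disjoint if they have no common inner point of an edge. *)

theory Defs
  imports "HOL-Analysis.Analysis"
begin

text \<open>Parallel edges are distinct edges with the same set of endvertices.\<close>

record ('v, 'e) multigraph =
  verts :: "'v set"
  edges :: "'e set"
  ends :: "'e \<Rightarrow> 'v set"

definition is_multigraph :: "('v, 'e) multigraph \<Rightarrow> bool" where
  "is_multigraph G \<longleftrightarrow>
     (\<forall>e\<in>edges G. \<exists>u\<in>verts G. \<exists>v\<in>verts G. u \<noteq> v \<and> ends G e = {u, v})"

definition locally_finite :: "('v, 'e) multigraph \<Rightarrow> bool" where
  "locally_finite G \<longleftrightarrow> (\<forall>v\<in>verts G. finite {e \<in> edges G. v \<in> ends G e})"

definition is_path :: "('v, 'e) multigraph \<Rightarrow> 'v list \<Rightarrow> 'e list \<Rightarrow> bool" where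
  "is_path G vs es \<longleftrightarrow>
     length vs = Suc (length es) \<and> distinct vs \<and> set vs \<subseteq> verts G \<and> set es \<subseteq> edges G \<and>
     (\<forall>i<length es. ends G (es ! i) = {vs ! i, vs ! Suc i})"

text \<open>A ray is given by its vertices and edges in their order along the ray. Its first vertex is
  determined by the ray as a subgraph, so every subgraph ray is counted exactly once.\<close>

type_synonym ('v, 'e) ray = "(nat \<Rightarrow> 'v) \<times> (nat \<Rightarrow> 'e)"

definition rays :: "('v, 'e) multigraph \<Rightarrow> ('v, 'e) ray set" where
  "rays G = {(p, f). inj p \<and> range p \<subseteq> verts G \<and> range f \<subseteq> edges G \<and>
                     (\<forall>i. ends G (f i) = {p i, p (Suc i)})}"

definition is_double_ray :: "('v, 'e) multigraph \<Rightarrow> (int \<Rightarrow> 'v) \<Rightarrow> (int \<Rightarrow> 'e) \<Rightarrow> bool" where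
  "is_double_ray G p f \<longleftrightarrow> inj p \<and> range p \<subseteq> verts G \<and> range f \<subseteq> edges G \<and>
     (\<forall>i. ends G (f i) = {p i, p (i + 1)})"

definition has_tail_in :: "('v, 'e) ray \<Rightarrow> 'v set \<Rightarrow> bool" where
  "has_tail_in R C \<longleftrightarrow> (\<exists>n. \<forall>m\<ge>n. fst R m \<in> C)"

text \<open>Vertex sets of the components of the graph obtained by deleting the vertices in \<open>S\<close>.\<close>

definition adjacent_avoiding :: "('v, 'e) multigraph \<Rightarrow> 'v set \<Rightarrow> 'v \<Rightarrow> 'v \<Rightarrow> bool" where
  "adjacent_avoiding G S u v \<longleftrightarrow>
     u \<in> verts G - S \<and> v \<in> verts G - S \<and> (\<exists>e\<in>edges G. ends G e = {u, v})"

definition components_minus :: "('v, 'e) multigraph \<Rightarrow> 'v set \<Rightarrow> 'v set set" where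
  "components_minus G S = {{w. (adjacent_avoiding G S)\<^sup>*\<^sup>* v w} | v. v \<in> verts G - S}"

definition ray_equiv :: "('v, 'e) multigraph \<Rightarrow> (('v, 'e) ray \<times> ('v, 'e) ray) set" where
  "ray_equiv G = {(R, R'). R \<in> rays G \<and> R' \<in> rays G \<and>
     (\<forall>S. finite S \<and> S \<subseteq> verts G \<longrightarrow>
        (\<exists>C\<in>components_minus G S. has_tail_in R C \<and> has_tail_in R' C))}"

definition graph_ends :: "('v, 'e) multigraph \<Rightarrow> ('v, 'e) ray set set" where
  "graph_ends G = rays G // ray_equiv G"

text \<open>Points of the end compactification. Each edge \<open>e\<close> is a copy of the unit interval, with its
  endvertices at positions 0 and 1; which of them is at 0 is an arbitrary choice. Thus
  \<open>Inner e s\<close> has distance \<open>s\<close> from \<open>origin G e\<close>.\<close>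

datatype ('v, 'e) point =
    Vertex 'v
  | Inner 'e real
  | EndPoint "('v, 'e) ray set"

definition origin :: "('v, 'e) multigraph \<Rightarrow> 'e \<Rightarrow> 'v" where
  "origin G e = (SOME v. v \<in> ends G e)"

definition edge_dist :: "('v, 'e) multigraph \<Rightarrow> 'e \<Rightarrow> real \<Rightarrow> 'v \<Rightarrow> real" where
  "edge_dist G e s v = (if v = origin G e then s else 1 - s)"

definition inner_points :: "'e set \<Rightarrow> ('v, 'e) point set" where
  "inner_points F = {Inner e s | e s. e \<in> F \<and> 0 < s \<and> s < 1}"

definition vhat :: "('v, 'e) multigraph \<Rightarrow> ('v, 'e) point set" where
  "vhat G = Vertex ` verts G \<union> EndPoint ` graph_ends G"

definition end_component ::
  "('v, 'e) multigraph \<Rightarrow> 'v set \<Rightarrow> ('v, 'e) ray set \<Rightarrow> 'v set" where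
  "end_component G S \<omega> =
     (THE C. C \<in> components_minus G S \<and> (\<exists>R\<in>\<omega>. range (fst R) \<subseteq> C))"

text \<open>Basic open sets: \<open>\<epsilon>\<close>-stars around vertices, open segments of edges, and, for an end in the
  component \<open>C\<close> of \<open>G - S\<close>, the subgraph induced by \<open>C\<close> with all ends having a ray in \<open>C\<close> and the
  half-edges of length \<open>\<epsilon>\<close> leaving \<open>C\<close> towards \<open>S\<close>. As every vertex has finite degree, the stars of
  uniform radius generate the topology of the 1-complex.\<close>

definition open_star :: "('v, 'e) multigraph \<Rightarrow> 'v \<Rightarrow> real \<Rightarrow> ('v, 'e) point set" where
  "open_star G v \<epsilon> = insert (Vertex v)
     {Inner e s | e s. e \<in> edges G \<and> v \<in> ends G e \<and> 0 < s \<and> s < 1 \<and> edge_dist G e s v < \<epsilon>}"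

definition open_segment_of :: "'e \<Rightarrow> real \<Rightarrow> real \<Rightarrow> ('v, 'e) point set" where
  "open_segment_of e a b = {Inner e s | s. a < s \<and> s < b}"

definition end_nbhd ::
  "('v, 'e) multigraph \<Rightarrow> 'v set \<Rightarrow> ('v, 'e) ray set \<Rightarrow> real \<Rightarrow> ('v, 'e) point set" where
  "end_nbhd G S \<omega> \<epsilon> = (let C = end_component G S \<omega> in
     Vertex ` C
     \<union> inner_points {e \<in> edges G. ends G e \<subseteq> C}
     \<union> EndPoint ` {\<eta> \<in> graph_ends G. \<exists>R\<in>\<eta>. range (fst R) \<subseteq> C}
     \<union> {Inner e s | e s x c. e \<in> edges G \<and> x \<in> S \<and> c \<in> C \<and> ends G e = {x, c} \<and>
                            0 < s \<and> s < 1 \<and> edge_dist G e s c < \<epsilon>})"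

definition end_compactification :: "('v, 'e) multigraph \<Rightarrow> ('v, 'e) point topology" where
  "end_compactification G = topology_generated_by
     ({open_star G v \<epsilon> | v \<epsilon>. v \<in> verts G \<and> 0 < \<epsilon>}
      \<union> {open_segment_of e a b | e a b. e \<in> edges G \<and> 0 \<le> a \<and> a < b \<and> b \<le> 1}
      \<union> {end_nbhd G S \<omega> \<epsilon> | S \<omega> \<epsilon>. finite S \<and> S \<subseteq> verts G \<and> \<omega> \<in> graph_ends G \<and> 0 < \<epsilon>})"

text \<open>Sides of a cut may be empty. This matters for \<open>cut_lambda G t {}\<close>, which is 0.\<close>

definition cut_edges :: "('v, 'e) multigraph \<Rightarrow> 'v set \<Rightarrow> 'v set \<Rightarrow> 'e set" where
  "cut_edges G A B = {e \<in> edges G. \<exists>a\<in>A. \<exists>b\<in>B. ends G e = {a, b}}"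

definition is_bipartition :: "('v, 'e) multigraph \<Rightarrow> 'v set \<Rightarrow> 'v set \<Rightarrow> bool" where
  "is_bipartition G A B \<longleftrightarrow> A \<union> B = verts G \<and> A \<inter> B = {}"

definition lives_in :: "('v, 'e) point set \<Rightarrow> 'v set \<Rightarrow> bool" where
  "lives_in X C \<longleftrightarrow>
     (\<forall>v. Vertex v \<in> X \<longrightarrow> v \<in> C) \<and> (\<forall>\<omega>. EndPoint \<omega> \<in> X \<longrightarrow> (\<forall>R\<in>\<omega>. has_tail_in R C))"

definition separating_cut ::
  "('v, 'e) multigraph \<Rightarrow> ('v, 'e) point set \<Rightarrow> ('v, 'e) point set \<Rightarrow> 'e set \<Rightarrow> bool" where
  "separating_cut G X Y F \<longleftrightarrow> finite F \<and>
     (\<exists>A B. is_bipartition G A B \<and> F = cut_edges G A B \<and> lives_in X A \<and> lives_in Y B)"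

definition cut_lambda ::
  "('v, 'e) multigraph \<Rightarrow> ('v, 'e) point \<Rightarrow> ('v, 'e) point set \<Rightarrow> nat" where
  "cut_lambda G x Y = (LEAST n. \<exists>F. separating_cut G {x} Y F \<and> card F = n)"

definition arc_with_endpoints :: "'a topology \<Rightarrow> 'a \<Rightarrow> 'a \<Rightarrow> 'a set \<Rightarrow> bool" where
  "arc_with_endpoints X x y A \<longleftrightarrow> A \<subseteq> topspace X \<and>
     (\<exists>h. homeomorphic_map (top_of_set {0..1::real}) (subtopology X A) h \<and> h 0 = x \<and> h 1 = y)"

definition is_T_arc :: "'a topology \<Rightarrow> 'a set \<Rightarrow> 'a set \<Rightarrow> bool" where
  "is_T_arc X T A \<longleftrightarrow>
     (\<exists>x y. arc_with_endpoints X x y A \<and> x \<in> T \<and> y \<in> T \<and> (A - {x, y}) \<inter> T = {})"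

definition is_arc_between :: "'a topology \<Rightarrow> 'a set \<Rightarrow> 'a set \<Rightarrow> 'a set \<Rightarrow> bool" where
  "is_arc_between X P Q A \<longleftrightarrow>
     (\<exists>x y. arc_with_endpoints X x y A \<and> A \<inter> P = {x} \<and> A \<inter> Q = {y})"

definition is_graphic :: "('v, 'e) multigraph \<Rightarrow> ('v, 'e) point set \<Rightarrow> bool" where
  "is_graphic G A \<longleftrightarrow>
     (\<exists>vs es. is_path G vs es \<and> A = Vertex ` set vs \<union> inner_points (set es))
   \<or> (\<exists>p f \<omega>. \<omega> \<in> graph_ends G \<and> (p, f) \<in> \<omega> \<and>
        A = Vertex ` range p \<union> inner_points (range f) \<union> {EndPoint \<omega>})
   \<or> (\<exists>p f \<omega> \<eta>. is_double_ray G p f \<and> \<omega> \<in> graph_ends G \<and> \<eta> \<in> graph_ends G \<and> \<omega> \<noteq> \<eta> \<and>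
        (\<lambda>n. p (int n), \<lambda>n. f (int n)) \<in> \<omega> \<and>
        (\<lambda>n. p (- int n), \<lambda>n. f (- int n - 1)) \<in> \<eta> \<and>
        A = Vertex ` range p \<union> inner_points (range f) \<union> {EndPoint \<omega>, EndPoint \<eta>})"

definition edge_disjoint ::
  "('v, 'e) multigraph \<Rightarrow> ('v, 'e) point set \<Rightarrow> ('v, 'e) point set \<Rightarrow> bool" where
  "edge_disjoint G A B \<longleftrightarrow> A \<inter> B \<inter> inner_points (edges G) = {}"

end

theory Submission
  imports Defs
begin

text \<open>Choose for each terminal \<open>t\<close> a minimum cut side \<open>A t\<close> separating it from the other terminals; since
  each component contains only countably many terminals, posimodularity makes these sides disjoint.
  Contracting every \<open>A t\<close> to one vertex turns all terminals, ends included, into vertices \<open>t\<close> whose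
  degree is \<open>\<lambda>(t, T - {t})\<close>, and it remains to find edge-disjoint finite paths between terminals
  that use every edge at a terminal.

  Such paths are removed one at a time so that every cut around a single terminal \<open>r\<close> keeps at least
  as many edges as the degree of \<open>r\<close>. Follow a path of a Menger system from \<open>t\<close> to the other terminals
  and split off its edges one after the other; the first time this would destroy the condition,
  by parity there is a tight set around another terminal \<open>r\<close>, and a Menger linkage inside that set
  leads on to \<open>r\<close>.

  Finally the paths are extended inside the sides \<open>A t\<close>: by Menger's theorem if \<open>t\<close> is a vertex, and
  if \<open>t\<close> is an end by rays that traverse a decreasing sequence of neighbourhoods of \<open>t\<close>, each with
  a boundary that is minimum among those contained in the previous one.\<close>


text \<open>The hypotheses control finite cuts only, so all conditions quantify over vertex sets
  with finite boundary, while the sets themselves may be infinite. Discreteness of \<open>T\<close>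
  enters once: it gives an end in \<open>T\<close> a component of some \<open>G - S\<close> that
  avoids all other terminals, hence a finite separating cut. The parity hypothesis makes the
  boundary of a terminal-free set even after contraction. Then all finite cuts around the same
  single terminal have the same parity, so a cut that is not tight has slack at least 2, which is
  exactly what splitting off can cost. Two infinite processes have to be tamed. Uncrossing subtracts
  sides one at a time, so it copes with finitely many predecessors only; this is why the terminals
  of a component must be enumerated. Minimality of the sides is used twice: it provides the cut
  condition after contraction, and it makes every boundary edge of a side the start of a linkage
  path inside it.\<close>

text \<open>In the abstract part a graph is an edge set with an endvertex map, and every element of the vertex
  type counts as a vertex. Loops are allowed because contracting vertex sets creates them.
  A walk from \<open>u\<close> is a list of pairs, each an edge together with the vertex it leads to.\<close>

definition bd :: "('e \<Rightarrow> 'v set) \<Rightarrow> 'e set \<Rightarrow> 'v set \<Rightarrow> 'e set" where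
  "bd g E X = {e \<in> E. g e \<inter> X \<noteq> {} \<and> \<not> g e \<subseteq> X}"

definition graphlike :: "('e \<Rightarrow> 'v set) \<Rightarrow> 'e set \<Rightarrow> bool" where
  "graphlike g E \<longleftrightarrow> (\<forall>e\<in>E. \<exists>u v. g e = {u, v})"

text \<open>The target \<open>D\<close> is built in, so that a walk stops at its first vertex in
  \<open>D\<close>. The step relation \<open>st\<close> is arbitrary because the same notion serves
  residual steps, arcs of a flow and edges of a graph.\<close>

fun lwalk :: "('v \<Rightarrow> 'e \<Rightarrow> 'v \<Rightarrow> bool) \<Rightarrow> 'v set \<Rightarrow> 'v \<Rightarrow> ('e \<times> 'v) list \<Rightarrow> bool" where
  "lwalk st D u [] \<longleftrightarrow> u \<in> D"
| "lwalk st D u ((e, v) # ps) \<longleftrightarrow> u \<notin> D \<and> st u e v \<and> lwalk st D v ps"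

fun wend :: "'v \<Rightarrow> ('e \<times> 'v) list \<Rightarrow> 'v" where
  "wend u [] = u"
| "wend u ((e, v) # ps) = wend v ps"

definition simple :: "'v \<Rightarrow> ('e \<times> 'v) list \<Rightarrow> bool" where
  "simple u ps \<longleftrightarrow> distinct (u # map snd ps)"

abbreviation pverts :: "'v \<Rightarrow> ('e \<times> 'v) list \<Rightarrow> 'v set" where
  "pverts u ps \<equiv> insert u (snd ` set ps)"

abbreviation pedges :: "('e \<times> 'v) list \<Rightarrow> 'e set" where
  "pedges ps \<equiv> fst ` set ps"

lemma simple_simps [simp]:
  "simple u []"
  "simple u ((e, v) # ps) \<longleftrightarrow> u \<notin> pverts v ps \<and> simple v ps"
  by (auto simp: simple_def)

lemma lwalk_mono:
  assumes "lwalk st D u ps" "\<And>u e v. st u e v \<Longrightarrow> st' u e v"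
  shows "lwalk st' D u ps"
  using assms by (induction st D u ps rule: lwalk.induct) auto

lemma lwalk_wend: "lwalk st D u ps \<Longrightarrow> wend u ps \<in> D"
  by (induction st D u ps rule: lwalk.induct) auto

lemma wend_in_pverts: "wend u ps \<in> pverts u ps"
  by (induction u ps rule: wend.induct) auto

lemma lwalk_suffix:
  assumes "lwalk st D u ps" "simple u ps" "z \<in> pverts u ps"
  shows "\<exists>qs. lwalk st D z qs \<and> simple z qs"
  using assms
proof (induction st D u ps rule: lwalk.induct)
  case (2 st D u e v ps)
  show ?case
  proof (cases "z = u")
    case True
    with 2 show ?thesis by blast
  next
    case False
    then have "z \<in> pverts v ps" using 2 by auto
    with 2 show ?thesis by auto
  qed
qed (auto intro: exI[of _ "[]"])

text \<open>Reachability in dual form: a caller need not exhibit a walk, but only refute a set that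
  contains \<open>S\<close>, is closed under steps and misses \<open>D\<close>. Such a set is a cut,
  so counting arguments apply.\<close>

lemma lwalk_exists:
  assumes closed: "\<And>X. \<lbrakk>S \<subseteq> X; \<And>x e y. \<lbrakk>x \<in> X; x \<notin> D; st x e y\<rbrakk> \<Longrightarrow> y \<in> X\<rbrakk> \<Longrightarrow> X \<inter> D \<noteq> {}"
  shows "\<exists>u\<in>S. \<exists>ps. lwalk st D u ps \<and> simple u ps"
proof -
  define r where "r = (\<lambda>x y. \<exists>e. x \<notin> D \<and> st x e y)"
  define X where "X = {x. \<exists>s\<in>S. r\<^sup>*\<^sup>* s x}"
  have "X \<inter> D \<noteq> {}"
  proof (rule closed)
    show "S \<subseteq> X" by (auto simp: X_def)
    fix x e y assume "x \<in> X" "x \<notin> D" "st x e y"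
    then show "y \<in> X" unfolding X_def r_def
      by (smt (verit, best) mem_Collect_eq rtranclp.rtrancl_into_rtrancl)
  qed
  then obtain x s where x: "x \<in> D" "s \<in> S" "r\<^sup>*\<^sup>* s x" by (auto simp: X_def)
  from x(3) have "\<exists>ps. lwalk st D s ps \<and> simple s ps"
  proof (induction rule: converse_rtranclp_induct)
    case base
    then show ?case using x(1) by (intro exI[of _ "[]"]) auto
  next
    case (step y z)
    then obtain ps e where ps: "lwalk st D z ps" "simple z ps" and e: "y \<notin> D" "st y e z"
      by (auto simp: r_def)
    \<comment> \<open>If \<open>y\<close> is already on the walk from \<open>z\<close>, the part
      after \<open>y\<close> is a shorter simple walk from \<open>y\<close>.\<close>
    show ?case
    proof (cases "y \<in> pverts z ps")
      case True
      then show ?thesis using lwalk_suffix[OF ps] by blast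
    next
      case False
      then show ?thesis using ps e by (intro exI[of _ "(e, z) # ps"]) auto
    qed
  qed
  with x show ?thesis by blast
qed

lemma bd_cases:
  assumes "graphlike g E" "e \<in> bd g E X"
  obtains u v where "e \<in> E" "g e = {u, v}" "u \<in> X" "v \<notin> X"
proof -
  obtain a b where "e \<in> E" "g e = {a, b}" using assms unfolding graphlike_def bd_def by blast
  then show thesis using that[of a b] that[of b a] assms(2)
    by (auto simp: bd_def insert_commute)
qed

definition joins :: "('e \<Rightarrow> 'v set) \<Rightarrow> 'e set \<Rightarrow> 'v \<Rightarrow> 'e \<Rightarrow> 'v \<Rightarrow> bool" where
  "joins g E u e v \<longleftrightarrow> e \<in> E \<and> g e = {u, v}"

section \<open>Menger's theorem\<close>

text \<open>A partial orientation of finitely many edges, that is, a unit flow: injectivity on the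
  edge component forbids using an edge in both directions.\<close>

definition arcset :: "('e \<Rightarrow> 'v set) \<Rightarrow> 'e set \<Rightarrow> ('v \<times> 'e \<times> 'v) set \<Rightarrow> bool" where
  "arcset g E F \<longleftrightarrow> finite F \<and> (\<forall>(u, e, v)\<in>F. e \<in> E \<and> g e = {u, v} \<and> u \<noteq> v)
     \<and> inj_on (\<lambda>(u, e, v). e) F"

text \<open>Net outflow of \<open>X\<close>. Summing over the finitely many arcs instead of over
  vertices makes sense for infinite \<open>X\<close>.\<close>

definition net :: "('v \<times> 'e \<times> 'v) set \<Rightarrow> 'v set \<Rightarrow> int" where
  "net F X = (\<Sum>(u, e, v)\<in>F. of_bool (u \<in> X) - of_bool (v \<in> X))"

definition flow where
  "flow g E S D F \<longleftrightarrow> arcset g E F \<and> (\<forall>v. v \<notin> S \<union> D \<longrightarrow> net F {v} = 0)"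

lemma arcsetD:
  assumes "arcset g E F" "(u, e, v) \<in> F"
  shows "e \<in> E" "g e = {u, v}" "u \<noteq> v"
  using assms unfolding arcset_def by auto

lemma arcset_unique:
  assumes "arcset g E F" "(u, e, v) \<in> F" "(u', e, v') \<in> F"
  shows "u = u'" "v = v'"
  using assms unfolding arcset_def inj_on_def by fastforce+

lemma net_Un:
  assumes "X \<inter> Y = {}"
  shows "net F (X \<union> Y) = net F X + net F Y"
  unfolding net_def sum.distrib[symmetric]
  by (rule sum.cong) (use assms in \<open>auto simp: of_bool_def\<close>)

lemma net_finite_zero:
  assumes "finite Y" "\<And>v. v \<in> Y \<Longrightarrow> net F {v} = 0"
  shows "net F Y = 0"
  using assms
proof (induction Y rule: finite_induct)
  case empty
  then show ?case by (simp add: net_def)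
next
  case (insert x Y)
  then show ?case using net_Un[of "{x}" Y F] by simp
qed

text \<open>Only the finitely many endvertices of arcs contribute to the net outflow of
  \<open>X - S\<close>, and at each of those in \<open>X - S\<close> conservation holds.\<close>

lemma net_closed:
  assumes "flow g E S D F" "S \<subseteq> X" "X \<inter> D = {}"
  shows "net F X = net F S"
proof -
  have fin: "finite F" using assms by (auto simp: flow_def arcset_def)
  define W where "W = fst ` F \<union> (\<lambda>(u, e, v). v) ` F"
  have "net F (X - S) = net F ((X - S) \<inter> W)"
    unfolding net_def
  proof (rule sum.cong[OF refl], clarify)
    fix u e v assume "(u, e, v) \<in> F"
    then have "u \<in> W" "v \<in> W" by (force simp: W_def)+
    then show "of_bool (u \<in> X - S) - of_bool (v \<in> X - S)
      = (of_bool (u \<in> (X - S) \<inter> W) - of_bool (v \<in> (X - S) \<inter> W) :: int)" by simp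
  qed
  also have "\<dots> = 0"
    by (rule net_finite_zero) (use assms fin in \<open>auto simp: flow_def W_def\<close>)
  finally show ?thesis using net_Un[of S "X - S" F] assms(2)
    by (simp add: Un_absorb1)
qed

lemma net_insert:
  assumes "finite F" "(u, e, v) \<notin> F"
  shows "net (insert (u, e, v) F) X = net F X + of_bool (u \<in> X) - of_bool (v \<in> X)"
  using assms by (simp add: net_def)

lemma net_remove:
  assumes "finite F" "(u, e, v) \<in> F"
  shows "net (F - {(u, e, v)}) X = net F X - of_bool (u \<in> X) + of_bool (v \<in> X)"
  using net_insert[of "F - {(u, e, v)}" u e v X] assms by (simp add: insert_absorb)

abbreviation arc_edges where "arc_edges F \<equiv> (\<lambda>(u, e, v). e) ` F"

text \<open>The residual graph of Ford and Fulkerson; the last alternative cancels an arc.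
  Forbidding steps into \<open>S\<close> keeps an augmenting walk from returning to
  \<open>S\<close>.\<close>

definition residual where
  "residual g E S F u e v \<longleftrightarrow> e \<in> E \<and> g e = {u, v} \<and> u \<noteq> v \<and> v \<notin> S
     \<and> (e \<notin> arc_edges F \<or> (v, e, u) \<in> F)"

lemma augment:
  assumes "arcset g E F" "lwalk (residual g E S F) D u ps" "simple u ps"
  shows "\<exists>F'. arcset g E F' \<and> (\<forall>X. net F' X = net F X + of_bool (u \<in> X) - of_bool (wend u ps \<in> X))"
  using assms
proof (induction ps arbitrary: F u)
  case Nil
  then show ?case by auto
next
  case (Cons p ps)
  obtain e v where p: "p = (e, v)" by (cases p)
  have st: "residual g E S F u e v" and rest: "lwalk (residual g E S F) D v ps"
    using Cons.prems p by auto
  have fin: "finite F" using Cons.prems by (auto simp: arcset_def)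
  \<comment> \<open>Pushing one unit along \<open>e\<close> cancels the opposite arc if there is
    one, and otherwise adds an arc.\<close>
  define F1 where "F1 = (if (v, e, u) \<in> F then F - {(v, e, u)} else insert (u, e, v) F)"
  have notin: "(u, e, v) \<notin> F"
  proof
    assume *: "(u, e, v) \<in> F"
    then have "(v, e, u) \<in> F" using st by (force simp: residual_def)
    from arcset_unique(1)[OF Cons.prems(1) * this] show False using st by (simp add: residual_def)
  qed
  have net1: "net F1 X = net F X + of_bool (u \<in> X) - of_bool (v \<in> X)" for X
    using net_insert[OF fin notin] net_remove[OF fin, of v e u] by (simp add: F1_def)
  have arc1: "arcset g E F1"
  proof (cases "(v, e, u) \<in> F")
    case True
    then show ?thesis using Cons.prems(1) by (auto simp: F1_def arcset_def inj_on_def)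
  next
    case False
    then have "e \<notin> arc_edges F" using st by (auto simp: residual_def)
    then show ?thesis using Cons.prems(1) st False
      by (auto simp: F1_def arcset_def residual_def inj_on_def image_iff)
  qed
  \<comment> \<open>Later steps avoid \<open>u\<close> because the walk is simple, so they use edges
    other than \<open>e\<close> and stay residual.\<close>
  have step: "residual g E S F1 x e' y" if "residual g E S F x e' y" "x \<noteq> u" "y \<noteq> u" for x e' y
  proof -
    have "e' \<noteq> e" using that st by (auto simp: residual_def doubleton_eq_iff)
    then show ?thesis using that by (auto simp: residual_def F1_def image_iff)
  qed
  have "lwalk (residual g E S F1) D x qs"
    if "lwalk (residual g E S F) D x qs" "u \<notin> pverts x qs" for x qs
    using that
    by (induction "residual g E S F" D x qs rule: lwalk.induct) (auto intro: step)
  then have "lwalk (residual g E S F1) D v ps" using rest Cons.prems p by auto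
  from Cons.IH[OF arc1 this] Cons.prems p obtain F' where
    "arcset g E F'" "\<forall>X. net F' X = net F1 X + of_bool (v \<in> X) - of_bool (wend v ps \<in> X)" by auto
  then show ?case using net1 p by (intro exI[of _ F']) auto
qed

text \<open>If no residual step leaves \<open>X\<close>, all boundary edges carry flow and all of it
  is directed outwards. Finiteness of the boundary comes for free, since the flow is finite; it must
  be a conclusion because cut hypotheses speak of finite boundaries only.\<close>

lemma card_bd_flow:
  assumes F: "arcset g E F" and gl: "graphlike g E"
    and cl: "\<And>u e v. \<lbrakk>u \<in> X; residual g E {} F u e v\<rbrakk> \<Longrightarrow> v \<in> X"
  shows "finite (bd g E X) \<and> int (card (bd g E X)) = net F X"
proof -
  define H where "H = {(u, e, v) \<in> F. u \<in> X \<and> v \<notin> X}"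
  have fin: "finite F" using F by (auto simp: arcset_def)
  have noin: "v \<in> X \<Longrightarrow> u \<in> X" if "(u, e, v) \<in> F" for u e v
    using cl[of v e u] that arcsetD[OF F that] by (auto simp: residual_def insert_commute)
  have bdH: "bd g E X = arc_edges H"
  proof
    show "arc_edges H \<subseteq> bd g E X"
    proof clarify
      fix u e v assume "(u, e, v) \<in> H"
      then have "e \<in> E" "g e = {u, v}" "u \<in> X" "v \<notin> X" using arcsetD[OF F] by (auto simp: H_def)
      then show "e \<in> bd g E X" by (simp add: bd_def)
    qed
    show "bd g E X \<subseteq> arc_edges H"
    proof
      fix e assume e: "e \<in> bd g E X"
      then obtain u v where uv: "g e = {u, v}" "u \<in> X" "v \<notin> X" "e \<in> E"
        using bd_cases[OF gl e] by blast
      have "e \<in> arc_edges F"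
        using cl[of u e v] uv by (auto simp: residual_def)
      then obtain x y where xy: "(x, e, y) \<in> F" by auto
      then have "{x, y} = {u, v}" using arcsetD(2)[OF F xy] uv(1) by simp
      moreover have "\<not> (x = v \<and> y = u)" using uv noin[OF xy] by auto
      ultimately have "x = u" "y = v" unfolding doubleton_eq_iff by blast+
      with xy uv have "(u, e, v) \<in> H" by (simp add: H_def)
      then show "e \<in> arc_edges H" by force
    qed
  qed
  have "net F X = (\<Sum>(u, e, v)\<in>H. 1)"
    unfolding net_def
  proof (rule sum.mono_neutral_cong_right[OF fin])
    show "H \<subseteq> F" by (auto simp: H_def)
    show "\<forall>a\<in>F - H. (case a of (u, e, v) \<Rightarrow> of_bool (u \<in> X) - of_bool (v \<in> X)) = (0::int)"
    proof clarify
      fix u e v assume "(u, e, v) \<in> F" "(u, e, v) \<notin> H"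
      then show "of_bool (u \<in> X) - of_bool (v \<in> X) = (0::int)"
        using noin[of u e v] by (cases "u \<in> X"; cases "v \<in> X") (simp_all add: H_def)
    qed
    show "\<And>a. a \<in> H \<Longrightarrow> (case a of (u, e, v) \<Rightarrow> of_bool (u \<in> X) - of_bool (v \<in> X)) = (case a of (u, e, v) \<Rightarrow> (1::int))"
      by (auto simp: H_def)
  qed
  also have "\<dots> = int (card H)" by (simp add: case_prod_unfold)
  also have "card H = card (arc_edges H)"
    by (rule card_image[symmetric]) (use F in \<open>auto simp: arcset_def H_def inj_on_def\<close>)
  finally show ?thesis using bdH fin by (auto simp: H_def intro: finite_subset)
qed

lemma flow_augment:
  assumes "flow g E S D F" "net F S = int j" "j < k" "S \<inter> D = {}" "graphlike g E"
    and cut: "\<And>X. \<lbrakk>S \<subseteq> X; X \<inter> D = {}; finite (bd g E X)\<rbrakk> \<Longrightarrow> k \<le> card (bd g E X)"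
  shows "\<exists>F'. flow g E S D F' \<and> net F' S = int (Suc j)"
proof -
  have "\<exists>u\<in>S. \<exists>ps. lwalk (residual g E S F) D u ps \<and> simple u ps"
  proof (rule lwalk_exists)
    fix X assume X: "S \<subseteq> X" "\<And>x e y. \<lbrakk>x \<in> X; x \<notin> D; residual g E S F x e y\<rbrakk> \<Longrightarrow> y \<in> X"
    show "X \<inter> D \<noteq> {}"
    proof
      assume XD: "X \<inter> D = {}"
      have "finite (bd g E X) \<and> int (card (bd g E X)) = net F X"
      proof (rule card_bd_flow)
        show "arcset g E F" using assms by (simp add: flow_def)
        show "graphlike g E" by fact
        \<comment> \<open>Steps into \<open>S\<close>, which \<open>residual g E S F\<close> leaves
          out, cannot leave \<open>X\<close> since \<open>S \<subseteq> X\<close>.\<close>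
        fix u e v assume "u \<in> X" "residual g E {} F u e v"
        then have "u \<notin> D" "v \<notin> S \<Longrightarrow> residual g E S F u e v" using XD by (auto simp: residual_def)
        then show "v \<in> X" using X(1) X(2)[of u e v] \<open>u \<in> X\<close> by blast
      qed
      then show False using cut[OF X(1) XD] net_closed[OF assms(1) X(1) XD] assms by simp
    qed
  qed
  then obtain u ps where ps: "u \<in> S" "lwalk (residual g E S F) D u ps" "simple u ps" by blast
  then obtain F' where F': "arcset g E F'"
    "\<And>X. net F' X = net F X + of_bool (u \<in> X) - of_bool (wend u ps \<in> X)"
    using augment[of g E F] assms(1) by (metis flow_def)
  have "wend u ps \<in> D" using ps lwalk_wend by fast
  then have "wend u ps \<notin> S" using assms by auto
  then show ?thesis using F' ps assms \<open>wend u ps \<in> D\<close>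
    by (intro exI[of _ F']) (auto simp: flow_def)
qed

lemma flow_exists:
  assumes "S \<inter> D = {}" "graphlike g E"
    and cut: "\<And>X. \<lbrakk>S \<subseteq> X; X \<inter> D = {}; finite (bd g E X)\<rbrakk> \<Longrightarrow> k \<le> card (bd g E X)"
    and "j \<le> k"
  shows "\<exists>F. flow g E S D F \<and> net F S = int j"
  using \<open>j \<le> k\<close>
proof (induction j)
  case 0
  show ?case by (intro exI[of _ "{}"]) (auto simp: flow_def arcset_def net_def)
next
  case (Suc j)
  then obtain F where "flow g E S D F" "net F S = int j" by auto
  then show ?case using flow_augment[of g E S D F j k] assms Suc.prems by auto
qed

lemma flow_path_remove:
  assumes "arcset g E F" "lwalk (\<lambda>u e v. (u, e, v) \<in> F \<and> v \<notin> S) D u ps" "simple u ps"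
  shows "\<exists>F'\<subseteq>F. arc_edges F' = arc_edges F - pedges ps
    \<and> (\<forall>X. net F' X = net F X - of_bool (u \<in> X) + of_bool (wend u ps \<in> X))"
  using assms
proof (induction ps arbitrary: F u)
  case Nil
  then show ?case by auto
next
  case (Cons p ps)
  obtain e v where p: "p = (e, v)" by (cases p)
  have fin: "finite F" using Cons.prems by (auto simp: arcset_def)
  define F1 where "F1 = F - {(u, e, v)}"
  have in_F: "(u, e, v) \<in> F" using Cons.prems p by auto
  have ae: "arc_edges F1 = arc_edges F - {e}"
  proof
    show "arc_edges F - {e} \<subseteq> arc_edges F1"
    proof
      fix x assume "x \<in> arc_edges F - {e}"
      then obtain a b where "(a, x, b) \<in> F" "x \<noteq> e" by auto
      then have "(a, x, b) \<in> F1" by (auto simp: F1_def)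
      then show "x \<in> arc_edges F1" by force
    qed
    show "arc_edges F1 \<subseteq> arc_edges F - {e}"
    proof clarsimp
      fix a x b assume "(a, x, b) \<in> F1"
      then show "x \<in> arc_edges F \<and> x \<noteq> e"
        using arcset_unique[OF Cons.prems(1) in_F, of a b] unfolding F1_def by (cases "x = e") force+
    qed
  qed
  have net1: "net F1 X = net F X - of_bool (u \<in> X) + of_bool (v \<in> X)" for X
    using net_remove[OF fin in_F] by (simp add: F1_def)
  have arc1: "arcset g E F1" using Cons.prems(1) by (auto simp: F1_def arcset_def inj_on_def)
  have "lwalk (\<lambda>u e v. (u, e, v) \<in> F1 \<and> v \<notin> S) D x qs"
    if "lwalk (\<lambda>u e v. (u, e, v) \<in> F \<and> v \<notin> S) D x qs" "u \<notin> pverts x qs" for x qs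
    using that by (induction "\<lambda>u e v. (u, e, v) \<in> F \<and> v \<notin> S" D x qs rule: lwalk.induct)
      (auto simp: F1_def)
  then have "lwalk (\<lambda>u e v. (u, e, v) \<in> F1 \<and> v \<notin> S) D v ps" using Cons.prems p by auto
  from Cons.IH[OF arc1 this] Cons.prems p obtain F' where
    "F' \<subseteq> F1" "arc_edges F' = arc_edges F1 - pedges ps"
    "\<forall>X. net F' X = net F1 X - of_bool (v \<in> X) + of_bool (wend v ps \<in> X)" by auto
  moreover have "arc_edges F - {e} - pedges ps = arc_edges F - pedges (p # ps)"
    unfolding p list.set image_insert fst_conv by blast
  ultimately show ?case using net1 p ae F1_def
    by (intro exI[of _ F']) auto
qed

lemma arcset_subset: "arcset g E F \<Longrightarrow> F' \<subseteq> F \<Longrightarrow> arcset g E F'"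
  unfolding arcset_def by (meson finite_subset inj_on_subset subset_iff)

definition link where
  "link g E S D u ps \<longleftrightarrow> u \<in> S \<and> lwalk (joins g E) D u ps \<and> simple u ps \<and> snd ` set ps \<inter> S = {}"

lemma lwalk_snd_pred: "lwalk (\<lambda>u e v. P u e v \<and> v \<notin> S) D u ps \<Longrightarrow> snd ` set ps \<inter> S = {}"
  by (induction "\<lambda>u e v. P u e v \<and> v \<notin> S" D u ps rule: lwalk.induct) auto

lemma lwalk_pedges_arc:
  "lwalk (\<lambda>u e v. (u, e, v) \<in> F \<and> v \<notin> S) D u ps \<Longrightarrow> pedges ps \<subseteq> arc_edges F"
  by (induction "\<lambda>u e v. (u, e, v) \<in> F \<and> v \<notin> S" D u ps rule: lwalk.induct) force+

text \<open>While the net outflow of \<open>S\<close> is positive, arcs lead from \<open>S\<close>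
  to \<open>D\<close>: otherwise the set reached along arcs has no leaving arc and hence no positive
  net outflow. Circulations remaining in \<open>F\<close> are simply left behind.\<close>

lemma flow_decompose:
  assumes "flow g E S D F" "net F S = int k" "S \<inter> D = {}"
  shows "\<exists>u ps. (\<forall>i<k. link g E S D (u i) (ps i) \<and> pedges (ps i) \<subseteq> arc_edges F)
     \<and> (\<forall>i<k. \<forall>j<k. i \<noteq> j \<longrightarrow> pedges (ps i) \<inter> pedges (ps j) = {})"
  using assms
proof (induction k arbitrary: F)
  case 0
  then show ?case by simp
next
  case (Suc k)
  let ?st = "\<lambda>u e v. (u, e, v) \<in> F \<and> v \<notin> S"
  have "\<exists>u\<in>S. \<exists>ps. lwalk ?st D u ps \<and> simple u ps"
  proof (rule lwalk_exists)
    fix X assume X: "S \<subseteq> X" "\<And>x e y. \<lbrakk>x \<in> X; x \<notin> D; ?st x e y\<rbrakk> \<Longrightarrow> y \<in> X"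
    show "X \<inter> D \<noteq> {}"
    proof
      assume XD: "X \<inter> D = {}"
      have "net F X \<le> 0" unfolding net_def
      proof (rule sum_nonpos, clarify)
        fix u e v assume "(u, e, v) \<in> F"
        then have "v \<in> X" if "u \<in> X" using X(1) X(2)[of u e v] XD that by blast
        then show "of_bool (u \<in> X) - of_bool (v \<in> X) \<le> (0::int)" by auto
      qed
      with net_closed[OF Suc.prems(1) X(1) XD] Suc.prems show False by simp
    qed
  qed
  then obtain u ps where ps: "u \<in> S" "lwalk ?st D u ps" "simple u ps" by blast
  have arc: "arcset g E F" using Suc.prems by (simp add: flow_def)
  obtain F' where F': "F' \<subseteq> F" "arc_edges F' = arc_edges F - pedges ps"
    "\<And>X. net F' X = net F X - of_bool (u \<in> X) + of_bool (wend u ps \<in> X)"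
    using flow_path_remove[OF arc ps(2,3)] by blast
  have wD: "wend u ps \<in> D" using ps lwalk_wend by fast
  then have wS: "wend u ps \<notin> S" using Suc.prems by auto
  have "flow g E S D F'" using F' arcset_subset[OF arc F'(1)] Suc.prems ps wD
    by (auto simp: flow_def)
  moreover have "net F' S = int k" using F' ps wS Suc.prems by simp
  ultimately obtain u' ps' where IH: "\<forall>i<k. link g E S D (u' i) (ps' i) \<and> pedges (ps' i) \<subseteq> arc_edges F'"
    "\<forall>i<k. \<forall>j<k. i \<noteq> j \<longrightarrow> pedges (ps' i) \<inter> pedges (ps' j) = {}"
    using Suc.IH Suc.prems(3) by blast
  have "joins g E x e y" if "(x, e, y) \<in> F" for x e y
    using arcsetD[OF arc that] by (simp add: joins_def)
  then have "lwalk (joins g E) D u ps"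
    using lwalk_mono[OF ps(2)] by blast
  then have l: "link g E S D u ps" using ps lwalk_snd_pred[OF ps(2)] by (simp add: link_def)
  have sub: "pedges ps \<subseteq> arc_edges F" using lwalk_pedges_arc[OF ps(2)] .
  have dis: "pedges (ps' i) \<inter> pedges ps = {}" if "i < k" for i
  proof -
    have "pedges (ps' i) \<subseteq> arc_edges F - pedges ps" using IH(1) that F'(2) by simp
    then show ?thesis by blast
  qed
  show ?case
  proof (intro exI conjI)
    show "\<forall>i<Suc k. link g E S D ((u'(k := u)) i) ((ps'(k := ps)) i) \<and> pedges ((ps'(k := ps)) i) \<subseteq> arc_edges F"
    proof (intro allI impI)
      fix i assume "i < Suc k"
      then consider "i < k" | "i = k" by linarith
      then show "link g E S D ((u'(k := u)) i) ((ps'(k := ps)) i) \<and> pedges ((ps'(k := ps)) i) \<subseteq> arc_edges F"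
      proof cases
        case 1
        then have "link g E S D (u' i) (ps' i)" "pedges (ps' i) \<subseteq> arc_edges F'"
          using IH(1) by blast+
        moreover have "arc_edges F' \<subseteq> arc_edges F" unfolding F'(2) by blast
        ultimately show ?thesis using 1 order_trans[of "pedges (ps' i)" "arc_edges F'"] by simp
      next
        case 2
        then show ?thesis using l sub by simp
      qed
    qed
    show "\<forall>i<Suc k. \<forall>j<Suc k. i \<noteq> j \<longrightarrow> pedges ((ps'(k := ps)) i) \<inter> pedges ((ps'(k := ps)) j) = {}"
    proof (intro allI impI)
      fix i j assume "i < Suc k" "j < Suc k" "i \<noteq> j"
      then consider "i < k" "j < k" | "i = k" "j < k" | "i < k" "j = k" by linarith
      then show "pedges ((ps'(k := ps)) i) \<inter> pedges ((ps'(k := ps)) j) = {}"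
        using IH(2) dis \<open>i \<noteq> j\<close> by cases (simp_all, blast+)
    qed
  qed
qed

text \<open>Edge version for arbitrary, possibly infinite graphs and sets \<open>S\<close> and
  \<open>D\<close>. It suffices that finite cuts are large, because the cut obtained from a failed
  augmentation is automatically finite.\<close>

theorem menger:
  assumes "S \<inter> D = {}" "graphlike g E"
    and "\<And>X. \<lbrakk>S \<subseteq> X; X \<inter> D = {}; finite (bd g E X)\<rbrakk> \<Longrightarrow> k \<le> card (bd g E X)"
  obtains u ps where "\<And>i. i < k \<Longrightarrow> link g E S D (u i) (ps i)"
    "\<And>i j. \<lbrakk>i < k; j < k; i \<noteq> j\<rbrakk> \<Longrightarrow> pedges (ps i) \<inter> pedges (ps j) = {}"
proof -
  obtain F where F: "flow g E S D F" "net F S = int k" using flow_exists[OF assms, of k] by auto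
  from flow_decompose[OF F assms(1)] obtain u ps
    where *: "\<forall>i<k. link g E S D (u i) (ps i) \<and> pedges (ps i) \<subseteq> arc_edges F"
      "\<forall>i<k. \<forall>j<k. i \<noteq> j \<longrightarrow> pedges (ps i) \<inter> pedges (ps j) = {}"
    by (elim exE conjE)
  show thesis by (rule that[of u ps]) (simp_all add: *)
qed


section \<open>Cuts\<close>

lemma bd_Compl: "bd g E (- X) = bd g E X"
  by (auto simp: bd_def)

lemma bd_Int_subset: "bd g E (X \<inter> Y) \<subseteq> bd g E X \<union> bd g E Y"
  by (auto simp: bd_def)

lemma bd_Diff_subset: "bd g E (X - Y) \<subseteq> bd g E X \<union> bd g E Y"
  using bd_Int_subset[of g E X "- Y"] by (simp add: bd_Compl Diff_eq)

lemma bd_Diff_edges: "bd g (E - P) X = bd g E X - P"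
  by (auto simp: bd_def)

text \<open>Both new boundaries lie in the union of the old ones, and an edge in both new boundaries
  joins \<open>X \<inter> Y\<close> to the outside of \<open>X \<union> Y\<close>, so it is in both
  old ones. Inclusion-exclusion then does the counting.\<close>

lemma submodular:
  assumes "graphlike g E" "finite (bd g E X)" "finite (bd g E Y)"
  shows "card (bd g E (X \<inter> Y)) + card (bd g E (X \<union> Y)) \<le> card (bd g E X) + card (bd g E Y)"
proof -
  let ?I = "bd g E (X \<inter> Y)" and ?U = "bd g E (X \<union> Y)"
  have U: "?U \<subseteq> bd g E X \<union> bd g E Y" by (auto simp: bd_def)
  have fin: "finite ?I" "finite ?U"
    using finite_subset[OF bd_Int_subset] finite_subset[OF U] assms by auto
  have "?I \<inter> ?U \<subseteq> bd g E X \<inter> bd g E Y"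
  proof
    fix e assume e: "e \<in> ?I \<inter> ?U"
    then obtain u v where "e \<in> E" "g e = {u, v}" "u \<in> X \<inter> Y" "v \<notin> X \<inter> Y"
      using bd_cases[OF assms(1)] by (metis IntD1)
    with e show "e \<in> bd g E X \<inter> bd g E Y" by (auto simp: bd_def)
  qed
  then have "card (?I \<inter> ?U) \<le> card (bd g E X \<inter> bd g E Y)"
    using assms by (intro card_mono) auto
  moreover have "card (?I \<union> ?U) \<le> card (bd g E X \<union> bd g E Y)"
    using assms U bd_Int_subset[of g E X Y] by (intro card_mono) auto
  ultimately show ?thesis using card_Un_Int[of ?I ?U] card_Un_Int[of "bd g E X" "bd g E Y"] fin assms
    by linarith
qed

text \<open>This is submodularity for \<open>X\<close> and the complement of \<open>Y\<close>, as
  complementary sets have the same boundary.\<close>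

lemma posimodular:
  assumes "graphlike g E" "finite (bd g E X)" "finite (bd g E Y)"
  shows "card (bd g E (X - Y)) + card (bd g E (Y - X)) \<le> card (bd g E X) + card (bd g E Y)"
proof -
  have "bd g E (X \<union> - Y) = bd g E (Y - X)"
    using bd_Compl[of g E "Y - X"] by (simp add: Diff_eq Un_commute)
  then show ?thesis using submodular[OF assms(1,2), of "- Y"] assms(3)
    by (simp add: bd_Compl Diff_eq[symmetric])
qed

lemma even_card_sym_diff:
  assumes "finite A" "finite B"
  shows "even (card ((A - B) \<union> (B - A))) \<longleftrightarrow> even (card A + card B)"
proof -
  have "card ((A - B) \<union> (B - A)) = card (A - B) + card (B - A)"
    by (rule card_Un_disjoint) (use assms in auto)
  moreover have "card A = card (A - B) + card (A \<inter> B)" "card B = card (B - A) + card (B \<inter> A)"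
    by (metis card_Int_Diff assms add.commute)+
  ultimately have *: "card A + card B = card ((A - B) \<union> (B - A)) + 2 * card (A \<inter> B)"
    unfolding Int_commute[of B A] by linarith
  show ?thesis unfolding * by simp
qed

text \<open>The boundary is linear modulo 2; this is the source of all parity arguments about pairs
  of cuts.\<close>

lemma bd_sym_diff:
  assumes "graphlike g E"
  shows "bd g E ((X - Y) \<union> (Y - X)) = (bd g E X - bd g E Y) \<union> (bd g E Y - bd g E X)"
proof -
  have "e \<in> bd g E ((X - Y) \<union> (Y - X)) \<longleftrightarrow> e \<in> (bd g E X - bd g E Y) \<union> (bd g E Y - bd g E X)"
    if e: "e \<in> E" for e
  proof -
    obtain u v where "g e = {u, v}" using assms e unfolding graphlike_def by blast
    with e show ?thesis by (auto simp: bd_def)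
  qed
  moreover have "e \<in> E" if "e \<in> bd g E Z" for e Z using that by (simp add: bd_def)
  ultimately show ?thesis by (metis (no_types, lifting) DiffD1 UnE subsetI subset_antisym)
qed

lemma card_le_disjoint_family:
  assumes "finite B" "finite I" "\<And>i. i \<in> I \<Longrightarrow> f i \<inter> B \<noteq> {}"
    "\<And>i j. \<lbrakk>i \<in> I; j \<in> I; i \<noteq> j\<rbrakk> \<Longrightarrow> f i \<inter> f j = {}"
  shows "card I \<le> card B"
proof -
  obtain c where c: "\<And>i. i \<in> I \<Longrightarrow> c i \<in> f i \<inter> B" using assms(3) by (meson all_not_in_conv)
  show ?thesis
  proof (rule card_inj_on_le[of c])
    show "inj_on c I" using c assms(4) by (fastforce intro!: inj_onI)
    show "c ` I \<subseteq> B" using c by auto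
  qed (use assms in auto)
qed

text \<open>Pigeonhole with equality: \<open>k\<close> disjoint sets that meet a
  \<open>k\<close>-set meet it once each and cover it. For a Menger system and a minimum cut this
  says that every cut edge lies on a path that crosses the cut nowhere else.\<close>

lemma disjoint_family_cover:
  assumes "finite B" "card B = k" "\<And>i. i < k \<Longrightarrow> f i \<inter> B \<noteq> {}"
    "\<And>i j. \<lbrakk>i < k; j < k; i \<noteq> j\<rbrakk> \<Longrightarrow> f i \<inter> f j = {}" "b \<in> B"
  shows "\<exists>i<k. f i \<inter> B = {b}"
proof -
  obtain c where c: "\<And>i. i < k \<Longrightarrow> c i \<in> f i \<inter> B" using assms(3) by (meson all_not_in_conv)
  have inj: "inj_on c {..<k}" using c assms(4) by (fastforce intro!: inj_onI)
  have "c ` {..<k} = B"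
    by (rule card_subset_eq) (use assms c inj in \<open>auto simp: card_image\<close>)
  then have ex: "\<exists>i<k. x = c i" if "x \<in> B" for x using that by auto
  obtain i where i: "i < k" "b = c i" using ex assms(5) by blast
  have "x = b" if x: "x \<in> f i \<inter> B" for x
  proof -
    obtain j where j: "j < k" "x = c j" using ex[of x] x by auto
    then have "x \<in> f j" using c by blast
    then show ?thesis using assms(4)[OF i(1) j(1)] x i j by blast
  qed
  then show ?thesis using c i by blast
qed

section \<open>Walks\<close>

fun walk :: "('e \<Rightarrow> 'v set) \<Rightarrow> 'e set \<Rightarrow> 'v \<Rightarrow> ('e \<times> 'v) list \<Rightarrow> bool" where
  "walk g E u [] \<longleftrightarrow> True"
| "walk g E u ((e, v) # ps) \<longleftrightarrow> e \<in> E \<and> g e = {u, v} \<and> walk g E v ps"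

lemma lwalk_iff:
  assumes "simple u ps"
  shows "lwalk (joins g E) D u ps \<longleftrightarrow> walk g E u ps \<and> pverts u ps \<inter> D = {wend u ps}"
  using assms
proof (induction ps arbitrary: u)
  case Nil
  then show ?case by auto
next
  case (Cons p ps)
  obtain e v where p: "p = (e, v)" by (cases p)
  have "u \<noteq> wend v ps" "wend v ps \<in> pverts v ps" using Cons.prems p wend_in_pverts[of v ps] by auto
  then have "pverts u (p # ps) \<inter> D = {wend u (p # ps)} \<longleftrightarrow> u \<notin> D \<and> pverts v ps \<inter> D = {wend v ps}"
    unfolding p by auto
  then show ?case using Cons p by (auto simp: joins_def)
qed

lemma link_iff:
  "link g E S D u ps \<longleftrightarrow> walk g E u ps \<and> simple u ps \<and> pverts u ps \<inter> S = {u} \<and> pverts u ps \<inter> D = {wend u ps}"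
proof -
  have "u \<in> S \<and> snd ` set ps \<inter> S = {} \<longleftrightarrow> pverts u ps \<inter> S = {u}" if "simple u ps"
    using that by (auto simp: simple_def)
  then show ?thesis using lwalk_iff[of u ps g E D] by (auto simp: link_def)
qed

lemma walk_edges: "walk g E u ps \<Longrightarrow> pedges ps \<subseteq> E"
  by (induction g E u ps rule: walk.induct) auto

lemma walk_edge_verts: "walk g E u ps \<Longrightarrow> e \<in> pedges ps \<Longrightarrow> g e \<subseteq> pverts u ps"
  by (induction g E u ps rule: walk.induct) auto

lemma walk_cong:
  assumes "walk g E u ps" "\<And>e. e \<in> pedges ps \<Longrightarrow> e \<in> E' \<and> g' e = g e"
  shows "walk g' E' u ps"
  using assms by (induction g E u ps rule: walk.induct) auto

lemma walk_suffix:
  assumes "walk g E u ps" "simple u ps" "z \<in> pverts u ps"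
  shows "\<exists>qs. walk g E z qs \<and> simple z qs \<and> pverts z qs \<subseteq> pverts u ps \<and> pedges qs \<subseteq> pedges ps
    \<and> wend z qs = wend u ps"
  using assms
proof (induction g E u ps rule: walk.induct)
  case (1 g E u)
  then show ?case by (intro exI[of _ "[]"]) auto
next
  case (2 g E u e v ps)
  show ?case
  proof (cases "z = u")
    case True
    with 2 show ?thesis by (intro exI[of _ "(e, v) # ps"]) auto
  next
    case False
    then have "z \<in> pverts v ps" using 2 by auto
    with 2 obtain qs where "walk g E z qs \<and> simple z qs \<and> pverts z qs \<subseteq> pverts v ps \<and> pedges qs \<subseteq> pedges ps
      \<and> wend z qs = wend v ps" by auto
    then show ?thesis by (intro exI[of _ qs]) auto
  qed
qed

fun prev :: "'v \<Rightarrow> ('e \<times> 'v) list \<Rightarrow> ('e \<times> 'v) list" where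
  "prev u [] = []"
| "prev u ((e, v) # ps) = prev v ps @ [(e, u)]"

lemma wend_append [simp]: "wend u (ps @ qs) = wend (wend u ps) qs"
  by (induction u ps rule: wend.induct) auto

lemma walk_append [simp]: "walk g E u (ps @ qs) \<longleftrightarrow> walk g E u ps \<and> walk g E (wend u ps) qs"
  by (induction g E u ps rule: walk.induct) auto

lemma wend_prev [simp]: "wend (wend u ps) (prev u ps) = u"
  by (induction u ps rule: prev.induct) auto

lemma walk_prev: "walk g E u ps \<Longrightarrow> walk g E (wend u ps) (prev u ps)"
  by (induction u ps rule: prev.induct) (auto simp: insert_commute)

lemma pedges_prev [simp]: "pedges (prev u ps) = pedges ps"
  by (induction u ps rule: prev.induct) auto

lemma map_snd_prev: "wend u ps # map snd (prev u ps) = rev (u # map snd ps)"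
  by (induction u ps rule: prev.induct) auto

lemma simple_prev: "simple u ps \<Longrightarrow> simple (wend u ps) (prev u ps)"
  unfolding simple_def map_snd_prev by simp

lemma pverts_prev [simp]: "pverts (wend u ps) (prev u ps) = pverts u ps"
proof -
  have "pverts (wend u ps) (prev u ps) = set (wend u ps # map snd (prev u ps))" by simp
  also have "\<dots> = pverts u ps" unfolding map_snd_prev by simp
  finally show ?thesis .
qed

lemma prev_Nil [simp]: "prev u ps = [] \<longleftrightarrow> ps = []"
  by (cases "(u, ps)" rule: prev.cases) auto

lemma walk_crosses:
  assumes "walk g E u ps" "u \<in> X" "wend u ps \<notin> X"
  shows "\<exists>e\<in>pedges ps. e \<in> bd g E X"
  using assms
proof (induction g E u ps rule: walk.induct)
  case (2 g E u e v ps)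
  then show ?case
    by (cases "v \<in> X") (auto simp: bd_def)
qed auto

text \<open>When only one edge of the walk can cross the boundary of \<open>D\<close>, this locates
  the end of the walk at an endvertex of that edge.\<close>

lemma walk_last:
  assumes "walk g E u ps" "pverts u ps \<inter> D = {wend u ps}" "simple u ps" "ps \<noteq> []"
  shows "\<exists>e\<in>pedges ps. e \<in> bd g E D \<and> wend u ps \<in> g e"
  using assms
proof (induction g E u ps rule: walk.induct)
  case (2 g E u e v ps)
  have u: "u \<noteq> wend v ps" using 2 wend_in_pverts[of v ps] by auto
  then have uD: "u \<notin> D" using 2 by auto
  show ?case
  proof (cases "ps = []")
    case True
    then show ?thesis using 2 uD by (auto simp: bd_def)
  next
    case False
    have "pverts v ps \<inter> D = {wend v ps}" using 2 uD by auto
    then show ?thesis using 2 False by auto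
  qed
qed auto

text \<open>Simple walks have no loops, so an edge inside \<open>D\<close> would put two vertices of
  the walk into \<open>D\<close>. This later tells apart the edges of linkages at different
  levels.\<close>

lemma walk_edges_meet:
  assumes "walk g E u ps" "pverts u ps \<inter> D = {wend u ps}" "simple u ps" "e \<in> pedges ps"
  shows "\<not> g e \<subseteq> D"
  using assms
proof (induction g E u ps rule: walk.induct)
  case (2 g E u e' v ps)
  have u: "u \<noteq> wend v ps" using 2 wend_in_pverts[of v ps] by auto
  then have uD: "u \<notin> D" using 2 by auto
  then have "pverts v ps \<inter> D = {wend v ps}" using 2 by auto
  then show ?case using 2 by auto
qed auto

text \<open>Each step in which membership in \<open>X\<close> changes is one crossing; simplicity
  ensures that no edge occurs twice, so counting edges counts crossings.\<close>

lemma even_crossings: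
  assumes "walk g E u ps" "simple u ps"
  shows "even (card (bd g E X \<inter> pedges ps)) \<longleftrightarrow> (u \<in> X) = (wend u ps \<in> X)"
  using assms
proof (induction g E u ps rule: walk.induct)
  case (2 g E u e v ps)
  have "e \<notin> pedges ps" using 2 walk_edge_verts[of g E v ps e] by auto
  moreover have "bd g E X \<inter> pedges ((e, v) # ps) = (if (u \<in> X) = (v \<in> X) then bd g E X \<inter> pedges ps
      else insert e (bd g E X \<inter> pedges ps))"
    using 2 by (auto simp: bd_def)
  ultimately show ?case using 2 by auto
qed auto

section \<open>Terminal paths\<close>

definition tpath :: "('e \<Rightarrow> 'v set) \<Rightarrow> 'e set \<Rightarrow> 'v set \<Rightarrow> 'v \<Rightarrow> ('e \<times> 'v) list \<Rightarrow> bool" where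
  "tpath g E T u ps \<longleftrightarrow> walk g E u ps \<and> simple u ps \<and> ps \<noteq> [] \<and> pverts u ps \<inter> T = {u, wend u ps}"

lemma simple_wend_neq: "simple u ps \<Longrightarrow> ps \<noteq> [] \<Longrightarrow> wend u ps \<noteq> u"
  by (cases ps) (use wend_in_pverts in \<open>fastforce+\<close>)

lemma tpath_prev: "tpath g E T u ps \<Longrightarrow> tpath g E T (wend u ps) (prev u ps)"
  by (auto simp: tpath_def walk_prev simple_prev simp del: insert_iff)

lemma tpath_start:
  assumes "tpath g E T u ps"
  shows "\<exists>e. bd g E {u} \<inter> pedges ps = {e}"
proof -
  obtain e v qs where ps: "ps = (e, v) # qs" using assms by (cases ps) (auto simp: tpath_def)
  have "u \<notin> g e'" if "e' \<in> pedges qs" for e'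
    using that walk_edge_verts[of g E v qs] assms ps by (auto simp: tpath_def)
  then have "bd g E {u} \<inter> pedges ps = {e}" using assms ps by (auto simp: tpath_def bd_def)
  then show ?thesis by blast
qed

lemma tpath_end:
  assumes "tpath g E T u ps"
  shows "\<exists>e. bd g E {wend u ps} \<inter> pedges ps = {e}"
  using tpath_start[OF tpath_prev[OF assms]] by simp

lemma tpath_degree:
  assumes "tpath g E T u ps" "r \<in> T"
  shows "card (bd g E {r} \<inter> pedges ps) = of_bool (r = u \<or> r = wend u ps)"
proof (cases "r = u \<or> r = wend u ps")
  case True
  then show ?thesis using tpath_start[OF assms(1)] tpath_end[OF assms(1)] by auto
next
  case False
  then have "r \<notin> pverts u ps" using assms by (auto simp: tpath_def)
  then have "bd g E {r} \<inter> pedges ps = {}"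
    using walk_edge_verts[of g E u ps] assms by (fastforce simp: tpath_def bd_def)
  then show ?thesis using False by simp
qed

text \<open>The invariant of path removal: the star of each terminal is a minimum cut between it and
  the other terminals. By Menger's theorem as many edge-disjoint paths then leave the terminal as it
  has edges.\<close>

definition linked :: "('e \<Rightarrow> 'v set) \<Rightarrow> 'e set \<Rightarrow> 'v set \<Rightarrow> bool" where
  "linked g E T \<longleftrightarrow> (\<forall>r\<in>T. \<forall>X. X \<inter> T = {r} \<longrightarrow> finite (bd g E X) \<longrightarrow> card (bd g E {r}) \<le> card (bd g E X))"

definition inner_even :: "('e \<Rightarrow> 'v set) \<Rightarrow> 'e set \<Rightarrow> 'v set \<Rightarrow> bool" where
  "inner_even g E T \<longleftrightarrow> (\<forall>X. X \<inter> T = {} \<longrightarrow> finite (bd g E X) \<longrightarrow> even (card (bd g E X)))"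

definition good :: "('e \<Rightarrow> 'v set) \<Rightarrow> 'e set \<Rightarrow> 'v set \<Rightarrow> bool" where
  "good g E T \<longleftrightarrow> graphlike g E \<and> (\<forall>r\<in>T. finite (bd g E {r})) \<and> inner_even g E T \<and> linked g E T"

lemma linkedD:
  "\<lbrakk>linked g E T; X \<inter> T = {r}; finite (bd g E X)\<rbrakk> \<Longrightarrow> card (bd g E {r}) \<le> card (bd g E X)"
  unfolding linked_def by blast

text \<open>\<open>X\<close> and \<open>{r}\<close> differ by the terminal-free set
  \<open>X - {r}\<close>, whose boundary is even, and boundaries add modulo 2.\<close>

lemma good_parity:
  assumes "good g E T" "X \<inter> T = {r}" "finite (bd g E X)"
  shows "even (card (bd g E X) + card (bd g E {r}))"
proof -
  have r: "r \<in> X" "r \<in> T" using assms by auto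
  have fr: "finite (bd g E {r})" and gl: "graphlike g E" using assms r by (auto simp: good_def)
  have "finite (bd g E (X - {r}))" using assms(3) fr bd_Diff_subset[of g E X "{r}"]
    by (meson finite_UnI finite_subset)
  moreover have "(X - {r}) \<inter> T = {}" using assms by auto
  ultimately have "even (card (bd g E (X - {r})))" using assms by (auto simp: good_def inner_even_def)
  moreover have "X - {r} = (X - {r}) \<union> ({r} - X)" using r by auto
  ultimately show ?thesis using bd_sym_diff[OF gl, of X "{r}"] even_card_sym_diff[OF assms(3) fr] by simp
qed

lemma degree_remove:
  assumes "tpath g E T u ps" "r \<in> T" "finite (bd g E {r})"
  shows "card (bd g (E - pedges ps) {r}) = card (bd g E {r}) - of_bool (r = u \<or> r = wend u ps)"
  unfolding bd_Diff_edges tpath_degree[OF assms(1,2), symmetric]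
  by (metis card_Diff_subset_Int finite_Int assms(3))

lemma finite_bd_remove: "finite (bd g (E - pedges ps) X) \<longleftrightarrow> finite (bd g E X)"
  unfolding bd_Diff_edges by simp

lemma graphlike_subset: "graphlike g E \<Longrightarrow> E' \<subseteq> E \<Longrightarrow> graphlike g E'"
  by (auto simp: graphlike_def)

text \<open>Parity survives because a terminal path has both ends outside a terminal-free set and so
  crosses its boundary an even number of times. Only \<open>linked\<close> must be supplied from
  outside.\<close>

lemma good_remove:
  assumes "good g E T" "tpath g E T u ps" "linked g (E - pedges ps) T"
  shows "good g (E - pedges ps) T"
  unfolding good_def
proof (intro conjI ballI assms(3))
  show "graphlike g (E - pedges ps)" using assms graphlike_subset[of g E] by (auto simp: good_def)
  show "finite (bd g (E - pedges ps) {r})" if "r \<in> T" for r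
    unfolding finite_bd_remove using assms that by (auto simp: good_def)
  show "inner_even g (E - pedges ps) T"
    unfolding inner_even_def finite_bd_remove
  proof (intro allI impI)
    fix X assume X: "X \<inter> T = {}" "finite (bd g E X)"
    then have "even (card (bd g E X))" using assms by (auto simp: good_def inner_even_def)
    moreover have "even (card (bd g E X \<inter> pedges ps))"
      using even_crossings[of g E u ps X] assms(2) X by (auto simp: tpath_def)
    moreover have "card (bd g E X) = card (bd g E X \<inter> pedges ps) + card (bd g E X - pedges ps)"
      by (metis card_Int_Diff X(2))
    ultimately show "even (card (bd g (E - pedges ps) X))" unfolding bd_Diff_edges by simp
  qed
qed

text \<open>A Menger system from \<open>r\<close> to the outside of the tight set \<open>Z\<close>
  uses every boundary edge of \<open>Z\<close>, so one of its paths leaves \<open>Z\<close> through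
  \<open>e\<close> and ends at \<open>t\<close>. The other \<open>k - 1\<close> paths keep all cuts
  inside \<open>Z\<close> large after its removal, and cuts that cross \<open>Z\<close> are handled
  by uncrossing.\<close>

lemma tight_path:
  assumes good: "good g E T" and tr: "t \<in> T" "r \<in> T" "t \<noteq> r" and Z: "Z \<inter> T = {r}" "finite (bd g E Z)"
    "card (bd g E Z) = card (bd g E {r})" and e: "e \<in> E" "g e = {t, v}" "v \<in> Z"
  shows "\<exists>ps. tpath g E T t ps \<and> linked g (E - pedges ps) T"
proof -
  have gl: "graphlike g E" and lk: "linked g E T" using good by (auto simp: good_def)
  have tZ: "t \<notin> Z" and rZ: "r \<in> Z" using Z tr by auto
  define k where "k = card (bd g E {r})"
  have "{r} \<inter> - Z = {}" using rZ by auto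
  moreover have "k \<le> card (bd g E X)" if "{r} \<subseteq> X" "X \<inter> - Z = {}" "finite (bd g E X)" for X
  proof -
    have "X \<inter> T = {r}" using that Z by auto
    then show ?thesis using linkedD[OF lk _ that(3)] by (simp add: k_def)
  qed
  ultimately obtain u ps where ps0: "\<And>i. i < k \<Longrightarrow> link g E {r} (- Z) (u i) (ps i)"
    and disj: "\<And>i j. \<lbrakk>i < k; j < k; i \<noteq> j\<rbrakk> \<Longrightarrow> pedges (ps i) \<inter> pedges (ps j) = {}"
    using menger[of "{r}" "- Z" g E k] gl by metis
  have ps: "walk g E r (ps i)" "simple r (ps i)" "pverts r (ps i) \<inter> - Z = {wend r (ps i)}" if "i < k" for i
    using ps0[OF that] by (auto simp: link_iff)
  have cross: "pedges (ps i) \<inter> bd g E Y \<noteq> {}" if "i < k" "r \<in> Y" "Y \<subseteq> Z" for i Y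
    using walk_crosses[of g E r "ps i" Y] ps[OF that(1)] that by blast
  have eZ: "e \<in> bd g E Z" using e tZ by (auto simp: bd_def)
  obtain i where i: "i < k" "pedges (ps i) \<inter> bd g E Z = {e}"
    using disjoint_family_cover[of "bd g E Z" k "\<lambda>i. pedges (ps i)" e] Z cross rZ disj eZ
    by (auto simp: k_def)
  define p where "p = ps i"
  have p: "walk g E r p" "simple r p" "pverts r p \<inter> - Z = {wend r p}" using ps[OF i(1)] by (auto simp: p_def)
  \<comment> \<open>The last edge of \<open>p\<close> crosses the boundary of \<open>Z\<close>, so
    it is \<open>e\<close>, whose only endvertex outside \<open>Z\<close> is
    \<open>t\<close>.\<close>
  have "p \<noteq> []" using p(3) rZ by auto
  then obtain e' where "e' \<in> pedges p" "e' \<in> bd g E (- Z)" "wend r p \<in> g e'"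
    using walk_last[OF p(1,3,2)] by blast
  then have "wend r p \<in> g e" using i by (auto simp: bd_Compl p_def)
  then have wt: "wend r p = t" using e p(3) by auto
  have pT: "pverts r p \<inter> T = {r, t}" using p(3) Z tr wt wend_in_pverts[of r p] by auto
  have inside: "g e' \<subseteq> Z" if "e' \<in> pedges p" "e' \<noteq> e" for e'
  proof (rule ccontr)
    assume "\<not> g e' \<subseteq> Z"
    moreover have "\<not> g e' \<subseteq> - Z" using walk_edges_meet[OF p(1,3,2)] that by blast
    ultimately have "e' \<in> bd g E Z" using that walk_edges[OF p(1)] by (auto simp: bd_def)
    then show False using that i by (auto simp: p_def)
  qed
  have tp': "tpath g E T r p" using p \<open>p \<noteq> []\<close> pT wt by (auto simp: tpath_def)
  have "linked g (E - pedges p) T"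
    unfolding linked_def finite_bd_remove
  proof (intro ballI allI impI)
    fix s X assume s: "s \<in> T" and X: "X \<inter> T = {s}" and fX: "finite (bd g E X)"
    let ?d = "\<lambda>Y. card (bd g (E - pedges p) Y)"
    have ds: "?d {s} = card (bd g E {s}) - of_bool (s = r \<or> s = t)"
      using degree_remove[OF tp' s] good s wt by (auto simp: good_def)
    have gl': "graphlike g (E - pedges p)" using gl by (rule graphlike_subset) auto
    have fX': "finite (bd g (E - pedges p) X)" and fZ': "finite (bd g (E - pedges p) Z)"
      using fX Z by (auto simp: finite_bd_remove)
    have dZ: "?d Z = k - 1"
      unfolding bd_Diff_edges using card_Diff_subset_Int[of "bd g E Z" "pedges p"] i Z
      by (simp add: k_def p_def Int_commute)
    \<comment> \<open>Sets around \<open>r\<close> inside \<open>Z\<close> are still crossed by the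
      \<open>k - 1\<close> remaining paths of the system.\<close>
    have inner: "k - 1 \<le> ?d Y" if "r \<in> Y" "Y \<subseteq> Z" "finite (bd g E Y)" for Y
    proof -
      have "card ({..<k} - {i}) \<le> card (bd g (E - pedges p) Y)"
      proof (rule card_le_disjoint_family[where f = "\<lambda>j. pedges (ps j)"])
        show "finite (bd g (E - pedges p) Y)" using that by (simp add: finite_bd_remove)
        fix j assume j: "j \<in> {..<k} - {i}"
        then have "pedges (ps j) \<inter> pedges p = {}" using disj i by (auto simp: p_def)
        then show "pedges (ps j) \<inter> bd g (E - pedges p) Y \<noteq> {}"
          using cross[of j Y] j that unfolding bd_Diff_edges by blast
      qed (use disj in auto)
      then show ?thesis using i by simp
    qed
    \<comment> \<open>All edges of \<open>p\<close> except \<open>e\<close> have both ends in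
      \<open>Z\<close>, so a set that contains or avoids \<open>Z\<close> can lose only
      \<open>e\<close>.\<close>
    have outer: "card (bd g E Y) - of_bool (e \<in> bd g E Y) \<le> ?d Y"
      if "finite (bd g E Y)" "Z \<subseteq> Y \<or> Z \<inter> Y = {}" for Y
    proof -
      have "bd g E Y \<inter> pedges p \<subseteq> (if e \<in> bd g E Y then {e} else {})"
        using inside that(2) by (fastforce simp: bd_def)
      then have "card (bd g E Y \<inter> pedges p) \<le> card (if e \<in> bd g E Y then {e} else {})"
        by (intro card_mono) auto
      also have "\<dots> = of_bool (e \<in> bd g E Y)" by auto
      finally show ?thesis unfolding bd_Diff_edges
        using card_Diff_subset_Int[of "bd g E Y" "pedges p"] that(1) by simp
    qed
    have fin2: "finite (bd g E (X \<inter> Z))" "finite (bd g E (X \<union> Z))" "finite (bd g E (X - Z))" "finite (bd g E (Z - X))"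
    proof -
      have "bd g E (X \<union> Z) \<subseteq> bd g E X \<union> bd g E Z" by (auto simp: bd_def)
      then show "finite (bd g E (X \<union> Z))" using fX Z by (meson finite_UnI finite_subset)
    qed (meson fX Z(2) finite_UnI finite_subset bd_Int_subset bd_Diff_subset)+
    \<comment> \<open>After the removal \<open>Z\<close> has boundary \<open>k - 1\<close>.
      Uncrossing gives a second set with boundary at least \<open>k - 1\<close>, so these terms
      cancel: for \<open>s = r\<close> the pair is union and intersection, for
      \<open>s \<noteq> r\<close> it is the two differences. In the latter case \<open>e\<close> is
      lost only if \<open>s = t\<close>, and then the degree of \<open>s\<close> has dropped as
      well.\<close>
    show "?d {s} \<le> ?d X"
    proof (cases "s = r")
      case True
      have "(X \<union> Z) \<inter> T = {r}" using X Z True by auto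
      then have "k \<le> card (bd g E (X \<union> Z))" using linkedD[OF lk _ fin2(2)] by (simp add: k_def)
      then have "k - 1 \<le> ?d (X \<union> Z)" using outer[OF fin2(2)] by (auto split: if_splits simp: of_bool_def)
      moreover have "k - 1 \<le> ?d (X \<inter> Z)" using inner[OF _ _ fin2(1)] X rZ True by auto
      ultimately show ?thesis using submodular[OF gl' fX' fZ'] dZ ds True by (simp add: k_def)
    next
      case False
      have sZ: "s \<notin> Z" using False Z s by auto
      have "(X - Z) \<inter> T = {s}" using X sZ by auto
      then have "card (bd g E {s}) \<le> card (bd g E (X - Z))" using linkedD[OF lk _ fin2(3)] by simp
      moreover have "e \<in> bd g E (X - Z) \<Longrightarrow> s = t" using e X tr by (auto simp: bd_def)
      ultimately have "?d {s} \<le> ?d (X - Z)" using outer[OF fin2(3)] ds by (auto split: if_splits simp: of_bool_def)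
      moreover have "r \<notin> X" using X tr False by auto
      then have "k - 1 \<le> ?d (Z - X)" using inner[OF _ _ fin2(4)] rZ by auto
      ultimately show ?thesis using posimodular[OF gl' fX' fZ'] dZ by simp
    qed
  qed
  then show ?thesis using tpath_prev[OF tp'] wt by (metis pedges_prev)
qed


section \<open>Splitting off\<close>

text \<open>Splitting off replaces the path \<open>t\<close>, \<open>v\<close>, \<open>w\<close> by
  one edge from \<open>t\<close> to \<open>w\<close>, which reuses the name \<open>f\<close>. A cut
  loses 2 if it separates \<open>v\<close> from both \<open>t\<close> and \<open>w\<close>, and
  nothing otherwise.\<close>

lemma split_bd:
  assumes e: "e \<in> E" "g e = {t, v}" and f: "f \<in> E" "g f = {v, w}" and ne: "e \<noteq> f"
  defines "g' \<equiv> g(f := {t, w})"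
  shows "finite (bd g' (E - {e}) X) \<longleftrightarrow> finite (bd g E X)"
    and "finite (bd g E X) \<Longrightarrow> card (bd g E X) =
      card (bd g' (E - {e}) X) + 2 * of_bool ((t \<in> X) = (w \<in> X) \<and> (v \<in> X) \<noteq> (t \<in> X))"
proof -
  define B where "B = bd g (E - {e, f}) X"
  have B: "e \<notin> B" "f \<notin> B" by (auto simp: B_def bd_def)
  have 1: "bd g E X = B \<union> (if (t \<in> X) = (v \<in> X) then {} else {e}) \<union> (if (v \<in> X) = (w \<in> X) then {} else {f})"
    using e f by (auto simp: B_def bd_def)
  have 2: "bd g' (E - {e}) X = B \<union> (if (t \<in> X) = (w \<in> X) then {} else {f})"
    using e f ne by (auto simp: B_def bd_def g'_def)
  show "finite (bd g' (E - {e}) X) \<longleftrightarrow> finite (bd g E X)"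
    unfolding 1 2 by auto
  assume "finite (bd g E X)"
  then have "finite B" unfolding 1 by simp
  then show "card (bd g E X) =
      card (bd g' (E - {e}) X) + 2 * of_bool ((t \<in> X) = (w \<in> X) \<and> (v \<in> X) \<noteq> (t \<in> X))"
    unfolding 1 2 using B ne
    by (cases "t \<in> X"; cases "v \<in> X"; cases "w \<in> X") simp_all
qed

lemma tpath_edges: "tpath g E T u ps \<Longrightarrow> pedges ps \<subseteq> E"
  unfolding tpath_def by (blast dest: walk_edges)

lemma link_single:
  assumes "link g E {t} D u ps"
  shows "walk g E t ps \<and> simple t ps \<and> pverts t ps \<inter> D = {wend t ps}"
proof -
  have "u = t" using assms by (simp add: link_def)
  then show ?thesis using assms unfolding link_iff by blast
qed

lemma even_gap: "\<lbrakk>b \<noteq> a; even (b + a); a \<le> b\<rbrakk> \<Longrightarrow> a + 2 \<le> b" for a b :: nat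
  by presburger

text \<open>If a set \<open>P\<close> of edges may be deleted, so may a terminal path inside
  \<open>P\<close> that lowers the terminal degrees by the same amounts: other cuts only become
  larger. It is needed when undoing a split shortcuts a path.\<close>

lemma linked_shrink:
  assumes lk: "linked g (E - P) T" and tp: "tpath g E T t qs" and P: "pedges qs \<subseteq> P" "finite P"
    and deg: "\<And>s. s \<in> T \<Longrightarrow> finite (bd g E {s}) \<and>
      card (bd g (E - P) {s}) = card (bd g E {s}) - of_bool (s = t \<or> s = wend t qs)"
  shows "linked g (E - pedges qs) T"
  unfolding linked_def finite_bd_remove
proof (intro ballI allI impI)
  fix s X assume s: "s \<in> T" and X: "X \<inter> T = {s}" and fX: "finite (bd g E X)"
  have "card (bd g (E - pedges qs) {s}) = card (bd g (E - P) {s})"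
    using degree_remove[OF tp s] deg[OF s] by simp
  also have "\<dots> \<le> card (bd g (E - P) X)"
    by (rule linkedD[OF lk X]) (use fX in \<open>simp add: bd_Diff_edges\<close>)
  also have "\<dots> \<le> card (bd g (E - pedges qs) X)"
    by (rule card_mono) (use fX P in \<open>auto simp: bd_Diff_edges\<close>)
  finally show "card (bd g (E - pedges qs) {s}) \<le> card (bd g (E - pedges qs) X)" .
qed

text \<open>Following a Menger path from \<open>t\<close>, the two edges at its second vertex \<open>v\<close> are split off.
  This can only violate the cut condition at a tight cut around another terminal that contains \<open>v\<close>,
  and then \<open>tight_path\<close> finishes.\<close>

lemma terminal_path_step:
  assumes "good g E T" "t \<in> T" "tpath g E T t ps"
    and "\<And>X. \<lbrakk>X \<inter> T = {t}; finite (bd g E X)\<rbrakk> \<Longrightarrow> card (bd g E {t}) \<le> card (bd g E X - pedges ps) + 1"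
  shows "\<exists>qs. tpath g E T t qs \<and> linked g (E - pedges qs) T"
  using assms
proof (induction ps arbitrary: g E)
  case Nil
  then show ?case by (simp add: tpath_def)
next
  case (Cons p ps g E)
  obtain e v where p: "p = (e, v)" by (cases p)
  have gl: "graphlike g E" and lk: "linked g E T" using Cons.prems by (auto simp: good_def)
  have wk: "e \<in> E" "g e = {t, v}" "walk g E v ps" and sm: "t \<notin> pverts v ps" "simple v ps"
    and pT: "insert t (pverts v ps) \<inter> T = {t, wend v ps}"
    using Cons.prems(3) p by (auto simp: tpath_def)
  have wT: "wend v ps \<in> T" "wend v ps \<noteq> t" using pT sm wend_in_pverts[of v ps] by auto
  show ?case
  \<comment> \<open>The obstruction to splitting at \<open>v\<close> is a tight set around a
    terminal other than \<open>t\<close> that contains \<open>v\<close>. A terminal \<open>v\<close>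
    is covered too, with \<open>Z = {v}\<close>.\<close>
  proof (cases "\<exists>Z r. v \<in> Z \<and> r \<noteq> t \<and> Z \<inter> T = {r} \<and> finite (bd g E Z) \<and> card (bd g E Z) = card (bd g E {r})")
    case True
    then obtain Z r where Z: "v \<in> Z" "r \<noteq> t" "Z \<inter> T = {r}" "finite (bd g E Z)"
      "card (bd g E Z) = card (bd g E {r})" by blast
    then have "r \<in> T" by auto
    then show ?thesis using tight_path[OF Cons.prems(1,2) _ _ Z(3,4,5) wk(1,2) Z(1)] Z(2) by blast
  next
    case False
    have vT: "v \<notin> T"
    proof
      assume "v \<in> T"
      then have "v \<in> {v} \<and> v \<noteq> t \<and> {v} \<inter> T = {v} \<and> finite (bd g E {v}) \<and> card (bd g E {v}) = card (bd g E {v})"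
        using sm Cons.prems(1) by (auto simp: good_def)
      then show False using False by blast
    qed
    then have "ps \<noteq> []" using wT by auto
    then obtain f w rest where ps: "ps = (f, w) # rest" by (metis list.exhaust surj_pair)
    have wk2: "f \<in> E" "g f = {v, w}" "walk g E w rest" and sm2: "v \<notin> pverts w rest" "simple w rest"
      "t \<noteq> v" "t \<notin> pverts w rest"
      using wk sm ps by auto
    have ne: "e \<noteq> f" using wk wk2 sm2 by (auto simp: doubleton_eq_iff)
    define g' where "g' = g(f := {t, w})"
    define E' where "E' = E - {e}"
    note fin_iff = split_bd(1)[OF wk(1,2) wk2(1,2) ne, folded g'_def E'_def]
    note card_eq = split_bd(2)[OF wk(1,2) wk2(1,2) ne, folded g'_def E'_def]
    have deg: "card (bd g E {s}) = card (bd g' E' {s})" if "s \<in> T" for s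
      using card_eq[of "{s}"] Cons.prems(1) that vT sm2 by (auto simp: good_def)
    have rest: "e \<notin> pedges rest" "f \<notin> pedges rest"
      using walk_edge_verts[OF wk2(3)] wk wk2 sm2 by auto
    have tp': "tpath g' E' T t ps"
    proof -
      have "walk g' E' w rest"
        by (rule walk_cong[OF wk2(3)]) (use rest walk_edges[OF wk2(3)] in \<open>auto simp: g'_def E'_def\<close>)
      then show ?thesis using pT vT sm2 wk2 ne unfolding ps tpath_def
        by (auto simp: g'_def E'_def)
    qed
    have bd_rest: "bd g' E' X - pedges ps = bd g E X - pedges (p # ps)" for X
      unfolding p ps by (auto simp: bd_def g'_def E'_def)
    have good': "good g' E' T"
      unfolding good_def
    proof (intro conjI ballI)
      show "graphlike g' E'" using gl unfolding graphlike_def g'_def E'_def by auto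
      show "finite (bd g' E' {r})" if "r \<in> T" for r
        unfolding fin_iff using Cons.prems(1) that by (auto simp: good_def)
      show "inner_even g' E' T"
        unfolding inner_even_def fin_iff
      proof (intro allI impI)
        fix X assume X: "X \<inter> T = {}" "finite (bd g E X)"
        then have "even (card (bd g E X))" using Cons.prems(1) by (auto simp: good_def inner_even_def)
        then show "even (card (bd g' E' X))" using card_eq[OF X(2)] by simp
      qed
      show "linked g' E' T"
        unfolding linked_def fin_iff
      proof (intro ballI allI impI)
        fix r X assume r: "r \<in> T" and X: "X \<inter> T = {r}" and fX: "finite (bd g E X)"
        have le: "card (bd g E {r}) \<le> card (bd g E X)" by (rule linkedD[OF lk X fX])
        \<comment> \<open>Only the last two configurations cost the cut 2 edges; in each of them a
          slack of 2 must be found.\<close>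
        consider "\<not> ((t \<in> X) = (w \<in> X) \<and> (v \<in> X) \<noteq> (t \<in> X))"
          | "v \<in> X" "t \<notin> X" "w \<notin> X" | "v \<notin> X" "t \<in> X" "w \<in> X" by blast
        then show "card (bd g' E' {r}) \<le> card (bd g' E' X)"
        proof cases
          case 1
          then have "card (bd g E X) = card (bd g' E' X)" using card_eq[OF fX] by auto
          then show ?thesis using le deg[OF r] by simp
        next
          case 2
          then have "r \<noteq> t" using X by auto
          \<comment> \<open>\<open>X\<close> contains \<open>v\<close> and isolates a terminal other
            than \<open>t\<close>, so it is not tight by the case assumption, and parity doubles the
            slack.\<close>
          then have "card (bd g E X) \<noteq> card (bd g E {r})" using False 2 X fX by blast
          moreover have "even (card (bd g E X) + card (bd g E {r}))" by (rule good_parity[OF Cons.prems(1) X fX])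
          ultimately have "card (bd g E {r}) + 2 \<le> card (bd g E X)" using le even_gap by blast
          then show ?thesis using card_eq[OF fX] 2 deg[OF r] by simp
        next
          case 3
          have "t \<in> X \<inter> T" using 3 Cons.prems(2) by simp
          then have rt: "r = t" unfolding X by simp
          have wend: "wend w rest \<in> T" "wend w rest \<noteq> t" using wT ps by simp_all
          have "wend w rest \<notin> X"
          proof
            assume "wend w rest \<in> X"
            then have "wend w rest \<in> X \<inter> T" using wend by simp
            then show False unfolding X rt using wend by simp
          qed
          then obtain h where h: "h \<in> pedges rest" "h \<in> bd g E X"
            using walk_crosses[OF wk2(3) 3(3)] by blast
          \<comment> \<open>The path leaves \<open>X\<close> by \<open>e\<close>, returns by
            \<open>f\<close> and must leave again by some \<open>h\<close>. The other paths of the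
            Menger system, recorded in the last hypothesis, contribute all but one of the required
            edges, so three crossings give slack 2.\<close>
          have "{e, f, h} \<subseteq> bd g E X \<inter> pedges (p # ps)"
            using h 3 wk wk2 by (auto simp: p ps bd_def)
          then have "card {e, f, h} \<le> card (bd g E X \<inter> pedges (p # ps))"
            by (intro card_mono) auto
          moreover have "h \<noteq> e" "h \<noteq> f" using rest h by metis+
          then have "card {e, f, h} = 3" using ne by simp
          moreover have "card (bd g E {t}) \<le> card (bd g E X - pedges (p # ps)) + 1"
            using Cons.prems(4)[of X] X rt fX by simp
          moreover have "card (bd g E X) = card (bd g E X \<inter> pedges (p # ps)) + card (bd g E X - pedges (p # ps))"
            by (metis card_Int_Diff fX)
          ultimately have "card (bd g E {t}) + 2 \<le> card (bd g E X)" by linarith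
          then show ?thesis using card_eq[OF fX] 3 deg[OF r] rt by simp
        qed
      qed
    qed
    have "card (bd g' E' {t}) \<le> card (bd g' E' X - pedges ps) + 1"
      if "X \<inter> T = {t}" "finite (bd g' E' X)" for X
      using Cons.prems(4)[OF that(1)] that(2) deg[OF Cons.prems(2)] unfolding fin_iff bd_rest by simp
    from Cons.IH[OF good' Cons.prems(2) tp' this] obtain qs where
      qs: "tpath g' E' T t qs" "linked g' (E' - pedges qs) T" by blast
    have qsE: "pedges qs \<subseteq> E'" by (rule tpath_edges[OF qs(1)])
    have fdeg: "finite (bd g E {s})" "finite (bd g' E' {s})" if "s \<in> T" for s
      using that Cons.prems(1) good' by (auto simp: good_def)
    show ?thesis
    proof (cases "f \<in> pedges qs")
      case False
      have "walk g E t qs"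
        by (rule walk_cong[of g' E']) (use qs(1) qsE False in \<open>auto simp: tpath_def g'_def E'_def\<close>)
      then have tp: "tpath g E T t qs" using qs(1) by (auto simp: tpath_def)
      have eQ: "e \<in> E - pedges qs" "f \<in> E - pedges qs" using qsE wk wk2 False by (auto simp: E'_def)
      have EE: "E' - pedges qs = (E - pedges qs) - {e}" by (auto simp: E'_def)
      note fin2 = split_bd(1)[OF eQ(1) wk(2) eQ(2) wk2(2) ne, folded g'_def EE]
      note card2 = split_bd(2)[OF eQ(1) wk(2) eQ(2) wk2(2) ne, folded g'_def EE]
      have "linked g (E - pedges qs) T"
        unfolding linked_def
      proof (intro ballI allI impI)
        fix r X assume r: "r \<in> T" and X: "X \<inter> T = {r}" and fX: "finite (bd g (E - pedges qs) X)"
        have "card (bd g (E - pedges qs) {r}) = card (bd g' (E' - pedges qs) {r})"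
          using card2[of "{r}"] fdeg(1)[OF r] vT r sm2 by (auto simp: finite_bd_remove)
        also have "\<dots> \<le> card (bd g' (E' - pedges qs) X)"
          by (rule linkedD[OF qs(2) X]) (use fX fin2 in simp)
        also have "\<dots> \<le> card (bd g (E - pedges qs) X)" using card2[OF fX] by simp
        finally show "card (bd g (E - pedges qs) {r}) \<le> card (bd g (E - pedges qs) X)" .
      qed
      then show ?thesis using tp by blast
    next
      case True
      obtain h x qs' where qs': "qs = (h, x) # qs'" using qs(1) by (cases qs) (auto simp: tpath_def)
      have q: "h \<in> E'" "g' h = {t, x}" "walk g' E' x qs'" "t \<notin> pverts x qs'" "simple x qs'"
        "insert t (pverts x qs') \<inter> T = {t, wend x qs'}"
        using qs(1) by (auto simp: tpath_def qs')
      \<comment> \<open>In the split graph \<open>f\<close> is incident with \<open>t\<close>, which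
        a simple walk from \<open>t\<close> never revisits; so \<open>f\<close> can only be the
        first edge.\<close>
      have fq: "f \<notin> pedges qs'" using walk_edge_verts[OF q(3), of f] q(4) by (auto simp: g'_def)
      then have hf: "h = f" using True by (auto simp: qs')
      then have xw: "x = w" using q(2) sm2 by (auto simp: g'_def doubleton_eq_iff)
      have wq: "walk g E w qs'"
        by (rule walk_cong[OF q(3)[unfolded xw]]) (use fq walk_edges[OF q(3)] in \<open>auto simp: g'_def E'_def\<close>)
      \<comment> \<open>The split is undone by inserting \<open>v\<close> between \<open>t\<close>
        and \<open>w\<close>. If the path visits \<open>v\<close> later on, it is shortcut from
        \<open>t\<close> along \<open>e\<close> to that visit, which is why \<open>R\<close> need
        not use all the listed edges.\<close>
      have "\<exists>R. tpath g E T t R \<and> wend t R = wend t qs \<and> pedges R \<subseteq> insert e (pedges qs)"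
      proof (cases "v \<in> pverts w qs'")
        case False
        then show ?thesis
          using wk wk2 wq q(4-6) vT sm2 unfolding qs' hf xw
          by (intro exI[of _ "(e, v) # (f, w) # qs'"]) (auto simp: tpath_def)
      next
        case True
        obtain bs where bs: "walk g E v bs" "simple v bs" "pverts v bs \<subseteq> pverts w qs'"
          "pedges bs \<subseteq> pedges qs'" "wend v bs = wend w qs'"
          using walk_suffix[OF wq q(5)[unfolded xw] True] by blast
        have "walk g E t ((e, v) # bs)" using wk bs by simp
        moreover have "simple t ((e, v) # bs)" using bs q(4) unfolding xw by auto
        moreover have "pverts t ((e, v) # bs) \<inter> T = {t, wend t ((e, v) # bs)}"
        proof -
          have "x' = wend v bs" if "x' \<in> pverts v bs" "x' \<in> T" for x'
          proof -
            have "x' \<in> pverts w qs'" using bs(3) that(1) by blast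
            then have "x' \<in> {t, wend w qs'}" "x' \<noteq> t" using q(4,6) that(2) unfolding xw by blast+
            then show ?thesis using bs(5) by simp
          qed
          then have "pverts v bs \<inter> T \<subseteq> {wend v bs}" by blast
          moreover have "wend v bs \<in> T" using q(6) bs(5) xw by auto
          ultimately show ?thesis using Cons.prems(2) wend_in_pverts[of v bs] by auto
        qed
        ultimately have "tpath g E T t ((e, v) # bs)" unfolding tpath_def by blast
        moreover have "wend t ((e, v) # bs) = wend t qs" using bs(5) by (simp add: qs' xw)
        moreover have "pedges ((e, v) # bs) \<subseteq> insert e (pedges qs)" using bs(4) by (auto simp: qs')
        ultimately show ?thesis by blast
      qed
      then obtain R where R: "tpath g E T t R" "wend t R = wend t qs" "pedges R \<subseteq> insert e (pedges qs)" by blast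
      \<comment> \<open>\<open>g\<close> and \<open>g'\<close> differ only at \<open>f\<close>,
        which is deleted on both sides.\<close>
      have bd_eq: "bd g (E - insert e (pedges qs)) X = bd g' (E' - pedges qs) X" for X
        using True by (auto simp: bd_def g'_def E'_def)
      have "linked g (E - pedges R) T"
      proof (rule linked_shrink[OF _ R(1,3)])
        show "linked g (E - insert e (pedges qs)) T"
          using qs(2) unfolding linked_def bd_eq .
        fix s assume s: "s \<in> T"
        show "finite (bd g E {s}) \<and>
          card (bd g (E - insert e (pedges qs)) {s}) = card (bd g E {s}) - of_bool (s = t \<or> s = wend t R)"
          using fdeg(1)[OF s] degree_remove[OF qs(1) s fdeg(2)[OF s]] R(2) deg[OF s] unfolding bd_eq by simp
      qed simp
      then show ?thesis using R by blast
    qed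
  qed
qed

text \<open>Any path of a Menger system at \<open>t\<close> can serve as the guide for splitting
  off.\<close>

lemma terminal_path_exists:
  assumes "good g E T" "t \<in> T" "bd g E {t} \<noteq> {}"
  shows "\<exists>ps. tpath g E T t ps \<and> good g (E - pedges ps) T"
proof -
  have gl: "graphlike g E" and lk: "linked g E T" and fin: "finite (bd g E {t})"
    using assms by (auto simp: good_def)
  define k where "k = card (bd g E {t})"
  have k: "k > 0" using fin assms by (auto simp: k_def card_gt_0_iff)
  have "k \<le> card (bd g E X)" if "{t} \<subseteq> X" "X \<inter> (T - {t}) = {}" "finite (bd g E X)" for X
  proof -
    have "X \<inter> T = {t}" using that assms by auto
    then show ?thesis using linkedD[OF lk _ that(3)] by (simp add: k_def)
  qed
  moreover have "{t} \<inter> (T - {t}) = {}" by auto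
  ultimately obtain u ps where ps0: "\<And>i. i < k \<Longrightarrow> link g E {t} (T - {t}) (u i) (ps i)"
    and disj: "\<And>i j. \<lbrakk>i < k; j < k; i \<noteq> j\<rbrakk> \<Longrightarrow> pedges (ps i) \<inter> pedges (ps j) = {}"
    using menger[of "{t}" "T - {t}" g E k] gl by metis
  have ps: "walk g E t (ps i)" "simple t (ps i)" "pverts t (ps i) \<inter> (T - {t}) = {wend t (ps i)}" if "i < k" for i
    using link_single[OF ps0[OF that]] by blast+
  have tp: "tpath g E T t (ps i)" if "i < k" for i
  proof -
    have "ps i \<noteq> []" using ps(3)[OF that] by auto
    moreover have "pverts t (ps i) \<inter> T = insert t (pverts t (ps i) \<inter> (T - {t}))" using assms(2) by blast
    ultimately show ?thesis using ps[OF that] unfolding tpath_def by simp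
  qed
  \<comment> \<open>The remaining \<open>k - 1\<close> paths also leave \<open>X\<close>, by edges
    that are not on path 0.\<close>
  have "card (bd g E {t}) \<le> card (bd g E X - pedges (ps 0)) + 1"
    if X: "X \<inter> T = {t}" "finite (bd g E X)" for X
  proof -
    have "card {0<..<k} \<le> card (bd g E X - pedges (ps 0))"
    proof (rule card_le_disjoint_family[where f = "\<lambda>i. pedges (ps i)"])
      fix i assume i: "i \<in> {0<..<k}"
      have "wend t (ps i) \<notin> X" "t \<in> X" using ps(3)[of i] i X by auto
      then obtain e where "e \<in> pedges (ps i)" "e \<in> bd g E X"
        using walk_crosses[of g E t "ps i" X] ps(1)[of i] i by auto
      moreover have "pedges (ps i) \<inter> pedges (ps 0) = {}" using disj[of i 0] i by simp
      ultimately show "pedges (ps i) \<inter> (bd g E X - pedges (ps 0)) \<noteq> {}" by blast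
    qed (use X disj in auto)
    then show ?thesis using k by (simp add: k_def)
  qed
  from terminal_path_step[OF assms(1,2) tp[OF k] this] show ?thesis
    using good_remove[OF assms(1)] by blast
qed

section \<open>Systems of terminal paths\<close>

definition pe :: "('v \<times> ('e \<times> 'v) list) set \<Rightarrow> 'e set" where
  "pe \<P> = (\<Union>(u, ps)\<in>\<P>. pedges ps)"

definition tsystem :: "('e \<Rightarrow> 'v set) \<Rightarrow> 'e set \<Rightarrow> 'v set \<Rightarrow> ('v \<times> ('e \<times> 'v) list) set \<Rightarrow> bool" where
  "tsystem g E T \<P> \<longleftrightarrow> (\<forall>(u, ps)\<in>\<P>. tpath g E T u ps)
     \<and> (\<forall>p\<in>\<P>. \<forall>q\<in>\<P>. p \<noteq> q \<longrightarrow> pedges (snd p) \<inter> pedges (snd q) = {})"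

lemma tsystem_insert:
  assumes "tsystem g E T \<P>" "tpath g (E - pe \<P>) T t ps"
  shows "tsystem g E T (insert (t, ps) \<P>)"
proof -
  have e: "pedges ps \<subseteq> E - pe \<P>" by (rule tpath_edges[OF assms(2)])
  have "walk g E t ps"
    by (rule walk_cong[of g "E - pe \<P>"]) (use assms(2) e in \<open>auto simp: tpath_def\<close>)
  then have "tpath g E T t ps" using assms(2) by (auto simp: tpath_def)
  moreover have "pedges ps \<inter> pedges (snd q) = {}" if "q \<in> \<P>" for q
  proof -
    have "pedges (snd q) \<subseteq> pe \<P>" using that unfolding pe_def by (cases q) auto
    then show ?thesis using e by blast
  qed
  ultimately show ?thesis using assms(1) unfolding tsystem_def by (auto simp: Int_commute)
qed

text \<open>Each new path starts at \<open>t\<close> and uses exactly one of its edges, so the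
  finite degree of \<open>t\<close> is the termination measure.\<close>

lemma tsystem_exhaust:
  assumes "tsystem g E T \<P>" "good g (E - pe \<P>) T" "t \<in> T"
  shows "\<exists>\<Q>. \<P> \<subseteq> \<Q> \<and> tsystem g E T \<Q> \<and> good g (E - pe \<Q>) T \<and> bd g (E - pe \<Q>) {t} = {}"
  using assms
proof (induction "card (bd g (E - pe \<P>) {t})" arbitrary: \<P> rule: less_induct)
  case less
  show ?case
  proof (cases "bd g (E - pe \<P>) {t} = {}")
    case True
    with less.prems show ?thesis by blast
  next
    case False
    obtain ps where ps: "tpath g (E - pe \<P>) T t ps" "good g (E - pe \<P> - pedges ps) T"
      using terminal_path_exists[OF less.prems(2,3) False] by blast
    have eq: "E - pe (insert (t, ps) \<P>) = E - pe \<P> - pedges ps"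
      by (auto simp: pe_def)
    have fin: "finite (bd g (E - pe \<P>) {t})" using less.prems by (auto simp: good_def)
    then have "card (bd g (E - pe (insert (t, ps) \<P>)) {t}) < card (bd g (E - pe \<P>) {t})"
      unfolding eq using degree_remove[OF ps(1) less.prems(3) fin] False by (simp add: card_gt_0_iff)
    moreover have "tsystem g E T (insert (t, ps) \<P>)" by (rule tsystem_insert[OF less.prems(1) ps(1)])
    moreover have "good g (E - pe (insert (t, ps) \<P>)) T" unfolding eq by (rule ps(2))
    ultimately obtain \<Q> where "insert (t, ps) \<P> \<subseteq> \<Q>" "tsystem g E T \<Q>" "good g (E - pe \<Q>) T"
      "bd g (E - pe \<Q>) {t} = {}"
      using less.hyps[of "insert (t, ps) \<P>"] less.prems(3) by blast
    then show ?thesis by blast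
  qed
qed

text \<open>Terminals are exhausted in an enumeration and the increasing systems are united.
  Covering the edges at a terminal and disjointness are witnessed at finite stages, so nothing has
  to be shown about the graph left over in the limit.\<close>

theorem tsystem_exists:
  assumes "good g E T" "countable T"
  shows "\<exists>\<P>. tsystem g E T \<P> \<and> (\<forall>t\<in>T. bd g E {t} \<subseteq> pe \<P>)"
proof (cases "T = {}")
  case True
  then show ?thesis by (intro exI[of _ "{}"]) (auto simp: tsystem_def)
next
  case False
  define tm where "tm = from_nat_into T"
  have tm: "range tm = T" using False assms(2) by (simp add: tm_def)
  \<comment> \<open>The enumeration may repeat terminals; a terminal that is already exhausted
    simply adds no path.\<close>
  have "\<exists>\<Q>. \<forall>n. (tsystem g E T (\<Q> n) \<and> good g (E - pe (\<Q> n)) T) \<and>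
    (\<Q> n \<subseteq> \<Q> (Suc n) \<and> bd g (E - pe (\<Q> (Suc n))) {tm n} = {})"
  proof (rule dependent_nat_choice)
    show "\<exists>\<P>. tsystem g E T \<P> \<and> good g (E - pe \<P>) T"
      using assms by (intro exI[of _ "{}"]) (auto simp: tsystem_def pe_def)
    fix \<P> n assume "tsystem g E T \<P> \<and> good g (E - pe \<P>) T"
    then show "\<exists>\<Q>. (tsystem g E T \<Q> \<and> good g (E - pe \<Q>) T) \<and> (\<P> \<subseteq> \<Q> \<and> bd g (E - pe \<Q>) {tm n} = {})"
      using tsystem_exhaust[of g E T \<P> "tm n"] tm by blast
  qed
  then obtain \<Q> where Q: "\<And>n. tsystem g E T (\<Q> n)" "\<And>n. \<Q> n \<subseteq> \<Q> (Suc n)"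
    "\<And>n. bd g (E - pe (\<Q> (Suc n))) {tm n} = {}" by blast
  have mono: "\<Q> m \<subseteq> \<Q> n" if "m \<le> n" for m n using lift_Suc_mono_le[of \<Q>, OF Q(2) that] .
  have "tsystem g E T (\<Union>n. \<Q> n)"
    unfolding tsystem_def
  proof (intro conjI ballI impI)
    fix p assume "p \<in> (\<Union>n. \<Q> n)"
    then show "case p of (u, ps) \<Rightarrow> tpath g E T u ps" using Q(1) by (force simp: tsystem_def)
  next
    fix p q assume "p \<in> (\<Union>n. \<Q> n)" "q \<in> (\<Union>n. \<Q> n)" "p \<noteq> q"
    then obtain m n where "p \<in> \<Q> m" "q \<in> \<Q> n" by blast
    then have "p \<in> \<Q> (max m n)" "q \<in> \<Q> (max m n)"
      using mono[of m "max m n"] mono[of n "max m n"] by auto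
    then show "pedges (snd p) \<inter> pedges (snd q) = {}" using Q(1) \<open>p \<noteq> q\<close> unfolding tsystem_def by blast
  qed
  moreover have "bd g E {t} \<subseteq> pe (\<Union>n. \<Q> n)" if t: "t \<in> T" for t
  proof -
    obtain n where "t = tm n" using tm t by auto
    then have "bd g E {t} \<subseteq> pe (\<Q> (Suc n))" using Q(3)[of n] unfolding bd_Diff_edges by blast
    then show ?thesis unfolding pe_def by blast
  qed
  ultimately show ?thesis by blast
qed


section \<open>Ends\<close>

locale lf_graph =
  fixes G :: "('v, 'e) multigraph"
  assumes mg: "is_multigraph G" and lf: "locally_finite G"
begin

abbreviation "V \<equiv> verts G"
abbreviation "bdG \<equiv> bd (ends G) (edges G)"
abbreviation "reach S \<equiv> (adjacent_avoiding G S)\<^sup>*\<^sup>*"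

lemma graphlike_G: "graphlike (ends G) (edges G)"
  using mg unfolding is_multigraph_def graphlike_def by blast

lemma ends_subset: "e \<in> edges G \<Longrightarrow> ends G e \<subseteq> V"
  using mg unfolding is_multigraph_def by fastforce

lemma ends_neq: "e \<in> edges G \<Longrightarrow> ends G e = {u, v} \<Longrightarrow> u \<noteq> v"
  using mg unfolding is_multigraph_def by (metis doubleton_eq_iff insert_absorb2)

lemma finite_degree: "v \<in> V \<Longrightarrow> finite {e \<in> edges G. v \<in> ends G e}"
  using lf by (auto simp: locally_finite_def)

lemma adj_sym: "adjacent_avoiding G S u v \<Longrightarrow> adjacent_avoiding G S v u"
  by (auto simp: adjacent_avoiding_def insert_commute)

lemma reach_sym: "reach S u v \<Longrightarrow> reach S v u"
  by (rule sympD[OF symp_rtranclp]) (auto intro: sympI adj_sym)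

lemma reach_anti: "reach S' u v \<Longrightarrow> S \<subseteq> S' \<Longrightarrow> reach S u v"
  by (erule mono_rtranclp[rule_format, rotated]) (auto simp: adjacent_avoiding_def)

lemma component_subset: "C \<in> components_minus G S \<Longrightarrow> C \<subseteq> V - S"
proof -
  have "w \<in> V - S" if "reach S v w" "v \<in> V - S" for v w
    using that by (induction rule: rtranclp_induct) (auto simp: adjacent_avoiding_def)
  then show "C \<in> components_minus G S \<Longrightarrow> C \<subseteq> V - S" by (auto simp: components_minus_def)
qed

lemma component_eq:
  assumes "C \<in> components_minus G S" "v \<in> C"
  shows "C = {w. reach S v w}"
proof -
  obtain u where "C = {w. reach S u w}" using assms by (auto simp: components_minus_def)
  then show ?thesis using assms reach_sym by (auto intro: rtranclp_trans)
qed

lemma component_unique: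
  assumes "C \<in> components_minus G S" "C' \<in> components_minus G S" "v \<in> C" "v \<in> C'"
  shows "C = C'"
  using component_eq[OF assms(1,3)] component_eq[OF assms(2,4)] by simp

lemma component_of: "v \<in> V - S \<Longrightarrow> {w. reach S v w} \<in> components_minus G S"
  by (auto simp: components_minus_def)

lemma component_closed:
  assumes "C \<in> components_minus G S" "u \<in> C" "e \<in> edges G" "ends G e = {u, v}" "v \<notin> S"
  shows "v \<in> C"
proof -
  have "u \<in> V - S" using component_subset[OF assms(1)] assms(2) by blast
  moreover have "v \<in> V" using ends_subset[OF assms(3)] assms(4) by simp
  ultimately have "adjacent_avoiding G S u v" using assms by (auto simp: adjacent_avoiding_def)
  then show ?thesis using component_eq[OF assms(1,2)] by auto
qed

text \<open>Every edge leaving a component of \<open>G - S\<close> ends in \<open>S\<close>, and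
  degrees are finite.\<close>

lemma finite_bd_component:
  assumes "C \<in> components_minus G S" "finite S" "S \<subseteq> V"
  shows "finite (bdG C)"
proof (rule finite_subset)
  show "finite (\<Union>v\<in>S. {e \<in> edges G. v \<in> ends G e})"
    using assms finite_degree by auto
  show "bdG C \<subseteq> (\<Union>v\<in>S. {e \<in> edges G. v \<in> ends G e})"
  proof
    fix e assume "e \<in> bdG C"
    then obtain u v where "e \<in> edges G" "ends G e = {u, v}" "u \<in> C" "v \<notin> C"
      using bd_cases[OF graphlike_G] by blast
    then show "e \<in> (\<Union>v\<in>S. {e \<in> edges G. v \<in> ends G e})"
      using component_closed[OF assms(1)] by blast
  qed
qed

lemma raysD:
  assumes "R \<in> rays G"
  shows "inj (fst R)" "fst R i \<in> V" "snd R i \<in> edges G" "ends G (snd R i) = {fst R i, fst R (Suc i)}"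
  using assms by (auto simp: rays_def)

lemma ray_avoids:
  assumes "R \<in> rays G" "finite S"
  shows "\<exists>n. \<forall>m\<ge>n. fst R m \<notin> S"
proof -
  have "finite {m. fst R m \<in> S}" using finite_vimageI[OF assms(2) raysD(1)[OF assms(1)]]
    by (simp add: vimage_def)
  then obtain n where "\<forall>m\<in>{m. fst R m \<in> S}. m < n" using finite_nat_set_iff_bounded by blast
  then show ?thesis by (metis mem_Collect_eq not_less)
qed

lemma ray_reach:
  assumes "R \<in> rays G" "\<And>m. n \<le> m \<Longrightarrow> fst R m \<notin> S" "n \<le> m"
  shows "reach S (fst R n) (fst R m)"
  using assms(3)
proof (induction m rule: dec_induct)
  case (step m)
  have "\<exists>e\<in>edges G. ends G e = {fst R m, fst R (Suc m)}" using raysD(3,4)[OF assms(1)] by blast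
  then have "adjacent_avoiding G S (fst R m) (fst R (Suc m))"
    using raysD(2)[OF assms(1)] assms(2) step by (simp add: adjacent_avoiding_def)
  with step show ?case by (meson rtranclp.rtrancl_into_rtrancl)
qed simp

lemma ray_component:
  assumes "R \<in> rays G" "finite S"
  shows "\<exists>C\<in>components_minus G S. has_tail_in R C"
proof -
  obtain n where n: "\<And>m. n \<le> m \<Longrightarrow> fst R m \<notin> S" using ray_avoids[OF assms] by blast
  show ?thesis
  proof
    show "has_tail_in R {w. reach S (fst R n) w}"
      unfolding has_tail_in_def using ray_reach[OF assms(1) n] by blast
    show "{w. reach S (fst R n) w} \<in> components_minus G S"
      using component_of n raysD[OF assms(1)] by blast
  qed
qed

lemma has_tail_in_Int: "has_tail_in R A \<Longrightarrow> has_tail_in R B \<Longrightarrow> has_tail_in R (A \<inter> B)"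
  unfolding has_tail_in_def by (metis IntI le_trans nat_le_linear)

lemma has_tail_in_mono: "has_tail_in R A \<Longrightarrow> A \<subseteq> B \<Longrightarrow> has_tail_in R B"
  unfolding has_tail_in_def by blast

lemma has_tail_in_nonempty: "has_tail_in R A \<Longrightarrow> A \<noteq> {}"
  unfolding has_tail_in_def by blast

lemma tail_component_unique:
  assumes "C \<in> components_minus G S" "C' \<in> components_minus G S" "has_tail_in R C" "has_tail_in R C'"
  shows "C = C'"
  using has_tail_in_nonempty[OF has_tail_in_Int[OF assms(3,4)]] component_unique[OF assms(1,2)] by blast

lemma ray_equivD:
  assumes "(R, R') \<in> ray_equiv G" "finite S" "S \<subseteq> V" "C \<in> components_minus G S" "has_tail_in R C"
  shows "has_tail_in R' C"
proof -
  obtain C' where "C' \<in> components_minus G S" "has_tail_in R C'" "has_tail_in R' C'"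
    using assms(1-3) unfolding ray_equiv_def by blast
  then show ?thesis using tail_component_unique[OF assms(4)] assms(5) by blast
qed

lemma equiv_rays: "equiv (rays G) (ray_equiv G)"
proof (rule equivI)
  show "ray_equiv G \<subseteq> rays G \<times> rays G" by (auto simp: ray_equiv_def)
  show "refl_on (rays G) (ray_equiv G)"
    by (auto simp: refl_on_def ray_equiv_def ray_component)
  show "sym (ray_equiv G)"
    unfolding sym_def ray_equiv_def by blast
  show "trans (ray_equiv G)"
  proof (rule transI)
    fix R R' R'' assume 1: "(R, R') \<in> ray_equiv G" and 2: "(R', R'') \<in> ray_equiv G"
    have "\<exists>C\<in>components_minus G S. has_tail_in R C \<and> has_tail_in R'' C" if S: "finite S" "S \<subseteq> V" for S
    proof -
      obtain C where "C \<in> components_minus G S" "has_tail_in R C" "has_tail_in R' C"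
        using 1 S unfolding ray_equiv_def by blast
      then show ?thesis using ray_equivD[OF 2 S] by blast
    qed
    then show "(R, R'') \<in> ray_equiv G" using 1 2 unfolding ray_equiv_def by blast
  qed
qed

lemma ends_rays: "\<omega> \<in> graph_ends G \<Longrightarrow> R \<in> \<omega> \<Longrightarrow> R \<in> rays G"
  unfolding graph_ends_def using equiv_rays in_quotient_imp_subset by blast

lemma ends_nonempty: "\<omega> \<in> graph_ends G \<Longrightarrow> \<exists>R. R \<in> \<omega>"
  unfolding graph_ends_def using equiv_rays in_quotient_imp_non_empty by blast

lemma ends_equiv: "\<omega> \<in> graph_ends G \<Longrightarrow> R \<in> \<omega> \<Longrightarrow> R' \<in> \<omega> \<Longrightarrow> (R, R') \<in> ray_equiv G"
  unfolding graph_ends_def using equiv_rays in_quotient_imp_in_rel by fastforce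

lemma ends_closed: "\<omega> \<in> graph_ends G \<Longrightarrow> R \<in> \<omega> \<Longrightarrow> (R, R') \<in> ray_equiv G \<Longrightarrow> R' \<in> \<omega>"
  unfolding graph_ends_def using equiv_rays in_quotient_imp_closed by fastforce

lemma ends_disjoint: "\<omega> \<in> graph_ends G \<Longrightarrow> \<eta> \<in> graph_ends G \<Longrightarrow> R \<in> \<omega> \<Longrightarrow> R \<in> \<eta> \<Longrightarrow> \<omega> = \<eta>"
  unfolding graph_ends_def using quotient_disj[OF equiv_rays] by blast

text \<open>Two offsets are allowed so that both dropping and adding initial vertices are
  covered.\<close>

lemma ray_equiv_shift:
  assumes "R \<in> rays G" "R' \<in> rays G" "\<And>i. fst R' (i + a) = fst R (i + b)"
  shows "(R, R') \<in> ray_equiv G"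
proof -
  have "has_tail_in R' C" if C: "has_tail_in R C" for C
  proof -
    obtain n where n: "\<And>m. n \<le> m \<Longrightarrow> fst R m \<in> C" using C unfolding has_tail_in_def by blast
    have "fst R' m \<in> C" if "m \<ge> n + a" for m
      using n[of "m - a + b"] assms(3)[of "m - a"] that by simp
    then show ?thesis unfolding has_tail_in_def by blast
  qed
  then show ?thesis using assms ray_component[OF assms(1)] unfolding ray_equiv_def by blast
qed

lemma ray_drop:
  assumes "R \<in> rays G"
  shows "(\<lambda>i. fst R (i + n), \<lambda>i. snd R (i + n)) \<in> rays G"
  using raysD(2-4)[OF assms] injD[OF raysD(1)[OF assms]] by (force simp: rays_def intro!: injI)

lemma ends_drop:
  assumes "\<omega> \<in> graph_ends G" "R \<in> \<omega>"
  shows "(\<lambda>i. fst R (i + n), \<lambda>i. snd R (i + n)) \<in> \<omega>"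
proof (rule ends_closed[OF assms])
  show "(R, \<lambda>i. fst R (i + n), \<lambda>i. snd R (i + n)) \<in> ray_equiv G"
    by (rule ray_equiv_shift[of _ _ 0 n]) (use ends_rays[OF assms] ray_drop in auto)
qed

text \<open>Justifies the definite description. It asks for a ray lying entirely in
  \<open>C\<close>, whereas equivalence of rays speaks of tails; cutting off an initial segment
  connects the two, because it stays in the end.\<close>

lemma end_component_props:
  assumes "\<omega> \<in> graph_ends G" "finite S" "S \<subseteq> V"
  shows "end_component G S \<omega> \<in> components_minus G S"
    and "R \<in> \<omega> \<Longrightarrow> has_tail_in R (end_component G S \<omega>)"
    and "\<lbrakk>C \<in> components_minus G S; R \<in> \<omega>; has_tail_in R C\<rbrakk> \<Longrightarrow> C = end_component G S \<omega>"
    and "\<exists>R\<in>\<omega>. range (fst R) \<subseteq> end_component G S \<omega>"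
proof -
  obtain R0 where R0: "R0 \<in> \<omega>" using ends_nonempty[OF assms(1)] by blast
  obtain C0 where C0: "C0 \<in> components_minus G S" "has_tail_in R0 C0"
    using ray_component[OF ends_rays[OF assms(1) R0] assms(2)] by blast
  have tails: "has_tail_in R C0" if "R \<in> \<omega>" for R
    using ray_equivD[OF ends_equiv[OF assms(1) R0 that] assms(2,3) C0] .
  have uniq: "C = C0" if "C \<in> components_minus G S" "R \<in> \<omega>" "has_tail_in R C" for C R
    using tail_component_unique[OF that(1) C0(1) that(3) tails[OF that(2)]] .
  obtain n where n: "\<And>m. n \<le> m \<Longrightarrow> fst R0 m \<in> C0" using C0(2) unfolding has_tail_in_def by blast
  have ex: "\<exists>R\<in>\<omega>. range (fst R) \<subseteq> C0"
    using ends_drop[OF assms(1) R0, of n] n by (intro bexI) auto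
  have "end_component G S \<omega> = C0"
    unfolding end_component_def
  proof (rule the_equality)
    show "C0 \<in> components_minus G S \<and> (\<exists>R\<in>\<omega>. range (fst R) \<subseteq> C0)" using C0 ex by blast
    fix C assume C: "C \<in> components_minus G S \<and> (\<exists>R\<in>\<omega>. range (fst R) \<subseteq> C)"
    then obtain R where "R \<in> \<omega>" "range (fst R) \<subseteq> C" by blast
    then show "C = C0" using uniq[of C R] C unfolding has_tail_in_def by blast
  qed
  note eq = this
  show "end_component G S \<omega> \<in> components_minus G S" unfolding eq by (rule C0)
  show "R \<in> \<omega> \<Longrightarrow> has_tail_in R (end_component G S \<omega>)" unfolding eq by (rule tails)
  show "\<lbrakk>C \<in> components_minus G S; R \<in> \<omega>; has_tail_in R C\<rbrakk> \<Longrightarrow> C = end_component G S \<omega>"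
    unfolding eq by (rule uniq)
  show "\<exists>R\<in>\<omega>. range (fst R) \<subseteq> end_component G S \<omega>" unfolding eq by (rule ex)
qed

lemma ray_in_component_iff:
  assumes "\<eta> \<in> graph_ends G" "finite S" "S \<subseteq> V" "C \<in> components_minus G S"
  shows "(\<exists>R\<in>\<eta>. range (fst R) \<subseteq> C) \<longleftrightarrow> end_component G S \<eta> = C"
proof
  assume "\<exists>R\<in>\<eta>. range (fst R) \<subseteq> C"
  then obtain R where "R \<in> \<eta>" "range (fst R) \<subseteq> C" by blast
  moreover from this have "has_tail_in R C" unfolding has_tail_in_def by blast
  ultimately show "end_component G S \<eta> = C" using end_component_props(3)[OF assms(1-4)] by metis
next
  assume "end_component G S \<eta> = C"
  then show "\<exists>R\<in>\<eta>. range (fst R) \<subseteq> C" using end_component_props(4)[OF assms(1-3)] by simp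
qed

lemma component_anti:
  assumes "C' \<in> components_minus G S'" "S \<subseteq> S'" "C \<in> components_minus G S" "v \<in> C" "v \<in> C'"
  shows "C' \<subseteq> C"
  using component_eq[OF assms(1,5)] component_eq[OF assms(3,4)] reach_anti[OF _ assms(2)] by blast

lemma end_component_anti:
  assumes "\<omega> \<in> graph_ends G" "finite S'" "S' \<subseteq> V" "S \<subseteq> S'"
  shows "end_component G S' \<omega> \<subseteq> end_component G S \<omega>"
proof -
  have S: "finite S" "S \<subseteq> V" using assms finite_subset by auto
  obtain R where R: "R \<in> \<omega>" using ends_nonempty[OF assms(1)] by blast
  have "has_tail_in R (end_component G S' \<omega> \<inter> end_component G S \<omega>)"
    using end_component_props(2)[OF assms(1-3) R] end_component_props(2)[OF assms(1) S R] by (rule has_tail_in_Int)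
  then obtain v where "v \<in> end_component G S' \<omega>" "v \<in> end_component G S \<omega>"
    using has_tail_in_nonempty by blast
  then show ?thesis
    using component_anti[OF end_component_props(1)[OF assms(1-3)] assms(4) end_component_props(1)[OF assms(1) S]] by blast
qed

section \<open>Discrete sets of vertices and ends\<close>

lemma lives_in_iff: "lives_in X A \<longleftrightarrow> (\<forall>x\<in>X. lives_in {x} A)"
  unfolding lives_in_def by auto

lemma lives_in_mono: "lives_in X A \<Longrightarrow> A \<subseteq> B \<Longrightarrow> lives_in X B"
  unfolding lives_in_def using has_tail_in_mono by blast

lemma lives_in_Int: "lives_in X A \<Longrightarrow> lives_in X B \<Longrightarrow> lives_in X (A \<inter> B)"
  unfolding lives_in_def using has_tail_in_Int by blast

lemma lives_in_Vertex [simp]: "lives_in {Vertex v} A \<longleftrightarrow> v \<in> A"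
  by (auto simp: lives_in_def)

lemma lives_in_EndPoint: "lives_in {EndPoint \<omega>} A \<longleftrightarrow> (\<forall>R\<in>\<omega>. has_tail_in R A)"
  by (auto simp: lives_in_def)

lemma vhat_cases:
  assumes "x \<in> vhat G"
  obtains v where "x = Vertex v" "v \<in> V" | \<omega> where "x = EndPoint \<omega>" "\<omega> \<in> graph_ends G"
  using assms by (auto simp: vhat_def)

lemma lives_in_nonempty: "x \<in> vhat G \<Longrightarrow> lives_in {x} A \<Longrightarrow> A \<noteq> {}"
proof (erule vhat_cases)
  fix \<omega> assume \<omega>: "lives_in {x} A" "x = EndPoint \<omega>" "\<omega> \<in> graph_ends G"
  then obtain R where "R \<in> \<omega>" using ends_nonempty by blast
  then have "has_tail_in R A" using \<omega> by (simp add: lives_in_EndPoint)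
  then show "A \<noteq> {}" by (rule has_tail_in_nonempty)
qed auto

lemma lives_in_not_disjoint:
  assumes "x \<in> vhat G" "lives_in {x} A" "lives_in {x} B"
  shows "A \<inter> B \<noteq> {}"
  using lives_in_nonempty[OF assms(1) lives_in_Int[OF assms(2,3)]] .

text \<open>Shows by induction on the generation of open sets that the components containing
  \<open>\<omega>\<close> form a neighbourhood base as far as vertices and ends are concerned. Inner
  points of edges are left out because terminals never are such points.\<close>

lemma end_isolated:
  assumes "generate_topology_on
     ({open_star G v \<epsilon> | v \<epsilon>. v \<in> verts G \<and> 0 < \<epsilon>}
      \<union> {open_segment_of e a b | e a b. e \<in> edges G \<and> 0 \<le> a \<and> a < b \<and> b \<le> 1}
      \<union> {end_nbhd G S \<omega> \<epsilon> | S \<omega> \<epsilon>. finite S \<and> S \<subseteq> verts G \<and> \<omega> \<in> graph_ends G \<and> 0 < \<epsilon>}) U"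
    and "EndPoint \<omega> \<in> U" "\<omega> \<in> graph_ends G"
  shows "\<exists>S. finite S \<and> S \<subseteq> V \<and> Vertex ` end_component G S \<omega> \<subseteq> U
    \<and> (\<forall>\<eta>\<in>graph_ends G. end_component G S \<eta> = end_component G S \<omega> \<longrightarrow> EndPoint \<eta> \<in> U)"
  using assms
proof (induction rule: generate_topology_on.induct)
  case Empty
  then show ?case by simp
next
  case (Int a b)
  then obtain S S' where S: "finite S" "S \<subseteq> V" "Vertex ` end_component G S \<omega> \<subseteq> a"
    "\<forall>\<eta>\<in>graph_ends G. end_component G S \<eta> = end_component G S \<omega> \<longrightarrow> EndPoint \<eta> \<in> a"
    and S': "finite S'" "S' \<subseteq> V" "Vertex ` end_component G S' \<omega> \<subseteq> b"
    "\<forall>\<eta>\<in>graph_ends G. end_component G S' \<eta> = end_component G S' \<omega> \<longrightarrow> EndPoint \<eta> \<in> b" by auto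
  \<comment> \<open>For an intersection both deleted sets are united. Two ends in the same component
    of the smaller graph share its vertices, so they also agree for each of the two original
    sets.\<close>
  have SS: "finite (S \<union> S')" "S \<union> S' \<subseteq> V" using S S' by auto
  have eq: "end_component G S0 \<eta> = end_component G S0 \<omega>"
    if \<eta>: "\<eta> \<in> graph_ends G" and e: "end_component G (S \<union> S') \<eta> = end_component G (S \<union> S') \<omega>"
      and S0: "S0 \<subseteq> S \<union> S'" for \<eta> S0
  proof -
    have fS0: "finite S0" "S0 \<subseteq> V" using S0 SS finite_subset by auto
    have "end_component G (S \<union> S') \<omega> \<noteq> {}"
      using end_component_props(4)[OF \<open>\<omega> \<in> graph_ends G\<close> SS] by blast
    then obtain v where "v \<in> end_component G (S \<union> S') \<omega>" by blast
    then have "v \<in> end_component G S0 \<eta>" "v \<in> end_component G S0 \<omega>"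
      using end_component_anti[OF \<eta> SS S0] end_component_anti[OF \<open>\<omega> \<in> graph_ends G\<close> SS S0] e by auto
    then show ?thesis using component_unique end_component_props(1) fS0 \<eta> \<open>\<omega> \<in> graph_ends G\<close> by metis
  qed
  have "Vertex ` end_component G (S \<union> S') \<omega> \<subseteq> Vertex ` end_component G S \<omega>"
    "Vertex ` end_component G (S \<union> S') \<omega> \<subseteq> Vertex ` end_component G S' \<omega>"
    using end_component_anti[OF \<open>\<omega> \<in> graph_ends G\<close> SS] by (intro image_mono; simp)+
  note sub = Int_greatest[OF order_trans[OF this(1) S(3)] order_trans[OF this(2) S'(3)]]
  have "EndPoint \<eta> \<in> a \<inter> b"
    if "\<eta> \<in> graph_ends G" "end_component G (S \<union> S') \<eta> = end_component G (S \<union> S') \<omega>" for \<eta>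
    using S(4)[rule_format, OF that(1) eq[OF that Un_upper1]]
      S'(4)[rule_format, OF that(1) eq[OF that Un_upper2]] by (rule IntI)
  then show ?case using SS sub by (intro exI[of _ "S \<union> S'"]) (simp del: image_subset_iff Un_subset_iff)
next
  case (UN K)
  then obtain k where k: "k \<in> K" "EndPoint \<omega> \<in> k" by auto
  from UN.IH[OF this UN.prems(2)] obtain S where "finite S \<and> S \<subseteq> V \<and> Vertex ` end_component G S \<omega> \<subseteq> k
    \<and> (\<forall>\<eta>\<in>graph_ends G. end_component G S \<eta> = end_component G S \<omega> \<longrightarrow> EndPoint \<eta> \<in> k)" by (elim exE)
  then show ?case using k(1) by (intro exI[of _ S]) auto
next
  case (Basis s)
  then obtain S \<omega>' \<epsilon> where s: "s = end_nbhd G S \<omega>' \<epsilon>" "finite S" "S \<subseteq> V" "\<omega>' \<in> graph_ends G"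
    by (auto simp: open_star_def open_segment_of_def)
  define C where "C = end_component G S \<omega>'"
  have C: "C \<in> components_minus G S" using end_component_props(1) s by (auto simp: C_def)
  have "\<exists>R\<in>\<omega>. range (fst R) \<subseteq> C" using Basis(2) by (auto simp: s end_nbhd_def Let_def C_def inner_points_def)
  then have "end_component G S \<omega> = C" using ray_in_component_iff[OF Basis(3) s(2,3) C] by simp
  then show ?case using s ray_in_component_iff[OF _ s(2,3) C]
    by (intro exI[of _ S]) (auto simp: end_nbhd_def Let_def C_def)
qed

lemma bipartition_cut:
  assumes "is_bipartition G A B"
  shows "cut_edges G A B = bdG A"
proof
  show "cut_edges G A B \<subseteq> bdG A"
    using assms by (auto simp: cut_edges_def bd_def is_bipartition_def)
  show "bdG A \<subseteq> cut_edges G A B"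
  proof
    fix e assume "e \<in> bdG A"
    then obtain u v where uv: "e \<in> edges G" "ends G e = {u, v}" "u \<in> A" "v \<notin> A"
      using bd_cases[OF graphlike_G] by blast
    then have "v \<in> B" using ends_subset[of e] assms by (auto simp: is_bipartition_def)
    with uv show "e \<in> cut_edges G A B" by (auto simp: cut_edges_def)
  qed
qed

text \<open>A cut is represented by its side at \<open>t\<close>, the other side being the
  complement, because uncrossing operates on sides and not on edge sets.\<close>

definition sep :: "('v, 'e) point set \<Rightarrow> ('v, 'e) point \<Rightarrow> 'v set \<Rightarrow> bool" where
  "sep T t A \<longleftrightarrow> A \<subseteq> V \<and> finite (bdG A) \<and> lives_in {t} A \<and> lives_in (T - {t}) (V - A)"

definition minsep where
  "minsep T t A \<longleftrightarrow> sep T t A \<and> card (bdG A) = cut_lambda G t (T - {t})"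

lemma separating_cut_iff: "separating_cut G {t} (T - {t}) F \<longleftrightarrow> (\<exists>A. sep T t A \<and> F = bdG A)"
proof
  assume "separating_cut G {t} (T - {t}) F"
  then obtain A B where AB: "finite F" "is_bipartition G A B" "F = cut_edges G A B" "lives_in {t} A"
    "lives_in (T - {t}) B" by (auto simp: separating_cut_def)
  have "B = V - A" "A \<subseteq> V" using AB by (auto simp: is_bipartition_def)
  then show "\<exists>A. sep T t A \<and> F = bdG A" using AB bipartition_cut by (auto simp: sep_def)
next
  assume "\<exists>A. sep T t A \<and> F = bdG A"
  then obtain A where A: "sep T t A" "F = bdG A" by blast
  then have "is_bipartition G A (V - A)" by (auto simp: sep_def is_bipartition_def)
  then show "separating_cut G {t} (T - {t}) F" using A bipartition_cut
    unfolding separating_cut_def sep_def by metis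
qed

lemma cut_lambda_le: "sep T t A \<Longrightarrow> cut_lambda G t (T - {t}) \<le> card (bdG A)"
  unfolding cut_lambda_def separating_cut_iff by (rule Least_le) blast

lemma minsep_exists:
  assumes "sep T t A"
  shows "\<exists>B. minsep T t B"
proof -
  have "\<exists>F. (\<exists>A. sep T t A \<and> F = bdG A) \<and> card F = cut_lambda G t (T - {t})"
    unfolding cut_lambda_def separating_cut_iff by (rule LeastI[where k = "card (bdG A)"]) (use assms in blast)
  then show ?thesis by (auto simp: minsep_def)
qed

text \<open>For a vertex its own star is a finite cut, and every ray eventually leaves that vertex.
  For an end an isolating open set is needed; it contains a component in which no other terminal
  lives.\<close>

lemma sep_exists:
  assumes T: "T \<subseteq> vhat G" and disc: "subtopology (end_compactification G) T = discrete_topology T"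
    and t: "t \<in> T"
  shows "\<exists>A. sep T t A"
proof -
  have tv: "t \<in> vhat G" using assms by auto
  then show ?thesis
  proof (cases rule: vhat_cases)
    case (1 v)
    have "bdG {v} \<subseteq> {e \<in> edges G. v \<in> ends G e}" by (auto simp: bd_def)
    then have "finite (bdG {v})" using finite_degree[OF 1(2)] finite_subset by blast
    moreover have "lives_in {x} (V - {v})" if "x \<in> T - {t}" for x
    proof -
      have "x \<in> vhat G" using that T by auto
      then show ?thesis
      proof (cases rule: vhat_cases)
        case (1 w)
        then show ?thesis using that \<open>t = Vertex v\<close> by auto
      next
        case (2 \<omega>)
        have "has_tail_in R (V - {v})" if "R \<in> \<omega>" for R
          using ray_avoids[of R "{v}"] ends_rays[OF 2(2) that] raysD(2) unfolding has_tail_in_def by blast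
        then show ?thesis using 2 by (simp add: lives_in_EndPoint)
      qed
    qed
    ultimately have "sep T t {v}" using 1 lives_in_iff[of "T - {t}"] by (simp add: sep_def)
    then show ?thesis ..
  next
    case (2 \<omega>)
    have "openin (subtopology (end_compactification G) T) {t}" unfolding disc using t by simp
    then obtain U where U: "openin (end_compactification G) U" "{t} = U \<inter> T"
      by (auto simp: openin_subtopology)
    have "EndPoint \<omega> \<in> U" using U 2 by auto
    from end_isolated[OF U(1)[unfolded end_compactification_def openin_topology_generated_by_iff] this 2(2)]
    obtain S where S0: "finite S" "S \<subseteq> V" "Vertex ` end_component G S \<omega> \<subseteq> U"
      "\<forall>\<eta>\<in>graph_ends G. end_component G S \<eta> = end_component G S \<omega> \<longrightarrow> EndPoint \<eta> \<in> U"
      by (elim exE conjE)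
    note S = S0(1-3) S0(4)[rule_format]
    define C where "C = end_component G S \<omega>"
    have C: "C \<in> components_minus G S" using end_component_props(1) 2 S by (simp add: C_def)
    have CV: "C \<subseteq> V" using component_subset[OF C] by auto
    have "lives_in {x} (V - C)" if x: "x \<in> T - {t}" for x
    proof -
      have "x \<in> vhat G" using x T by auto
      then show ?thesis
      proof (cases rule: vhat_cases)
        case (1 w)
        have "w \<notin> C"
        proof
          assume "w \<in> C"
          then have "x \<in> U \<inter> T" using S(3) x 1 unfolding C_def by blast
          then show False using x U(2) by blast
        qed
        then show ?thesis using 1 by simp
      next
        case (2 \<eta>)
        then have "EndPoint \<eta> \<notin> U" using x U(2) by blast
        then have ne: "end_component G S \<eta> \<noteq> C" using S(4)[OF 2(2)] unfolding C_def by blast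
        have c: "end_component G S \<eta> \<in> components_minus G S" using end_component_props(1) 2 S by simp
        then have "end_component G S \<eta> \<subseteq> V - C" using component_subset[OF c] component_unique[OF c C] ne by blast
        then have "has_tail_in R (V - C)" if "R \<in> \<eta>" for R
          using end_component_props(2)[OF 2(2) S(1,2) that] has_tail_in_mono by blast
        then show ?thesis using 2 by (simp add: lives_in_EndPoint)
      qed
    qed
    moreover have "lives_in {t} C" using end_component_props(2)[OF 2(2) S(1,2)] 2 by (simp add: lives_in_EndPoint C_def)
    ultimately have "sep T t C" using finite_bd_component[OF C S(1,2)] CV lives_in_iff[of "T - {t}"] by (simp add: sep_def)
    then show ?thesis ..
  qed
qed


section \<open>Disjoint minimum cuts\<close>

lemma component_edge:
  assumes "D \<in> components_minus G {}" "e \<in> edges G" "ends G e \<inter> D \<noteq> {}"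
  shows "ends G e \<subseteq> D"
proof -
  obtain u v where "ends G e = {u, v}" using graphlike_G assms(2) by (auto simp: graphlike_def)
  then show ?thesis using component_closed[OF assms(1) _ assms(2), of u v]
      component_closed[OF assms(1) _ assms(2), of v u] assms(3) by (auto simp: insert_commute)
qed

text \<open>No edge leaves \<open>D\<close>, so intersecting with it creates no boundary
  edges.\<close>

lemma bd_Int_component:
  assumes "D \<in> components_minus G {}"
  shows "bdG (X \<inter> D) = bdG X \<inter> {e. ends G e \<subseteq> D}"
  using component_edge[OF assms] by (fastforce simp: bd_def)

text \<open>The balls around a vertex are finite by local finiteness, and the component is their
  union.\<close>

lemma countable_component:
  assumes "D \<in> components_minus G {}"
  shows "countable D"
proof -
  obtain v where D: "D = {w. reach {} v w}" using assms by (auto simp: components_minus_def)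
  let ?r = "adjacent_avoiding G {}"
  have fin: "finite {w. ?r u w}" for u
  proof (cases "u \<in> V")
    case True
    have "{w. ?r u w} \<subseteq> \<Union>(ends G ` {e \<in> edges G. u \<in> ends G e})"
      by (auto simp: adjacent_avoiding_def)
    moreover have "finite (ends G e)" if "e \<in> edges G" for e
    proof -
      have "\<exists>u v. ends G e = {u, v}" using graphlike_G that by (simp add: graphlike_def)
      then show ?thesis by auto
    qed
    ultimately show ?thesis using finite_degree[OF True] by (auto intro: finite_subset)
  qed (simp add: adjacent_avoiding_def)
  have "finite {w. (?r ^^ n) v w}" for n
  proof (induction n)
    case (Suc n)
    have "{w. (?r ^^ Suc n) v w} = (\<Union>u\<in>{w. (?r ^^ n) v w}. {w. ?r u w})" by auto
    then show ?case using Suc fin by simp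
  qed simp
  moreover have "D = (\<Union>n. {w. (?r ^^ n) v w})" unfolding D rtranclp_power by blast
  ultimately show ?thesis by (simp add: countable_finite)
qed

text \<open>In a connected graph a side is determined by its boundary and by whether it contains one
  fixed vertex \<open>v\<close>: membership propagates along paths from \<open>v\<close>. There are
  only countably many finite edge sets.\<close>

lemma countable_finite_cuts:
  assumes D: "D \<in> components_minus G {}"
  shows "countable {A. A \<subseteq> D \<and> finite (bdG A)}"
proof -
  obtain v where v: "v \<in> D" using assms by (auto simp: components_minus_def)
  define ED where "ED = (\<Union>u\<in>D. {e \<in> edges G. u \<in> ends G e})"
  have "countable ED" unfolding ED_def
  proof (rule countable_UN[OF countable_component[OF D]])
    fix u assume "u \<in> D"
    then show "countable {e \<in> edges G. u \<in> ends G e}"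
      using finite_degree[of u] component_subset[OF D] by (auto intro: countable_finite)
  qed
  then have "countable ({F. finite F \<and> F \<subseteq> ED} \<times> (UNIV :: bool set))"
    by (intro countable_SIGMA countable_Collect_finite_subset) auto
  moreover have "(\<lambda>A. (bdG A, v \<in> A)) ` {A. A \<subseteq> D \<and> finite (bdG A)} \<subseteq> {F. finite F \<and> F \<subseteq> ED} \<times> UNIV"
    by (auto simp: ED_def bd_def)
  ultimately have "countable ((\<lambda>A. (bdG A, v \<in> A)) ` {A. A \<subseteq> D \<and> finite (bdG A)})"
    using countable_subset by blast
  moreover have "inj_on (\<lambda>A. (bdG A, v \<in> A)) {A. A \<subseteq> D \<and> finite (bdG A)}"
  proof (rule inj_onI, clarify)
    fix A B assume AB: "A \<subseteq> D" "B \<subseteq> D" "bdG A = bdG B" "(v \<in> A) = (v \<in> B)"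
    have "w \<in> A \<longleftrightarrow> w \<in> B" if "w \<in> D" for w
    proof -
      have "reach {} v w" using component_eq[OF D v] that by auto
      then show ?thesis
      proof (induction rule: rtranclp_induct)
        case (step x y)
        then obtain e where e: "e \<in> edges G" "ends G e = {x, y}" by (auto simp: adjacent_avoiding_def)
        have "e \<in> bdG A \<longleftrightarrow> (x \<in> A) \<noteq> (y \<in> A)" "e \<in> bdG B \<longleftrightarrow> (x \<in> B) \<noteq> (y \<in> B)"
          using e by (auto simp: bd_def)
        then show ?case using AB step by auto
      qed (use AB in simp)
    qed
    then show "A = B" using AB by blast
  qed
  ultimately show ?thesis using countable_image_inj_on by blast
qed

lemma lives_in_component:
  assumes "x \<in> vhat G"
  shows "\<exists>D\<in>components_minus G {}. lives_in {x} D"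
  using assms
proof (cases rule: vhat_cases)
  case (1 v)
  then show ?thesis using component_of[of v "{}"] by auto
next
  case (2 \<omega>)
  then have "lives_in {x} (end_component G {} \<omega>)"
    using end_component_props(2)[of \<omega> "{}"] by (simp add: lives_in_EndPoint)
  then show ?thesis using end_component_props(1)[of \<omega> "{}"] 2 by blast
qed

lemma sep_Int_component:
  assumes "sep T t A" "D \<in> components_minus G {}" "lives_in {t} D"
  shows "sep T t (A \<inter> D)"
proof -
  have "finite (bdG (A \<inter> D))" using assms(1) by (auto simp: bd_Int_component[OF assms(2)] sep_def)
  moreover have "lives_in (T - {t}) (V - A \<inter> D)"
    by (rule lives_in_mono[of _ "V - A"]) (use assms(1) in \<open>auto simp: sep_def\<close>)
  ultimately show ?thesis using assms lives_in_Int by (auto simp: sep_def)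
qed

lemma minsep_Int_component:
  assumes "minsep T t A" "D \<in> components_minus G {}" "lives_in {t} D"
  shows "minsep T t (A \<inter> D)"
proof -
  have s: "sep T t (A \<inter> D)" using sep_Int_component assms by (auto simp: minsep_def)
  have "card (bdG (A \<inter> D)) \<le> card (bdG A)"
    by (rule card_mono) (use assms in \<open>auto simp: bd_Int_component[OF assms(2)] minsep_def sep_def\<close>)
  then show ?thesis using s cut_lambda_le[OF s] assms(1) by (auto simp: minsep_def)
qed

lemma sep_Diff:
  assumes "sep T t A" "sep T s B" "s \<noteq> t" "t \<in> T" "s \<in> T"
  shows "sep T t (A - B)"
proof -
  have "lives_in {t} (V - B)" using assms lives_in_iff[of "T - {s}"] by (auto simp: sep_def)
  then have "lives_in {t} (A \<inter> (V - B))" using assms by (auto simp: sep_def intro: lives_in_Int)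
  then have "lives_in {t} (A - B)" by (rule lives_in_mono) auto
  moreover have "lives_in (T - {t}) (V - (A - B))"
    by (rule lives_in_mono[of _ "V - A"]) (use assms(1) in \<open>auto simp: sep_def\<close>)
  moreover have "finite (bdG (A - B))"
    using assms finite_subset[OF bd_Diff_subset] by (auto simp: sep_def)
  ultimately show ?thesis using assms by (auto simp: sep_def)
qed

text \<open>By posimodularity the boundaries of \<open>A - B\<close> and \<open>B - A\<close>
  together are no larger than those of \<open>A\<close> and \<open>B\<close>. Both differences still
  separate, so both attain the minimum.\<close>

lemma minsep_Diff:
  assumes "minsep T t A" "minsep T s B" "s \<noteq> t" "t \<in> T" "s \<in> T"
  shows "minsep T t (A - B)"
proof -
  have 1: "sep T t (A - B)" and 2: "sep T s (B - A)" using assms sep_Diff by (auto simp: minsep_def)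
  have "card (bdG (A - B)) + card (bdG (B - A)) \<le> card (bdG A) + card (bdG B)"
    by (rule posimodular[OF graphlike_G]) (use assms in \<open>auto simp: minsep_def sep_def\<close>)
  then show ?thesis using cut_lambda_le[OF 1] cut_lambda_le[OF 2] 1 assms by (auto simp: minsep_def)
qed

lemma minsep_Diff_Union:
  assumes "finite J" "minsep T t A" "t \<in> T" "\<And>s. s \<in> J \<Longrightarrow> minsep T s (B s) \<and> s \<noteq> t \<and> s \<in> T"
  shows "minsep T t (A - \<Union>(B ` J))"
  using assms(1,4)
proof (induction J rule: finite_induct)
  case empty
  then show ?case using assms by simp
next
  case (insert s J)
  have "A - \<Union>(B ` insert s J) = (A - \<Union>(B ` J)) - B s" by auto
  then show ?case using insert minsep_Diff[of T t "A - \<Union>(B ` J)" s "B s"] assms(3) by auto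
qed

text \<open>The last condition keeps each side in the component of its terminal, so that the
  contraction can be treated in each component separately.\<close>

definition separators where
  "separators T A \<longleftrightarrow> (\<forall>t\<in>T. minsep T t (A t)) \<and> (\<forall>s\<in>T. \<forall>t\<in>T. s \<noteq> t \<longrightarrow> A s \<inter> A t = {})
    \<and> (\<forall>t\<in>T. \<forall>D\<in>components_minus G {}. lives_in {t} D \<longrightarrow> A t \<subseteq> D)"

text \<open>Distinct terminals of \<open>D\<close> have distinct separating sides, and there are
  only countably many candidates for these.\<close>

lemma countable_terminals:
  assumes "T \<subseteq> vhat G" "\<And>t. t \<in> T \<Longrightarrow> sep T t (A t)" "D \<in> components_minus G {}"
  shows "countable {t \<in> T. lives_in {t} D}"
proof -
  let ?T = "{t \<in> T. lives_in {t} D}"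
  have "(\<lambda>t. A t \<inter> D) ` ?T \<subseteq> {A. A \<subseteq> D \<and> finite (bdG A)}"
    using sep_Int_component[OF assms(2,3)] by (auto simp: sep_def)
  then have "countable ((\<lambda>t. A t \<inter> D) ` ?T)"
    using countable_finite_cuts[OF assms(3)] countable_subset by blast
  moreover have "inj_on (\<lambda>t. A t \<inter> D) ?T"
  proof (rule inj_onI, rule ccontr)
    fix s t assume st: "s \<in> ?T" "t \<in> ?T" "A s \<inter> D = A t \<inter> D" "s \<noteq> t"
    then have "sep T s (A s \<inter> D)" "sep T t (A s \<inter> D)"
      using sep_Int_component[OF assms(2,3), of s] sep_Int_component[OF assms(2,3), of t] by auto
    then have "lives_in {s} (A s \<inter> D)" "lives_in {s} (V - A s \<inter> D)"
      using st lives_in_iff[of "T - {t}"] by (auto simp: sep_def)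
    then show False using lives_in_not_disjoint[of s] assms(1) st by blast
  qed
  ultimately show ?thesis using countable_image_inj_on by blast
qed

text \<open>The terminals of each component are numbered, and from each side the sides of the
  finitely many terminals with smaller numbers are subtracted.\<close>

lemma separators_exist:
  assumes T: "T \<subseteq> vhat G" and sep: "\<And>t. t \<in> T \<Longrightarrow> \<exists>A. sep T t A"
  shows "\<exists>A. separators T A"
proof -
  have "\<exists>D\<in>components_minus G {}. lives_in {t} D" if "t \<in> T" for t
    using lives_in_component that T by blast
  then obtain D where D: "\<And>t. t \<in> T \<Longrightarrow> D t \<in> components_minus G {} \<and> lives_in {t} (D t)" by metis
  have D_uniq: "D t = C" if "t \<in> T" "C \<in> components_minus G {}" "lives_in {t} C" for t C
    using lives_in_not_disjoint[OF _ that(3), of "D t"] D[OF that(1)] that T component_unique by blast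
  have "\<exists>B. minsep T t B \<and> B \<subseteq> D t" if t: "t \<in> T" for t
  proof -
    obtain A where "minsep T t A" using sep[OF t] minsep_exists by blast
    then show ?thesis using minsep_Int_component D[OF t] by blast
  qed
  then obtain B where B: "\<And>t. t \<in> T \<Longrightarrow> minsep T t (B t) \<and> B t \<subseteq> D t" by metis
  define K where "K t = {s \<in> T. lives_in {s} (D t)}" for t
  have cK: "countable (K t)" if "t \<in> T" for t
    unfolding K_def using countable_terminals[OF T, of B "D t"] B D that by (auto simp: minsep_def)
  define J where "J t = {s \<in> K t. to_nat_on (K t) s < to_nat_on (K t) t}" for t
  have KD: "K s = K t" if "s \<in> K t" "t \<in> T" for s t
    using that D_uniq[of s "D t"] D[OF that(2)] by (auto simp: K_def)
  have tK: "t \<in> K t" if "t \<in> T" for t using D that by (auto simp: K_def)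
  have fJ: "finite (J t)" if "t \<in> T" for t
  proof (rule inj_on_finite)
    show "inj_on (to_nat_on (K t)) (J t)"
      by (rule inj_on_subset[OF inj_on_to_nat_on[OF cK[OF that]]]) (auto simp: J_def)
    show "to_nat_on (K t) ` J t \<subseteq> {..<to_nat_on (K t) t}" by (auto simp: J_def)
  qed simp
  define A where "A t = B t - \<Union>(B ` J t)" for t
  have AB: "A t \<subseteq> B t" for t by (auto simp: A_def)
  have "separators T A"
    unfolding separators_def
  proof (intro conjI ballI impI)
    show "minsep T t (A t)" if "t \<in> T" for t
      unfolding A_def
      by (rule minsep_Diff_Union[OF fJ[OF that]]) (use B that in \<open>auto simp: J_def K_def\<close>)
    show "A t \<subseteq> C" if "t \<in> T" "C \<in> components_minus G {}" "lives_in {t} C" for t C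
      using D_uniq[OF that] B[OF that(1)] AB by blast
    have less: "A s \<inter> A t = {}" if "s \<in> J t" for s t
      using that AB[of s] by (auto simp: A_def)
    fix s t assume st: "s \<in> T" "t \<in> T" "s \<noteq> t"
    show "A s \<inter> A t = {}"
    proof (cases "s \<in> K t")
      case True
      then have "to_nat_on (K t) s \<noteq> to_nat_on (K t) t"
        using inj_on_to_nat_on[OF cK[OF st(2)]] tK[OF st(2)] st(3) by (auto simp: inj_on_def)
      then have "s \<in> J t \<or> t \<in> J s"
        using True KD[OF True st(2)] tK[OF st(2)] by (auto simp: J_def)
      then show ?thesis using less by blast
    next
      case False
      then have "\<not> lives_in {s} (D t)" using st by (simp add: K_def)
      then have "D s \<noteq> D t" using D[OF st(1)] by metis
      then have "D s \<inter> D t = {}" using D st component_unique by blast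
      then show ?thesis using B[OF st(1)] B[OF st(2)] AB[of s] AB[of t] by blast
    qed
  qed
  then show ?thesis by blast
qed

section \<open>Contracting the cut sides\<close>

text \<open>Points serve as vertices of the contracted graph, so that a terminal, even an end, is
  the name of the vertex that its side is contracted to.\<close>

definition contract :: "('v, 'e) point set \<Rightarrow> (('v, 'e) point \<Rightarrow> 'v set) \<Rightarrow> 'v \<Rightarrow> ('v, 'e) point" where
  "contract T A v = (if \<exists>t\<in>T. v \<in> A t then (THE t. t \<in> T \<and> v \<in> A t) else Vertex v)"

lemma contract_in:
  assumes "separators T A" "t \<in> T" "v \<in> A t"
  shows "contract T A v = t"
proof -
  have "(THE t. t \<in> T \<and> v \<in> A t) = t"
    by (rule the_equality) (use assms in \<open>auto simp: separators_def\<close>)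
  then show ?thesis using assms by (auto simp: contract_def)
qed

lemma contract_out: "(\<And>t. t \<in> T \<Longrightarrow> v \<notin> A t) \<Longrightarrow> contract T A v = Vertex v"
  by (auto simp: contract_def)

text \<open>There is no clash of names: a vertex that is a terminal lies in its own side, so an
  uncontracted vertex is never a terminal.\<close>

lemma contract_terminal_iff:
  assumes "separators T A" "T \<subseteq> vhat G" "t \<in> T"
  shows "contract T A v = t \<longleftrightarrow> v \<in> A t"
proof
  assume c: "contract T A v = t"
  show "v \<in> A t"
  proof (cases "\<exists>s\<in>T. v \<in> A s")
    case True
    then show ?thesis using contract_in[OF assms(1)] c by blast
  next
    case False
    then have "t = Vertex v" using c by (simp add: contract_def)
    then show ?thesis using assms by (auto simp: separators_def minsep_def sep_def)
  qed
qed (rule contract_in[OF assms(1,3)])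

text \<open>Edges inside a side become loops, and simple walks avoid them.\<close>

definition cends where "cends T A e = contract T A ` ends G e"

lemma graphlike_cends: "graphlike (cends T A) (edges G)"
  unfolding graphlike_def
proof
  fix e assume "e \<in> edges G"
  then obtain u v where "ends G e = {u, v}" using graphlike_G unfolding graphlike_def by blast
  then have "cends T A e = {contract T A u, contract T A v}" by (simp add: cends_def)
  then show "\<exists>u v. cends T A e = {u, v}" by blast
qed

definition comp_edges where "comp_edges D = {e \<in> edges G. ends G e \<subseteq> D}"

lemma bd_cends:
  assumes "D \<in> components_minus G {}"
  shows "bd (cends T A) (comp_edges D) X = bdG (contract T A -` X \<inter> D)"
  unfolding bd_Int_component[OF assms] by (auto simp: bd_def cends_def comp_edges_def)

text \<open>Cuts of the contracted graph are cuts of \<open>G\<close> that split no side. Parity is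
  inherited from the hypothesis on \<open>G\<close>, and \<open>linked\<close> holds because a cut
  around a single terminal \<open>r\<close> separates it in \<open>G\<close>, so it has at least
  \<open>cut_lambda\<close> edges, the degree of \<open>r\<close>.\<close>

lemma good_contract:
  assumes T: "T \<subseteq> vhat G" and sp: "separators T A" and D: "D \<in> components_minus G {}"
    and par: "\<And>A B. \<lbrakk>is_bipartition G A B; finite (cut_edges G A B); lives_in T A \<or> lives_in T B\<rbrakk>
           \<Longrightarrow> even (card (cut_edges G A B))"
  shows "good (cends T A) (comp_edges D) {t \<in> T. lives_in {t} D}"
    and "t \<in> T \<Longrightarrow> lives_in {t} D \<Longrightarrow> bd (cends T A) (comp_edges D) {t} = bdG (A t)"
proof -
  let ?T = "{t \<in> T. lives_in {t} D}"
  have A: "minsep T t (A t)" if "t \<in> T" for t using sp that by (auto simp: separators_def)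
  have AD: "A t \<subseteq> D" if "t \<in> ?T" for t using sp that D by (auto simp: separators_def)
  have DV: "D \<subseteq> V" using component_subset[OF D] by simp
  have AnD: "A t \<inter> D = {}" if "t \<in> T" "t \<notin> ?T" for t
  proof -
    have "t \<in> vhat G" using that T by auto
    then obtain C where C: "C \<in> components_minus G {}" "lives_in {t} C" using lives_in_component by blast
    then have "A t \<subseteq> C" using sp that by (auto simp: separators_def)
    moreover have "C \<noteq> D" using C that by auto
    then have "C \<inter> D = {}" using component_unique[OF C(1) D] by blast
    ultimately show ?thesis by blast
  qed
  have pre: "contract T A -` {t} \<inter> D = A t" if "t \<in> ?T" for t
    using contract_terminal_iff[OF sp T] AD that by auto
  show deg: "bd (cends T A) (comp_edges D) {t} = bdG (A t)" if "t \<in> T" "lives_in {t} D" for t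
    unfolding bd_cends[OF D] using pre that by simp
  \<comment> \<open>A side whose terminal is not in \<open>X\<close> is disjoint from the preimage
    of \<open>X\<close> in \<open>D\<close>: it is contracted to a point outside \<open>X\<close> or
    lies in another component.\<close>
  have avoid: "lives_in {s} (V - contract T A -` X \<inter> D)" if "s \<in> T" "s \<notin> X \<inter> ?T" for s X
  proof -
    have "contract T A -` X \<inter> D \<inter> A s = {}"
    proof (cases "s \<in> ?T")
      case True
      then show ?thesis using contract_in[OF sp] that by auto
    next
      case False
      then show ?thesis using AnD[OF that(1)] by blast
    qed
    moreover have "A s \<subseteq> V" "lives_in {s} (A s)" using A[OF that(1)] by (auto simp: minsep_def sep_def)
    ultimately show ?thesis using lives_in_mono by (metis Diff_Compl Diff_eq Int_commute disjoint_eq_subset_Compl le_inf_iff)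
  qed
  show "good (cends T A) (comp_edges D) ?T"
    unfolding good_def
  proof (intro conjI ballI)
    show "graphlike (cends T A) (comp_edges D)"
      by (rule graphlike_subset[OF graphlike_cends]) (auto simp: comp_edges_def)
    show "finite (bd (cends T A) (comp_edges D) {r})" if "r \<in> ?T" for r
      using deg[of r] that A[of r] by (auto simp: minsep_def sep_def)
    show "inner_even (cends T A) (comp_edges D) ?T"
      unfolding inner_even_def bd_cends[OF D]
    proof (intro allI impI)
      fix X assume X: "X \<inter> ?T = {}" and fin: "finite (bdG (contract T A -` X \<inter> D))"
      let ?Y = "contract T A -` X \<inter> D"
      have bip: "is_bipartition G ?Y (V - ?Y)" using DV by (auto simp: is_bipartition_def)
      have "lives_in T (V - ?Y)" unfolding lives_in_iff[of T] using avoid[of _ X] X by blast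
      then show "even (card (bdG ?Y))" using par[OF bip] fin unfolding bipartition_cut[OF bip] by blast
    qed
    show "linked (cends T A) (comp_edges D) ?T"
      unfolding linked_def
    proof (intro ballI allI impI)
      fix r X assume r: "r \<in> ?T" and X: "X \<inter> ?T = {r}" and fin: "finite (bd (cends T A) (comp_edges D) X)"
      let ?Y = "contract T A -` X \<inter> D"
      have "A r \<subseteq> ?Y" using pre[OF r] X by auto
      moreover have "lives_in {r} (A r)" using A[of r] r by (simp add: minsep_def sep_def)
      ultimately have "lives_in {r} ?Y" by (metis lives_in_mono)
      moreover have "lives_in (T - {r}) (V - ?Y)"
        unfolding lives_in_iff[of "T - {r}"] using avoid[of _ X] X by blast
      ultimately have "sep T r ?Y" using fin DV unfolding bd_cends[OF D] by (auto simp: sep_def)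
      then have "cut_lambda G r (T - {r}) \<le> card (bdG ?Y)" by (rule cut_lambda_le)
      then show "card (bd (cends T A) (comp_edges D) {r}) \<le> card (bd (cends T A) (comp_edges D) X)"
        using deg[of r] r A[of r] unfolding bd_cends[OF D] by (auto simp: minsep_def)
    qed
  qed
qed

end


section \<open>Linkages inside a cut side\<close>

text \<open>Menger's theorem is applied from the complement of \<open>A\<close> to \<open>D\<close>.
  Since the boundary of \<open>A\<close> is minimum and each path crosses it, pigeonhole gives every
  boundary edge its own path. The boundary edges are included in the disjointness claim so that
  linkages can be composed.\<close>

lemma cut_linkage:
  assumes gl: "graphlike g E" and fin: "finite (bd g E A)" and DA: "D \<subseteq> A"
    and min: "\<And>Y. \<lbrakk>D \<subseteq> Y; Y \<subseteq> A; finite (bd g E Y)\<rbrakk> \<Longrightarrow> card (bd g E A) \<le> card (bd g E Y)"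
  shows "\<exists>v ps. (\<forall>e\<in>bd g E A. v e \<in> g e \<inter> A \<and> walk g E (v e) (ps e) \<and> simple (v e) (ps e)
      \<and> pverts (v e) (ps e) \<subseteq> A \<and> pverts (v e) (ps e) \<inter> D = {wend (v e) (ps e)})
    \<and> (\<forall>e\<in>bd g E A. \<forall>e'\<in>bd g E A. e \<noteq> e' \<longrightarrow> insert e (pedges (ps e)) \<inter> insert e' (pedges (ps e')) = {})"
proof -
  define k where "k = card (bd g E A)"
  have SD: "- A \<inter> D = {}" using DA by auto
  have kmin: "k \<le> card (bd g E X)" if "- A \<subseteq> X" "X \<inter> D = {}" "finite (bd g E X)" for X
    using min[of "- X"] that by (auto simp: bd_Compl k_def)
  obtain u qs where qs: "\<And>i. i < k \<Longrightarrow> link g E (- A) D (u i) (qs i)"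
    and disj: "\<And>i j. \<lbrakk>i < k; j < k; i \<noteq> j\<rbrakk> \<Longrightarrow> pedges (qs i) \<inter> pedges (qs j) = {}"
    using menger[OF SD gl kmin] by metis
  have cross: "pedges (qs i) \<inter> bd g E A \<noteq> {}" if i: "i < k" for i
  proof -
    have "walk g E (u i) (qs i)" "u i \<in> - A" "wend (u i) (qs i) \<in> D"
      using qs[OF i] unfolding link_iff by blast+
    then obtain e where "e \<in> pedges (qs i)" "e \<in> bd g E (- A)"
      using walk_crosses[of g E "u i" "qs i" "- A"] DA by blast
    then show ?thesis by (auto simp: bd_Compl)
  qed
  have "\<exists>i<k. pedges (qs i) \<inter> bd g E A = {e}" if e: "e \<in> bd g E A" for e
    by (rule disjoint_family_cover[of "bd g E A" k "\<lambda>i. pedges (qs i)"])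
      (use fin cross disj e in \<open>auto simp: k_def\<close>)
  then obtain i where i: "\<And>e. e \<in> bd g E A \<Longrightarrow> i e < k \<and> pedges (qs (i e)) \<inter> bd g E A = {e}" by metis
  \<comment> \<open>A linkage path meets the complement of \<open>A\<close> only in its first
    vertex, so its first edge is its unique boundary edge \<open>e\<close>.\<close>
  have *: "\<exists>v ps. qs (i e) = (e, v) # ps \<and> v \<in> g e \<inter> A \<and> walk g E v ps \<and> simple v ps
      \<and> pverts v ps \<subseteq> A \<and> pverts v ps \<inter> D = {wend v ps}" if e: "e \<in> bd g E A" for e
  proof -
    note l = qs[of "i e"] i[OF e]
    have q: "walk g E (u (i e)) (qs (i e))" "simple (u (i e)) (qs (i e))" "u (i e) \<in> - A"
      "snd ` set (qs (i e)) \<inter> - A = {}" "pverts (u (i e)) (qs (i e)) \<inter> D = {wend (u (i e)) (qs (i e))}"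
      using l(1)[unfolded link_iff] l(1)[unfolded link_def] l(2) by simp_all
    have "qs (i e) \<noteq> []" using cross[of "i e"] i[OF e] by auto
    then obtain e' v ps where eq: "qs (i e) = (e', v) # ps" by (metis list.exhaust surj_pair)
    have vA: "v \<in> A" using q(4) eq by auto
    have "e' \<in> bd g E A" using q eq vA by (auto simp: bd_def)
    moreover have "e' \<in> pedges (qs (i e))" using eq by simp
    ultimately have "e' = e" using i[OF e] by blast
    moreover have "pverts v ps \<subseteq> A" using q(4) eq by auto
    moreover have "u (i e) \<notin> D" using q(3) DA by auto
    then have "pverts v ps \<inter> D = {wend v ps}" using q(5) eq by simp
    ultimately show ?thesis using q eq vA by auto
  qed
  then obtain v ps where vp: "\<And>e. e \<in> bd g E A \<Longrightarrow> qs (i e) = (e, v e) # ps e \<and> v e \<in> g e \<inter> A \<and> walk g E (v e) (ps e)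
      \<and> simple (v e) (ps e) \<and> pverts (v e) (ps e) \<subseteq> A \<and> pverts (v e) (ps e) \<inter> D = {wend (v e) (ps e)}" by metis
  have "insert e (pedges (ps e)) \<inter> insert e' (pedges (ps e')) = {}"
    if ee: "e \<in> bd g E A" "e' \<in> bd g E A" "e \<noteq> e'" for e e'
  proof -
    have "i e \<noteq> i e'" using i[OF ee(1)] i[OF ee(2)] ee(3) by auto
    then have "pedges (qs (i e)) \<inter> pedges (qs (i e')) = {}" using disj i ee by blast
    moreover have "pedges (qs (i e)) = insert e (pedges (ps e))" "pedges (qs (i e')) = insert e' (pedges (ps e'))"
      using vp[OF ee(1)] vp[OF ee(2)] by simp_all
    ultimately show ?thesis by simp
  qed
  with vp show ?thesis by (intro exI[of _ v] exI[of _ ps]) blast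
qed

lemma simple_append:
  "simple u (ps @ qs) \<longleftrightarrow> simple u ps \<and> simple (wend u ps) qs \<and> snd ` set qs \<inter> pverts u ps = {}"
  using wend_in_pverts by (induction u ps rule: wend.induct) (auto simp: simple_def)

lemma walk_nth:
  assumes "walk g E u ps" "i < length ps"
  shows "fst (ps ! i) \<in> E \<and> g (fst (ps ! i)) = {(u # map snd ps) ! i, snd (ps ! i)}"
  using assms
proof (induction g E u ps arbitrary: i rule: walk.induct)
  case (2 g E u e v ps)
  then show ?case by (cases i) auto
qed auto

lemma prefix_limit:
  fixes W :: "nat \<Rightarrow> 'a list"
  assumes ext: "\<And>m n. m \<le> n \<Longrightarrow> \<exists>xs. W n = W m @ xs" and unb: "\<And>i. \<exists>n. i < length (W n)"
  shows "\<exists>h. \<forall>n. \<forall>i<length (W n). W n ! i = h i"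
proof -
  obtain N where N: "\<And>i. i < length (W (N i))" using unb by metis
  have "W n ! i = W (N i) ! i" if i: "i < length (W n)" for n i
  proof (cases "n \<le> N i")
    case True
    then obtain xs where "W (N i) = W n @ xs" using ext by blast
    then show ?thesis using i by (simp add: nth_append)
  next
    case False
    then obtain xs where "W n = W (N i) @ xs" using ext[of "N i" n] by auto
    then show ?thesis using N by (simp add: nth_append)
  qed
  then show ?thesis by (intro exI[of _ "\<lambda>i. W (N i) ! i"]) blast
qed

section \<open>Rays converging to an end through nested minimum cuts\<close>

context lf_graph
begin

abbreviation "walkG \<equiv> walk (ends G) (edges G)"

text \<open>The walks agree on common indices, so entries can be read off from any sufficiently long
  one; injectivity of the limit is also checked inside one such walk.\<close>

lemma walk_limit_ray:
  fixes W :: "nat \<Rightarrow> ('e \<times> 'v) list"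
  assumes W: "\<And>n. walkG u (W n) \<and> simple u (W n)"
    and ext: "\<And>m n. m \<le> n \<Longrightarrow> \<exists>xs. W n = W m @ xs" and unb: "\<And>i. \<exists>n. i < length (W n)"
  shows "\<exists>p f. (p, f) \<in> rays G \<and> p 0 = u \<and> (\<forall>n. \<forall>i<length (W n). W n ! i = (f i, p (Suc i)))"
proof -
  obtain h where h: "\<And>n i. i < length (W n) \<Longrightarrow> W n ! i = h i" using prefix_limit[of W, OF ext unb] by blast
  define p where "p i = (case i of 0 \<Rightarrow> u | Suc j \<Rightarrow> snd (h j))" for i
  define f where "f i = fst (h i)" for i
  have nth: "(u # map snd (W n)) ! i = p i" if "i \<le> length (W n)" for n i
    using that h by (cases i) (auto simp: p_def)
  have fi: "f i \<in> edges G \<and> ends G (f i) = {p i, p (Suc i)}" for i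
  proof -
    obtain n where n: "i < length (W n)" using unb by blast
    then show ?thesis using walk_nth[of "ends G" "edges G" u "W n" i] W[of n] h[OF n] nth[of i n]
      by (simp add: f_def p_def)
  qed
  have "inj p"
  proof (rule injI)
    fix i j assume eq: "p i = p j"
    obtain n where n: "max i j < length (W n)" using unb by blast
    have "distinct (u # map snd (W n))" using W[of n] by (simp add: simple_def)
    moreover have "(u # map snd (W n)) ! i = (u # map snd (W n)) ! j" using eq nth[of i n] nth[of j n] n by simp
    ultimately show "i = j" using n nth_eq_iff_index_eq[of "u # map snd (W n)" i j] by simp
  qed
  moreover have "p i \<in> V" for i using ends_subset fi by (metis insert_subset)
  ultimately have "(p, f) \<in> rays G" using fi by (auto simp: rays_def)
  moreover have "W n ! i = (f i, p (Suc i))" if "i < length (W n)" for n i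
    using h[OF that] by (simp add: f_def p_def)
  ultimately show ?thesis by (intro exI[of _ p] exI[of _ f]) (auto simp: p_def)
qed

text \<open>The component of the end is countable, so deleting longer and longer initial parts of an
  enumeration of it yields a countable neighbourhood base.\<close>

lemma end_basis:
  assumes \<omega>: "\<omega> \<in> graph_ends G"
  shows "\<exists>C :: nat \<Rightarrow> 'v set. (\<forall>n. C n \<subseteq> V \<and> finite (bdG (C n)) \<and> lives_in {EndPoint \<omega>} (C n))
    \<and> (\<forall>v. \<exists>n. v \<notin> C n) \<and> (\<forall>S. finite S \<longrightarrow> S \<subseteq> V \<longrightarrow> (\<exists>n. C n \<subseteq> end_component G S \<omega>))"
proof -
  define D where "D = end_component G {} \<omega>"
  have D: "D \<in> components_minus G {}" using end_component_props(1)[OF \<omega>, of "{}"] by (simp add: D_def)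
  then have "D \<noteq> {}" by (auto simp: components_minus_def)
  define d where "d = from_nat_into D"
  have d: "range d = D" using \<open>D \<noteq> {}\<close> countable_component[OF D] by (simp add: d_def)
  have DV: "D \<subseteq> V" using component_subset[OF D] by simp
  define S where "S n = d ` {..<n}" for n :: nat
  have S: "finite (S n)" "S n \<subseteq> V" for n using d DV by (auto simp: S_def)
  define C where "C n = end_component G (S n) \<omega>" for n
  have C: "C n \<in> components_minus G (S n)" for n using end_component_props(1)[OF \<omega> S] by (simp add: C_def)
  have CD: "C n \<subseteq> D" for n unfolding C_def D_def by (rule end_component_anti[OF \<omega> S]) simp
  show ?thesis
  proof (intro exI[of _ C] conjI allI impI)
    fix n
    show "C n \<subseteq> V" using component_subset[OF C] by blast
    show "finite (bdG (C n))" by (rule finite_bd_component[OF C S])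
    show "lives_in {EndPoint \<omega>} (C n)" using end_component_props(2)[OF \<omega> S] by (simp add: lives_in_EndPoint C_def)
  next
    fix v
    show "\<exists>n. v \<notin> C n"
    proof (cases "v \<in> D")
      case True
      then obtain i where "v = d i" using d by auto
      then have "v \<in> S (Suc i)" by (simp add: S_def)
      then show ?thesis using component_subset[OF C] by blast
    next
      case False
      then show ?thesis using CD by blast
    qed
  next
    fix S' assume S': "finite S'" "S' \<subseteq> V"
    obtain K where K: "finite K" "S' \<inter> D = d ` K"
      using finite_subset_image[of "S' \<inter> D" d UNIV] S' d by auto
    obtain n where "K \<subseteq> {..<n}" using K finite_nat_iff_bounded by blast
    then have n: "S' \<inter> D \<subseteq> S n" using K by (auto simp: S_def)
    \<comment> \<open>Vertices of \<open>S'\<close> outside \<open>D\<close> are harmless: a walk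
      from \<open>v\<close> in \<open>G - S n\<close> stays in \<open>D\<close>, where it already
      avoids \<open>S'\<close>.\<close>
    obtain R where R: "R \<in> \<omega>" using ends_nonempty[OF \<omega>] by blast
    have "has_tail_in R (C n \<inter> end_component G S' \<omega>)" unfolding C_def
      by (rule has_tail_in_Int[OF end_component_props(2)[OF \<omega> S R] end_component_props(2)[OF \<omega> S' R]])
    then obtain v where v: "v \<in> C n" "v \<in> end_component G S' \<omega>" using has_tail_in_nonempty by blast
    have "reach S' v w \<and> w \<in> D" if "reach (S n) v w" for w
      using that
    proof (induction rule: rtranclp_induct)
      case base
      then show ?case using v CD by auto
    next
      case (step y z)
      then obtain e where e: "e \<in> edges G" "ends G e = {y, z}" by (auto simp: adjacent_avoiding_def)
      then have "z \<in> D" using component_closed[OF D, of y e z] step by simp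
      then have "adjacent_avoiding G S' y z" using step n by (auto simp: adjacent_avoiding_def)
      then show ?case using step \<open>z \<in> D\<close> by (meson rtranclp.rtrancl_into_rtrancl)
    qed
    then show "\<exists>n. C n \<subseteq> end_component G S' \<omega>"
      using component_eq[OF C v(1)] component_eq[OF end_component_props(1)[OF \<omega> S'] v(2)] by blast
  qed
qed

text \<open>Each new set is a minimum cut among those within the previous set and the next basic
  neighbourhood. It is then minimum among its own subsets as well, which is all that linking it to
  its successor needs; the cut sizes may grow along the sequence.\<close>

lemma end_cut_sequence:
  assumes \<omega>: "\<omega> \<in> graph_ends G" and A0: "A0 \<subseteq> V" "finite (bdG A0)" "lives_in {EndPoint \<omega>} A0"
    and min0: "\<And>Y. \<lbrakk>lives_in {EndPoint \<omega>} Y; Y \<subseteq> A0; finite (bdG Y)\<rbrakk> \<Longrightarrow> card (bdG A0) \<le> card (bdG Y)"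
  shows "\<exists>A :: nat \<Rightarrow> 'v set. A 0 = A0 \<and> (\<forall>n. A (Suc n) \<subseteq> A n \<and> finite (bdG (A n)) \<and> lives_in {EndPoint \<omega>} (A n)
      \<and> (\<forall>Y. lives_in {EndPoint \<omega>} Y \<longrightarrow> Y \<subseteq> A n \<longrightarrow> finite (bdG Y) \<longrightarrow> card (bdG (A n)) \<le> card (bdG Y)))
    \<and> (\<forall>v. \<exists>n. v \<notin> A n) \<and> (\<forall>S. finite S \<longrightarrow> S \<subseteq> V \<longrightarrow> (\<exists>n. A n \<subseteq> end_component G S \<omega>))"
proof -
  obtain C :: "nat \<Rightarrow> 'v set" where C: "\<And>n. C n \<subseteq> V \<and> finite (bdG (C n)) \<and> lives_in {EndPoint \<omega>} (C n)"
    "\<And>v. \<exists>n. v \<notin> C n" "\<And>S. finite S \<Longrightarrow> S \<subseteq> V \<Longrightarrow> \<exists>n. C n \<subseteq> end_component G S \<omega>"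
    using end_basis[OF \<omega>] by metis
  define ok where "ok B \<longleftrightarrow> finite (bdG B) \<and> lives_in {EndPoint \<omega>} B
      \<and> (\<forall>Y. lives_in {EndPoint \<omega>} Y \<longrightarrow> Y \<subseteq> B \<longrightarrow> finite (bdG Y) \<longrightarrow> card (bdG B) \<le> card (bdG Y))" for B
  have "\<exists>A. \<forall>n. (ok (A n) \<and> (n = 0 \<longrightarrow> A n = A0)) \<and> A (Suc n) \<subseteq> A n \<inter> C n"
  proof (rule dependent_nat_choice)
    show "\<exists>B. ok B \<and> (0 = 0 \<longrightarrow> B = A0)" using assms by (auto simp: ok_def)
    fix B and n :: nat assume B: "ok B \<and> (n = 0 \<longrightarrow> B = A0)"
    define Q where "Q Y \<longleftrightarrow> lives_in {EndPoint \<omega>} Y \<and> Y \<subseteq> B \<inter> C n \<and> finite (bdG Y)" for Y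
    have "Q (B \<inter> C n)"
      unfolding Q_def
    proof (intro conjI)
      show "lives_in {EndPoint \<omega>} (B \<inter> C n)" using B C(1)[of n] by (auto simp: ok_def intro: lives_in_Int)
      show "finite (bdG (B \<inter> C n))"
        by (rule finite_subset[OF bd_Int_subset]) (use B C(1)[of n] in \<open>auto simp: ok_def\<close>)
    qed simp
    then obtain Y where Y: "Q Y" "\<And>Z. Q Z \<Longrightarrow> card (bdG Y) \<le> card (bdG Z)"
      using ex_has_least_nat[of Q "B \<inter> C n" "\<lambda>Y. card (bdG Y)"] by blast
    have "ok Y"
      unfolding ok_def
    proof (intro conjI allI impI)
      fix Z assume "lives_in {EndPoint \<omega>} Z" "Z \<subseteq> Y" "finite (bdG Z)"
      then show "card (bdG Y) \<le> card (bdG Z)" using Y(1) by (intro Y(2)) (auto simp: Q_def)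
    qed (use Y(1) in \<open>auto simp: Q_def\<close>)
    then show "\<exists>Y. (ok Y \<and> (Suc n = 0 \<longrightarrow> Y = A0)) \<and> Y \<subseteq> B \<inter> C n"
      using Y(1) by (auto simp: Q_def)
  qed
  then obtain A where A: "\<And>n. ok (A n)" "A 0 = A0" "\<And>n. A (Suc n) \<subseteq> A n \<inter> C n" by blast
  have AC: "A (Suc n) \<subseteq> C n" for n using A(3) by blast
  show ?thesis
  proof (intro exI[of _ A] conjI allI impI)
    show "A 0 = A0" by (rule A)
    show "A (Suc n) \<subseteq> A n" for n using A(3) by blast
    show "finite (bdG (A n))" "lives_in {EndPoint \<omega>} (A n)" for n using A(1) by (auto simp: ok_def)
    show "card (bdG (A n)) \<le> card (bdG Y)" if "lives_in {EndPoint \<omega>} Y" "Y \<subseteq> A n" "finite (bdG Y)" for n Y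
      using A(1)[of n] that by (auto simp: ok_def)
    show "\<exists>n. v \<notin> A n" for v using C(2)[of v] AC by blast
    show "\<exists>n. A n \<subseteq> end_component G S \<omega>" if "finite S" "S \<subseteq> V" for S
      using C(3)[OF that] AC by blast
  qed
qed

lemma bd_one_end:
  assumes "e \<in> bdG A" "x \<in> ends G e \<inter> A" "y \<in> ends G e \<inter> A"
  shows "x = y"
proof -
  obtain u v where "ends G e = {u, v}" "u \<in> A" "v \<notin> A" using bd_cases[OF graphlike_G assms(1)] by metis
  then show ?thesis using assms by auto
qed

text \<open>The boundary edges of \<open>A n\<close> are linked inside \<open>A n\<close> to
  \<open>A (Suc n)\<close>, and these linkages are concatenated. Cuts may grow with
  \<open>n\<close>, so the boundary edges of one level are matched injectively, not bijectively,
  into those of the next.\<close>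

lemma end_tails:
  assumes \<omega>: "\<omega> \<in> graph_ends G" and A0: "A0 \<subseteq> V" "finite (bdG A0)" "lives_in {EndPoint \<omega>} A0"
    and min0: "\<And>Y. \<lbrakk>lives_in {EndPoint \<omega>} Y; Y \<subseteq> A0; finite (bdG Y)\<rbrakk> \<Longrightarrow> card (bdG A0) \<le> card (bdG Y)"
  shows "\<exists>p f. (\<forall>e\<in>bdG A0. p e 0 \<in> ends G e \<and> (p e, f e) \<in> \<omega> \<and> range (p e) \<subseteq> A0)
    \<and> (\<forall>e\<in>bdG A0. \<forall>e'\<in>bdG A0. e \<noteq> e' \<longrightarrow> range (f e) \<inter> range (f e') = {})"
proof -
  define P where "P A \<longleftrightarrow> A 0 = A0 \<and> (\<forall>n. A (Suc n) \<subseteq> A n \<and> finite (bdG (A n)) \<and> lives_in {EndPoint \<omega>} (A n)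
      \<and> (\<forall>Y. lives_in {EndPoint \<omega>} Y \<longrightarrow> Y \<subseteq> A n \<longrightarrow> finite (bdG Y) \<longrightarrow> card (bdG (A n)) \<le> card (bdG Y)))
    \<and> (\<forall>v. \<exists>n. v \<notin> A n) \<and> (\<forall>S. finite S \<longrightarrow> S \<subseteq> V \<longrightarrow> (\<exists>n. A n \<subseteq> end_component G S \<omega>))"
    for A :: "nat \<Rightarrow> 'v set"
  have "\<exists>A. P A" unfolding P_def by (rule end_cut_sequence[OF \<omega> A0]) (rule min0)
  then obtain A where PA: "P A" ..
  have A: "A 0 = A0" "\<And>n. A (Suc n) \<subseteq> A n"
    "\<And>n. finite (bdG (A n))" "\<And>n. lives_in {EndPoint \<omega>} (A n)"
    "\<And>n Y. \<lbrakk>lives_in {EndPoint \<omega>} Y; Y \<subseteq> A n; finite (bdG Y)\<rbrakk> \<Longrightarrow> card (bdG (A n)) \<le> card (bdG Y)"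
    "\<And>v. \<exists>n. v \<notin> A n" "\<And>S. \<lbrakk>finite S; S \<subseteq> V\<rbrakk> \<Longrightarrow> \<exists>n. A n \<subseteq> end_component G S \<omega>"
    using PA unfolding P_def by blast+
  have anti: "A n \<subseteq> A m" if "m \<le> n" for m n using lift_Suc_antimono_le[of A, OF A(2) that] .
  define L where "L n v ps \<longleftrightarrow> (\<forall>e\<in>bdG (A n). v e \<in> ends G e \<inter> A n \<and> walkG (v e) (ps e) \<and> simple (v e) (ps e)
      \<and> pverts (v e) (ps e) \<subseteq> A n \<and> pverts (v e) (ps e) \<inter> A (Suc n) = {wend (v e) (ps e)})
    \<and> (\<forall>e\<in>bdG (A n). \<forall>e'\<in>bdG (A n). e \<noteq> e' \<longrightarrow> insert e (pedges (ps e)) \<inter> insert e' (pedges (ps e')) = {})"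
    for n v ps
  have "\<exists>v ps. L n v ps" for n
    unfolding L_def
  proof (rule cut_linkage[OF graphlike_G A(3) A(2)])
    fix Y assume "A (Suc n) \<subseteq> Y" "Y \<subseteq> A n" "finite (bdG Y)"
    then show "card (bdG (A n)) \<le> card (bdG Y)" using A(4,5) lives_in_mono by metis
  qed
  then obtain v ps where vp: "\<And>n. L n (v n) (ps n)" by metis
  have v: "v n e \<in> ends G e \<inter> A n" and w: "walkG (v n e) (ps n e)" and s: "simple (v n e) (ps n e)"
    and inA: "pverts (v n e) (ps n e) \<subseteq> A n"
    and last: "pverts (v n e) (ps n e) \<inter> A (Suc n) = {wend (v n e) (ps n e)}" if "e \<in> bdG (A n)" for n e
    using vp[of n] that unfolding L_def by blast+
  have dis: "insert e (pedges (ps n e)) \<inter> insert e' (pedges (ps n e')) = {}"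
    if "e \<in> bdG (A n)" "e' \<in> bdG (A n)" "e \<noteq> e'" for n e e'
    using vp[of n] that unfolding L_def by blast
  \<comment> \<open>A linkage path can be empty; then \<open>e\<close> itself already leads into
    \<open>A (Suc n)\<close>.\<close>
  have next_edge: "\<exists>h. h \<in> insert e (pedges (ps n e)) \<and> h \<in> bdG (A (Suc n)) \<and> wend (v n e) (ps n e) \<in> ends G h"
    if e: "e \<in> bdG (A n)" for n e
  proof (cases "ps n e = []")
    case True
    then have "v n e \<in> A (Suc n)" using last[OF e] by auto
    moreover have "\<not> ends G e \<subseteq> A (Suc n)" using e A(2)[of n] by (auto simp: bd_def)
    ultimately have "e \<in> bdG (A (Suc n))" using v[OF e] e by (auto simp: bd_def)
    then show ?thesis using True v[OF e] by auto
  next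
    case False
    then show ?thesis using walk_last[OF w[OF e] last[OF e] s[OF e]] by blast
  qed
  define \<sigma> where "\<sigma> n e = (SOME h. h \<in> insert e (pedges (ps n e)) \<and> h \<in> bdG (A (Suc n))
      \<and> wend (v n e) (ps n e) \<in> ends G h)" for n e
  have \<sigma>: "\<sigma> n e \<in> insert e (pedges (ps n e)) \<and> \<sigma> n e \<in> bdG (A (Suc n))
      \<and> wend (v n e) (ps n e) \<in> ends G (\<sigma> n e)" if "e \<in> bdG (A n)" for n e
    unfolding \<sigma>_def by (rule someI_ex[OF next_edge[OF that]])
  \<comment> \<open>The edge of the boundary of \<open>A n\<close> through which the ray belonging
    to \<open>e\<close> arrives.\<close>
  define \<epsilon> where "\<epsilon> e n = rec_nat e \<sigma> n" for e n
  have \<epsilon>0: "\<epsilon> e 0 = e" and \<epsilon>S: "\<epsilon> e (Suc n) = \<sigma> n (\<epsilon> e n)" for e n by (simp_all add: \<epsilon>_def)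
  have \<epsilon>: "\<epsilon> e n \<in> bdG (A n)" if e: "e \<in> bdG A0" for e n
    by (induction n) (use e A(1) \<sigma> in \<open>auto simp: \<epsilon>0 \<epsilon>S\<close>)
  have \<epsilon>_inj: "\<epsilon> e n \<noteq> \<epsilon> e' n" if e: "e \<in> bdG A0" "e' \<in> bdG A0" "e \<noteq> e'" for e e' n
  proof (induction n)
    case (Suc n)
    then show ?case
      using \<sigma>[OF \<epsilon>[OF e(1)], of n] \<sigma>[OF \<epsilon>[OF e(2)], of n] dis[OF \<epsilon>[OF e(1)] \<epsilon>[OF e(2)], of n]
      unfolding \<epsilon>S by (metis disjoint_iff)
  qed (use e in \<open>simp add: \<epsilon>0\<close>)
  \<comment> \<open>A boundary edge has only one endvertex inside, so the linkage of the next level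
    starts where that of this level ends.\<close>
  have wend_v: "wend (v n (\<epsilon> e n)) (ps n (\<epsilon> e n)) = v (Suc n) (\<epsilon> e (Suc n))" if e: "e \<in> bdG A0" for e n
  proof (rule bd_one_end)
    show "\<epsilon> e (Suc n) \<in> bdG (A (Suc n))" by (rule \<epsilon>[OF e])
    show "v (Suc n) (\<epsilon> e (Suc n)) \<in> ends G (\<epsilon> e (Suc n)) \<inter> A (Suc n)" by (rule v[OF \<epsilon>[OF e]])
    show "wend (v n (\<epsilon> e n)) (ps n (\<epsilon> e n)) \<in> ends G (\<epsilon> e (Suc n)) \<inter> A (Suc n)"
      using \<sigma>[OF \<epsilon>[OF e], of n] last[OF \<epsilon>[OF e], of n] unfolding \<epsilon>S by blast
  qed
  define W where "W e n = concat (map (\<lambda>m. ps m (\<epsilon> e m)) [0..<n])" for e n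
  have WS: "W e (Suc n) = W e n @ ps n (\<epsilon> e n)" for e n by (simp add: W_def)
  have W: "walkG (v 0 e) (W e n) \<and> simple (v 0 e) (W e n) \<and> wend (v 0 e) (W e n) = v n (\<epsilon> e n)
      \<and> pverts (v 0 e) (W e n) \<subseteq> A0 \<and> pverts (v 0 e) (W e n) \<inter> A n = {v n (\<epsilon> e n)}" if e: "e \<in> bdG A0" for e n
  proof (induction n)
    case 0
    have "v 0 e \<in> A 0" using v[of e 0] e A(1) by simp
    then show ?case using A(1) by (auto simp: W_def \<epsilon>0)
  next
    case (Suc n)
    let ?q = "ps n (\<epsilon> e n)" and ?x = "v n (\<epsilon> e n)"
    have q: "walkG ?x ?q" "simple ?x ?q" "pverts ?x ?q \<subseteq> A n" "pverts ?x ?q \<inter> A (Suc n) = {wend ?x ?q}"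
      using w s inA last \<epsilon>[OF e] by blast+
    have "snd ` set ?q \<inter> pverts (v 0 e) (W e n) = {}"
    proof -
      have "?x \<notin> snd ` set ?q" using q(2) by (simp add: simple_def)
      then have "snd ` set ?q \<subseteq> A n - {?x}" using q(3) by blast
      then show ?thesis using Suc by blast
    qed
    then have 1: "simple (v 0 e) (W e (Suc n))" unfolding WS simple_append using Suc q by simp
    have eq: "pverts (v 0 e) (W e (Suc n)) = pverts (v 0 e) (W e n) \<union> pverts ?x ?q"
      using wend_in_pverts[of "v 0 e" "W e n"] Suc unfolding WS by auto
    have "pverts (v 0 e) (W e n) \<inter> A (Suc n) \<subseteq> {?x}" using Suc A(2)[of n] by blast
    then have "pverts (v 0 e) (W e (Suc n)) \<inter> A (Suc n) = {wend ?x ?q}" using q(4) unfolding eq by blast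
    moreover have "pverts (v 0 e) (W e (Suc n)) \<subseteq> A0" unfolding eq using Suc q(3) anti[of 0 n] A(1) by blast
    ultimately show ?case using Suc q(1) 1 wend_v[OF e, of n] by (simp add: WS)
  qed
  have ext: "\<exists>xs. W e n = W e m @ xs \<and> snd ` set xs \<subseteq> A m" if e: "e \<in> bdG A0" and mn: "m \<le> n" for e m n
    using mn
  proof (induction n rule: dec_induct)
    case (step n)
    then obtain xs where xs: "W e n = W e m @ xs" "snd ` set xs \<subseteq> A m" by blast
    have "snd ` set (ps n (\<epsilon> e n)) \<subseteq> A m" using inA[OF \<epsilon>[OF e], of n] anti[of m n] step by blast
    with xs show ?case by (intro exI[of _ "xs @ ps n (\<epsilon> e n)"]) (auto simp: WS)
  qed simp
  \<comment> \<open>Although single linkages may be empty, the current endvertex lies outside some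
    \<open>A m\<close>, while the walk up to level \<open>m\<close> ends inside \<open>A m\<close>;
    so it has grown by then.\<close>
  have unb: "\<exists>n. i < length (W e n)" if e: "e \<in> bdG A0" for e i
  proof (induction i)
    case 0
    obtain n where n: "v 0 e \<notin> A n" using A(6) by blast
    then have "W e n \<noteq> []" using W[OF e, of n] v[OF \<epsilon>[OF e], of n] by (metis IntD2 wend.simps(1))
    then show ?case by blast
  next
    case (Suc i)
    then obtain n where n: "i < length (W e n)" by blast
    obtain m where m: "v n (\<epsilon> e n) \<notin> A m" using A(6) by blast
    then have "m > n" using v[OF \<epsilon>[OF e], of n] anti[of m n] by (metis IntD2 not_le subsetD)
    then obtain xs where xs: "W e m = W e n @ xs" using ext[OF e, of n m] by auto
    have "xs \<noteq> []"
    proof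
      assume "xs = []"
      then have "v m (\<epsilon> e m) = v n (\<epsilon> e n)" using W[OF e, of n] W[OF e, of m] xs by simp
      then show False using v[OF \<epsilon>[OF e], of m] m by simp
    qed
    then have "Suc i < length (W e m)" using n xs by (cases xs) auto
    then show ?case by blast
  qed
  have "\<exists>p f. (p, f) \<in> rays G \<and> p 0 = v 0 e \<and> (\<forall>n. \<forall>i<length (W e n). W e n ! i = (f i, p (Suc i)))"
    if e: "e \<in> bdG A0" for e
    by (rule walk_limit_ray) (use W[OF e] ext[OF e] unb[OF e] in blast)+
  then obtain p f where pf: "\<And>e. e \<in> bdG A0 \<Longrightarrow> (p e, f e) \<in> rays G \<and> p e 0 = v 0 e
      \<and> (\<forall>n. \<forall>i<length (W e n). W e n ! i = (f e i, p e (Suc i)))" by metis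
  have nth: "W e n ! i = (f e i, p e (Suc i))" if "e \<in> bdG A0" "i < length (W e n)" for e n i
    using pf[OF that(1)] that(2) by blast
  have tail: "has_tail_in (p e, f e) (A m)" if e: "e \<in> bdG A0" for e m
  proof -
    have "p e (Suc i) \<in> A m" if i: "length (W e m) \<le> i" for i
    proof -
      obtain n where n: "i < length (W e n)" using unb[OF e] by blast
      have "m \<le> n"
      proof (rule ccontr)
        assume "\<not> m \<le> n"
        then obtain xs where "W e m = W e n @ xs" using ext[OF e, of n m] by auto
        then show False using n i by simp
      qed
      then obtain xs where xs: "W e n = W e m @ xs" "snd ` set xs \<subseteq> A m" using ext[OF e] by blast
      have "(f e i, p e (Suc i)) = xs ! (i - length (W e m))"
        using nth[OF e n] xs i by (simp add: nth_append)
      moreover have "i - length (W e m) < length xs" using n xs i by simp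
      ultimately have "(f e i, p e (Suc i)) \<in> set xs" by (metis nth_mem)
      then show ?thesis using xs(2) by force
    qed
    then have "p e i \<in> A m" if "Suc (length (W e m)) \<le> i" for i using that by (cases i) auto
    then show ?thesis unfolding has_tail_in_def by auto
  qed
  have in\<omega>: "(p e, f e) \<in> \<omega>" if e: "e \<in> bdG A0" for e
  proof -
    obtain R where R: "R \<in> \<omega>" using ends_nonempty[OF \<omega>] by blast
    have "(R, (p e, f e)) \<in> ray_equiv G"
      unfolding ray_equiv_def
    proof (clarsimp, intro conjI allI impI)
      show "R \<in> rays G" "(p e, f e) \<in> rays G" using ends_rays[OF \<omega> R] pf[OF e] by auto
      fix S assume S: "finite S \<and> S \<subseteq> V"
      then obtain n where "A n \<subseteq> end_component G S \<omega>" using A(7) by blast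
      then have "has_tail_in (p e, f e) (end_component G S \<omega>)" using tail[OF e, of n] has_tail_in_mono by blast
      then show "\<exists>C\<in>components_minus G S. has_tail_in R C \<and> has_tail_in (p e, f e) C"
        using end_component_props(1)[OF \<omega>, of S] end_component_props(2)[OF \<omega> _ _ R, of S] S by blast
    qed
    then show ?thesis using ends_closed[OF \<omega> R] by blast
  qed
  have rng: "range (p e) \<subseteq> A0" if e: "e \<in> bdG A0" for e
  proof clarify
    fix i
    show "p e i \<in> A0"
    proof (cases i)
      case 0
      then show ?thesis using pf[OF e] v[of e 0] e A(1) by simp
    next
      case (Suc j)
      obtain n where n: "j < length (W e n)" using unb[OF e] by blast
      have "(f e j, p e (Suc j)) \<in> set (W e n)" using nth[OF e n] nth_mem[OF n] by simp
      then have "p e (Suc j) \<in> pverts (v 0 e) (W e n)" by force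
      then show ?thesis using W[OF e, of n] Suc by blast
    qed
  qed
  have f_in: "\<exists>m. f e i \<in> pedges (ps m (\<epsilon> e m))" if e: "e \<in> bdG A0" for e i
  proof -
    obtain n where n: "i < length (W e n)" using unb[OF e] by blast
    have "(f e i, p e (Suc i)) \<in> set (W e n)" using nth[OF e n] nth_mem[OF n] by simp
    then obtain m where "(f e i, p e (Suc i)) \<in> set (ps m (\<epsilon> e m))" by (auto simp: W_def)
    then show ?thesis by force
  qed
  \<comment> \<open>An edge of level \<open>m\<close> does not lie inside \<open>A (Suc m)\<close>,
    whereas all edges of later levels do. Hence rays can only share edges within one level, where
    the linkage is disjoint.\<close>
  have lev: "h \<notin> pedges (ps m' (\<epsilon> e' m'))"
    if e: "e \<in> bdG A0" "e' \<in> bdG A0" and m: "m < m'" and h: "h \<in> pedges (ps m (\<epsilon> e m))" for e e' m m' h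
  proof
    assume "h \<in> pedges (ps m' (\<epsilon> e' m'))"
    then have "ends G h \<subseteq> A m'"
      using walk_edge_verts[OF w[OF \<epsilon>[OF e(2)]]] inA[OF \<epsilon>[OF e(2)]] by blast
    also have "\<dots> \<subseteq> A (Suc m)" using anti[of "Suc m" m'] m by simp
    finally show False using walk_edges_meet[OF w[OF \<epsilon>[OF e(1)]] last[OF \<epsilon>[OF e(1)]] s[OF \<epsilon>[OF e(1)]] h] by blast
  qed
  have "range (f e) \<inter> range (f e') = {}" if e: "e \<in> bdG A0" "e' \<in> bdG A0" "e \<noteq> e'" for e e'
  proof (rule ccontr)
    assume "range (f e) \<inter> range (f e') \<noteq> {}"
    then obtain i j where ij: "f e i = f e' j" by blast
    obtain m m' where m: "f e i \<in> pedges (ps m (\<epsilon> e m))" "f e i \<in> pedges (ps m' (\<epsilon> e' m'))"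
      using f_in[OF e(1), of i] f_in[OF e(2), of j] ij by metis
    then have "m = m'" using lev[OF e(1,2)] lev[OF e(2,1)] by (metis linorder_neqE_nat)
    then show False using m dis[OF \<epsilon>[OF e(1)] \<epsilon>[OF e(2)] \<epsilon>_inj[OF e]] by blast
  qed
  then show ?thesis using in\<omega> rng pf v[of _ 0] A(1)
    by (intro exI[of _ p] exI[of _ f]) auto
qed

end


section \<open>Arcs in the end compactification\<close>

text \<open>A continuous injection of a compact space into a Hausdorff space is an embedding, so
  inverse maps never have to be examined.\<close>

lemma arc_of_map:
  fixes h :: "real \<Rightarrow> 'a"
  assumes "continuous_map (top_of_set {0..1}) X h" "Hausdorff_space X" "inj_on h {0..1}"
  shows "arc_with_endpoints X (h 0) (h 1) (h ` {0..1})"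
proof -
  have "compact_space (top_of_set {0..1::real})"
    by (simp add: compact_space_subtopology)
  then have "embedding_map (top_of_set {0..1}) X h"
    using continuous_imp_embedding_map[OF assms(1) _ assms(2)] assms(3) by simp
  then have "homeomorphic_map (top_of_set {0..1}) (subtopology X (h ` {0..1})) h"
    by (simp add: embedding_map_def)
  moreover have "h ` {0..1} \<subseteq> topspace X"
    using assms(1) by (auto simp: continuous_map_def)
  ultimately show ?thesis unfolding arc_with_endpoints_def by blast
qed

lemma map_of_arc:
  assumes "arc_with_endpoints X x y A"
  obtains h :: "real \<Rightarrow> 'a" where "continuous_map (top_of_set {0..1}) X h" "inj_on h {0..1}" "h ` {0..1} = A" "h 0 = x" "h 1 = y"
proof -
  obtain h :: "real \<Rightarrow> 'a" where h: "A \<subseteq> topspace X" "homeomorphic_map (top_of_set {0..1::real}) (subtopology X A) h" "h 0 = x" "h 1 = y"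
    using assms by (auto simp: arc_with_endpoints_def)
  have "continuous_map (top_of_set {0..1}) X h"
    using homeomorphic_imp_continuous_map[OF h(2)] continuous_map_into_fulltopology by blast
  moreover have "inj_on h {0..1}" using homeomorphic_imp_injective_map[OF h(2)] by simp
  moreover have "h ` {0..1} = A" using homeomorphic_imp_surjective_map[OF h(2)] h(1) by auto
  ultimately show thesis using that h by blast
qed

lemma continuous_map_affine:
  fixes a b :: real
  assumes "continuous_map (top_of_set {0..1}) X h" "\<And>s. s \<in> S \<Longrightarrow> a * s + b \<in> {0..1}"
  shows "continuous_map (top_of_set S) X (\<lambda>s. h (a * s + b))"
proof -
  have "continuous_map (top_of_set S) (top_of_set {0..1}) (\<lambda>s. a * s + b)"
    unfolding continuous_map_subtopology_eu using assms(2) by (auto intro!: continuous_intros)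
  from continuous_map_compose[OF this assms(1)] show ?thesis by (simp add: o_def)
qed

lemma arc_reverse:
  fixes X :: "'a topology"
  assumes "arc_with_endpoints X x y A" "Hausdorff_space X"
  shows "arc_with_endpoints X y x A"
proof -
  obtain h :: "real \<Rightarrow> 'a" where h: "continuous_map (top_of_set {0..1}) X h" "inj_on h {0..1}" "h ` {0..1} = A" "h 0 = x" "h 1 = y"
    using map_of_arc[OF assms(1)] by blast
  let ?k = "\<lambda>s. h (- 1 * s + 1)"
  have "continuous_map (top_of_set {0..1}) X ?k" by (rule continuous_map_affine[OF h(1)]) auto
  moreover have "inj_on ?k {0..1}"
  proof (rule inj_onI)
    fix s t :: real assume "s \<in> {0..1}" "t \<in> {0..1}" "?k s = ?k t"
    then show "s = t" using inj_onD[OF h(2), of "- 1 * s + 1" "- 1 * t + 1"] by simp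
  qed
  moreover have "?k ` {0..1} = A"
  proof -
    have "(\<lambda>s. - 1 * s + 1) ` {0..1::real} = {0..1}"
    proof
      show "{0..1} \<subseteq> (\<lambda>s. - 1 * s + 1) ` {0..1::real}"
      proof
        fix s :: real assume "s \<in> {0..1}"
        then show "s \<in> (\<lambda>s. - 1 * s + 1) ` {0..1}" by (intro image_eqI[of _ _ "1 - s"]) auto
      qed
    qed auto
    then have "h ` ((\<lambda>s. - 1 * s + 1) ` {0..1}) = A" using h(3) by simp
    then show ?thesis unfolding image_image .
  qed
  ultimately show ?thesis using arc_of_map[OF _ assms(2), of ?k] h by simp
qed

lemma arc_join:
  fixes X :: "'a topology"
  assumes "arc_with_endpoints X x y A" "arc_with_endpoints X y z B" "A \<inter> B = {y}" "Hausdorff_space X"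
  shows "arc_with_endpoints X x z (A \<union> B)"
proof -
  obtain h :: "real \<Rightarrow> 'a" where h: "continuous_map (top_of_set {0..1}) X h" "inj_on h {0..1}" "h ` {0..1} = A" "h 0 = x" "h 1 = y"
    using map_of_arc[OF assms(1)] by blast
  obtain k :: "real \<Rightarrow> 'a" where k: "continuous_map (top_of_set {0..1}) X k" "inj_on k {0..1}" "k ` {0..1} = B" "k 0 = y" "k 1 = z"
    using map_of_arc[OF assms(2)] by blast
  define j where "j s = (if s \<le> 1/2 then h (2 * s + 0) else k (2 * s + - 1))" for s :: real
  have cont: "continuous_map (top_of_set {0..1}) X j"
    unfolding j_def
  proof (rule continuous_map_cases_le)
    show "continuous_map (subtopology (top_of_set {0..1}) {s \<in> topspace (top_of_set {0..1}). s \<le> 1 / 2}) X (\<lambda>s. h (2 * s + 0))"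
      unfolding subtopology_subtopology by (rule continuous_map_affine[OF h(1)]) auto
    show "continuous_map (subtopology (top_of_set {0..1}) {s \<in> topspace (top_of_set {0..1}). 1 / 2 \<le> s}) X (\<lambda>s. k (2 * s + - 1))"
      unfolding subtopology_subtopology by (rule continuous_map_affine[OF k(1)]) auto
    show "h (2 * s + 0) = k (2 * s + - 1)" if "s = 1 / 2" for s
      unfolding that using h k by simp
  qed (auto intro!: continuous_intros)
  have jA: "j s \<in> A" if "s \<in> {0..1/2}" for s
  proof -
    have "2 * s + 0 \<in> {0..1}" using that by auto
    then show ?thesis using h(3) that by (auto simp: j_def)
  qed
  \<comment> \<open>The second half omits the common point \<open>y\<close>, which is already taken
    at \<open>1/2\<close>; this is what makes \<open>j\<close> injective.\<close>
  have jB: "j s \<in> B" "j s \<noteq> y" if "s \<in> {1/2<..1}" for s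
  proof -
    have "2 * s + - 1 \<in> {0..1}" using that by auto
    then show "j s \<in> B" using k(3) that by (auto simp: j_def)
    have "k (2 * s + - 1) \<noteq> k 0" using inj_onD[OF k(2), of "2 * s + - 1" 0] that by auto
    then show "j s \<noteq> y" using that k(4) by (simp add: j_def)
  qed
  have inj: "inj_on j {0..1}"
  proof (rule linorder_inj_onI')
    fix s t :: real assume st: "s \<in> {0..1}" "t \<in> {0..1}" "s < t"
    consider "t \<le> 1/2" | "1/2 < s" | "s \<le> 1/2" "1/2 < t" by linarith
    then show "j s \<noteq> j t"
    proof cases
      case 1
      then show ?thesis using inj_onD[OF h(2), of "2 * s + 0" "2 * t + 0"] st by (auto simp: j_def)
    next
      case 2
      then show ?thesis using inj_onD[OF k(2), of "2 * s + - 1" "2 * t + - 1"] st by (auto simp: j_def)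
    next
      case 3
      then have s: "j s \<in> A" and t: "j t \<in> B" "j t \<noteq> y" using jA[of s] jB[of t] st by auto
      show ?thesis
      proof
        assume "j s = j t"
        then have "j t \<in> A \<inter> B" using s t by simp
        then show False unfolding assms(3) using t by simp
      qed
    qed
  qed
  have "j ` {0..1} = A \<union> B"
  proof
    show "j ` {0..1} \<subseteq> A \<union> B"
    proof
      fix x assume "x \<in> j ` {0..1}"
      then obtain s where "s \<in> {0..1}" "x = j s" by blast
      then show "x \<in> A \<union> B" using jA[of s] jB[of s] by (cases "s \<le> 1/2") auto
    qed
    have "A \<subseteq> j ` {0..1}"
    proof
      fix a assume "a \<in> A"
      then obtain s where s: "s \<in> {0..1}" "a = h s" using h(3) by blast
      then have "a = j (s/2)" "s/2 \<in> {0..1}" by (auto simp: j_def)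
      then show "a \<in> j ` {0..1}" by blast
    qed
    moreover have "B \<subseteq> j ` {0..1}"
    proof
      fix b assume "b \<in> B"
      then obtain s where s: "s \<in> {0..1}" "b = k s" using k(3) by blast
      show "b \<in> j ` {0..1}"
      proof (cases "s = 0")
        case True
        then have "b = h 1" using s k(4) h(5) by simp
        then have "b \<in> A" unfolding h(3)[symmetric] by (intro image_eqI[of _ _ 1]) auto
        then show ?thesis using \<open>A \<subseteq> j ` {0..1}\<close> by blast
      next
        case False
        then have "b = j ((s + 1)/2)" "(s + 1)/2 \<in> {0..1}" using s by (auto simp: j_def field_simps)
        then show ?thesis by blast
      qed
    qed
    ultimately show "A \<union> B \<subseteq> j ` {0..1}" by blast
  qed
  then show ?thesis using arc_of_map[OF cont assms(4) inj] h k by (simp add: j_def)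
qed

section \<open>Basic neighbourhoods, the Hausdorff property, and arcs along paths and rays\<close>

context lf_graph
begin

abbreviation "K \<equiv> end_compactification G"

definition subbasis :: "('v, 'e) point set set" where
  "subbasis = {open_star G v \<epsilon> | v \<epsilon>. v \<in> V \<and> 0 < \<epsilon>}
      \<union> {open_segment_of e a b | e a b. e \<in> edges G \<and> 0 \<le> a \<and> a < b \<and> b \<le> 1}
      \<union> {end_nbhd G S \<omega> \<epsilon> | S \<omega> \<epsilon>. finite S \<and> S \<subseteq> V \<and> \<omega> \<in> graph_ends G \<and> 0 < \<epsilon>}"

lemma K_def: "K = topology_generated_by subbasis"
  unfolding end_compactification_def subbasis_def ..

lemma open_star: "v \<in> V \<Longrightarrow> 0 < \<epsilon> \<Longrightarrow> openin K (open_star G v \<epsilon>)"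
  unfolding K_def by (rule topology_generated_by_Basis) (auto simp: subbasis_def)

lemma open_segment: "e \<in> edges G \<Longrightarrow> 0 \<le> a \<Longrightarrow> a < b \<Longrightarrow> b \<le> 1 \<Longrightarrow> openin K (open_segment_of e a b)"
  unfolding K_def by (rule topology_generated_by_Basis) (auto simp: subbasis_def)

lemma open_end_nbhd:
  "finite S \<Longrightarrow> S \<subseteq> V \<Longrightarrow> \<omega> \<in> graph_ends G \<Longrightarrow> 0 < \<epsilon> \<Longrightarrow> openin K (end_nbhd G S \<omega> \<epsilon>)"
  unfolding K_def by (rule topology_generated_by_Basis) (auto simp: subbasis_def)

lemma end_in_nbhd:
  assumes "finite S" "S \<subseteq> V" "\<omega> \<in> graph_ends G"
  shows "EndPoint \<omega> \<in> end_nbhd G S \<omega> \<epsilon>"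
  using end_component_props(4)[OF assms(3,1,2)] assms(3) by (auto simp: end_nbhd_def Let_def)

lemma origin_in: "e \<in> edges G \<Longrightarrow> origin G e \<in> ends G e"
  unfolding origin_def by (rule someI_ex) (use mg in \<open>force simp: is_multigraph_def\<close>)

lemma edge_dist_cases:
  assumes "e \<in> edges G" "ends G e = {u, v}" "u \<noteq> v"
  obtains "origin G e = u" "\<And>s. edge_dist G e s u = s" "\<And>s. edge_dist G e s v = 1 - s"
  | "origin G e = v" "\<And>s. edge_dist G e s u = 1 - s" "\<And>s. edge_dist G e s v = s"
proof -
  have "origin G e = u \<or> origin G e = v" using origin_in[OF assms(1)] assms(2) by simp
  then show thesis using that assms(3) unfolding edge_dist_def by presburger
qed

lemma edge_dist_sum:
  assumes "e \<in> edges G" "u \<in> ends G e" "v \<in> ends G e" "u \<noteq> v"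
  shows "edge_dist G e s u + edge_dist G e s v = 1"
proof -
  obtain a b where "ends G e = {a, b}" using assms(1) graphlike_G unfolding graphlike_def by blast
  then have "ends G e = {u, v}" using assms by auto
  from edge_dist_cases[OF assms(1) this assms(4)] show ?thesis by (metis add.commute diff_add_cancel)
qed

definition valid_points :: "('v, 'e) point set" where
  "valid_points = Vertex ` V \<union> inner_points (edges G) \<union> EndPoint ` graph_ends G"

lemma subbasis_valid: "U \<in> subbasis \<Longrightarrow> U \<subseteq> valid_points"
proof -
  assume "U \<in> subbasis"
  then consider v \<epsilon> where "U = open_star G v \<epsilon>" "v \<in> V"
    | e a b where "U = open_segment_of e a b" "e \<in> edges G" "0 \<le> a" "b \<le> 1"
    | S \<omega> \<epsilon> where "U = end_nbhd G S \<omega> \<epsilon>" "finite S" "S \<subseteq> V" "\<omega> \<in> graph_ends G"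
    unfolding subbasis_def by blast
  then show "U \<subseteq> valid_points"
  proof cases
    case 3
    then have "end_component G S \<omega> \<subseteq> V" using end_component_props(1) component_subset by blast
    then show ?thesis using 3 by (auto simp: valid_points_def end_nbhd_def Let_def inner_points_def)
  qed (auto simp: valid_points_def open_star_def open_segment_of_def inner_points_def)
qed

lemma topspace_K: "topspace K = valid_points"
proof
  show "topspace K \<subseteq> valid_points" unfolding K_def using subbasis_valid by auto
  have "Vertex v \<in> topspace K" if "v \<in> V" for v
    using openin_subset[OF open_star[OF that, of 1]] by (auto simp: open_star_def)
  moreover have "Inner e s \<in> topspace K" if "e \<in> edges G" "0 < s" "s < 1" for e s
    using openin_subset[OF open_segment[OF that(1), of 0 1]] that by (auto simp: open_segment_of_def)
  moreover have "EndPoint \<omega> \<in> topspace K" if "\<omega> \<in> graph_ends G" for \<omega>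
    using openin_subset[OF open_end_nbhd[of "{}" \<omega> 1]] end_in_nbhd[of "{}" \<omega> 1] that by auto
  ultimately show "valid_points \<subseteq> topspace K" by (auto simp: valid_points_def inner_points_def)
qed

text \<open>An edge at a vertex of \<open>C\<close> stays in \<open>C\<close> or ends in
  \<open>S\<close>; the latter belong to the neighbourhood up to distance \<open>\<epsilon>\<close>,
  so a star of that radius fits.\<close>

lemma nbhd_vertex:
  assumes "U \<in> subbasis" "Vertex v \<in> U"
  shows "\<exists>\<epsilon>>0. open_star G v \<epsilon> \<subseteq> U"
proof -
  consider w \<epsilon> where "U = open_star G w \<epsilon>" "0 < \<epsilon>"
    | e a b where "U = open_segment_of e a b"
    | S \<omega> \<epsilon> where "U = end_nbhd G S \<omega> \<epsilon>" "finite S" "S \<subseteq> V" "\<omega> \<in> graph_ends G" "0 < \<epsilon>"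
    using assms(1) unfolding subbasis_def by blast
  then show ?thesis
  proof cases
    case 1
    then show ?thesis using assms(2) by (auto simp: open_star_def)
  next
    case 2
    then show ?thesis using assms(2) by (auto simp: open_segment_of_def)
  next
    case 3
    let ?C = "end_component G S \<omega>"
    have C: "?C \<in> components_minus G S" using end_component_props(1) 3 by blast
    have vC: "v \<in> ?C" using assms(2) 3 by (auto simp: end_nbhd_def Let_def inner_points_def)
    have "Inner e s \<in> U" if e: "e \<in> edges G" "v \<in> ends G e" "0 < s" "s < 1" "edge_dist G e s v < \<epsilon>" for e s
    proof -
      obtain w where w: "ends G e = {w, v}"
        using e graphlike_G unfolding graphlike_def by (metis insert_commute insertE singletonD)
      show ?thesis
      proof (cases "w \<in> S")
        case True
        have "e \<in> edges G \<and> w \<in> S \<and> v \<in> ?C \<and> ends G e = {w, v} \<and> 0 < s \<and> s < 1 \<and> edge_dist G e s v < \<epsilon>"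
          using True e w vC by blast
        then show ?thesis unfolding 3(1) end_nbhd_def Let_def by blast
      next
        case False
        then have "w \<in> ?C" using component_closed[OF C vC e(1), of w] w by (simp add: insert_commute)
        then have "ends G e \<subseteq> ?C" using w vC by simp
        then show ?thesis using e unfolding 3(1) end_nbhd_def Let_def inner_points_def by blast
      qed
    qed
    then have "open_star G v \<epsilon> \<subseteq> U" using assms(2) by (auto simp: open_star_def)
    then show ?thesis using 3 by blast
  qed
qed

lemma segment_in_dist:
  assumes "0 < s" "s < 1" "edge_dist G e s v < \<epsilon>"
  shows "\<exists>a b. 0 \<le> a \<and> a < s \<and> s < b \<and> b \<le> 1 \<and> (\<forall>s'. a < s' \<longrightarrow> s' < b \<longrightarrow> edge_dist G e s' v < \<epsilon>)"
proof (cases "v = origin G e")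
  case True
  then show ?thesis using assms by (intro exI[of _ 0] exI[of _ "min 1 \<epsilon>"]) (auto simp: edge_dist_def)
next
  case False
  then show ?thesis using assms by (intro exI[of _ "max 0 (1 - \<epsilon>)"] exI[of _ 1]) (auto simp: edge_dist_def)
qed

lemma nbhd_inner:
  assumes "U \<in> subbasis" "Inner e s \<in> U"
  shows "\<exists>a b. 0 \<le> a \<and> a < s \<and> s < b \<and> b \<le> 1 \<and> open_segment_of e a b \<subseteq> U"
proof -
  have s: "0 < s" "s < 1" "e \<in> edges G" using subbasis_valid[OF assms(1)] assms(2)
    by (auto simp: valid_points_def inner_points_def)
  consider w \<epsilon> where "U = open_star G w \<epsilon>"
    | e a b where "U = open_segment_of e a b" "0 \<le> a" "b \<le> 1"
    | S \<omega> \<epsilon> where "U = end_nbhd G S \<omega> \<epsilon>"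
    using assms(1) unfolding subbasis_def by blast
  then show ?thesis
  proof cases
    case 1
    then have e: "e \<in> edges G" "w \<in> ends G e" "edge_dist G e s w < \<epsilon>" using assms(2) by (auto simp: open_star_def)
    obtain a b where ab: "0 \<le> a" "a < s" "s < b" "b \<le> 1" "\<And>s'. a < s' \<Longrightarrow> s' < b \<Longrightarrow> edge_dist G e s' w < \<epsilon>"
      using segment_in_dist[OF s(1,2) e(3)] by blast
    have "open_segment_of e a b \<subseteq> U" using ab e unfolding 1 open_segment_of_def open_star_def by fastforce
    then show ?thesis using ab by blast
  next
    case 2
    then show ?thesis using assms(2) by (auto simp: open_segment_of_def)
  next
    case 3
    let ?C = "end_component G S \<omega>"
    consider "ends G e \<subseteq> ?C" | x c where "x \<in> S" "c \<in> ?C" "ends G e = {x, c}" "edge_dist G e s c < \<epsilon>"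
      using assms(2) unfolding 3 by (auto simp: end_nbhd_def Let_def inner_points_def)
    then show ?thesis
    proof cases
      case 1
      then have "open_segment_of e 0 1 \<subseteq> U" using s(3) unfolding 3
        by (auto simp: end_nbhd_def Let_def inner_points_def open_segment_of_def)
      then show ?thesis using s by (intro exI[of _ 0] exI[of _ 1]) simp
    next
      case 2
      obtain a b where ab: "0 \<le> a" "a < s" "s < b" "b \<le> 1" "\<And>s'. a < s' \<Longrightarrow> s' < b \<Longrightarrow> edge_dist G e s' c < \<epsilon>"
        using segment_in_dist[OF s(1,2) 2(4)] by blast
      have "Inner e s' \<in> U" if "a < s'" "s' < b" for s'
      proof -
        have "e \<in> edges G \<and> x \<in> S \<and> c \<in> ?C \<and> ends G e = {x, c} \<and> 0 < s' \<and> s' < 1 \<and> edge_dist G e s' c < \<epsilon>"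
          using that ab(5)[OF that] ab 2 s by auto
        then show ?thesis unfolding 3 end_nbhd_def Let_def by blast
      qed
      then have "open_segment_of e a b \<subseteq> U" unfolding open_segment_of_def by blast
      then show ?thesis using ab by blast
    qed
  qed
qed

text \<open>Membership of \<open>\<omega>\<close> forces a tail of its ray into the component, and
  consecutive vertices there bring the whole edge between them along. This yields continuity at the
  end of a ray.\<close>

lemma nbhd_end:
  assumes "U \<in> subbasis" "EndPoint \<omega> \<in> U" "\<omega> \<in> graph_ends G" "(p, f) \<in> \<omega>"
  shows "\<exists>N. \<forall>n\<ge>N. Vertex (p n) \<in> U \<and> (\<forall>s. 0 < s \<longrightarrow> s < 1 \<longrightarrow> Inner (f n) s \<in> U)"
proof -
  obtain S \<omega>' \<epsilon> where U: "U = end_nbhd G S \<omega>' \<epsilon>" "finite S" "S \<subseteq> V" "\<omega>' \<in> graph_ends G"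
    using assms(1,2) by (auto simp: subbasis_def open_star_def open_segment_of_def)
  let ?C = "end_component G S \<omega>'"
  have C: "?C \<in> components_minus G S" using end_component_props(1) U by blast
  have "\<exists>R\<in>\<omega>. range (fst R) \<subseteq> ?C" using assms(2) U by (auto simp: end_nbhd_def Let_def inner_points_def)
  then have "end_component G S \<omega> = ?C" using ray_in_component_iff[OF assms(3) U(2,3) C] by simp
  then have "has_tail_in (p, f) ?C" using end_component_props(2)[OF assms(3) U(2,3) assms(4)] by simp
  then obtain N where N: "\<And>n. N \<le> n \<Longrightarrow> p n \<in> ?C" unfolding has_tail_in_def by auto
  have "Vertex (p n) \<in> U \<and> (\<forall>s. 0 < s \<longrightarrow> s < 1 \<longrightarrow> Inner (f n) s \<in> U)" if "n \<ge> N" for n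
  proof -
    have "f n \<in> edges G" "ends G (f n) \<subseteq> ?C"
      using raysD(3,4)[OF ends_rays[OF assms(3,4)], of n] N[of n] N[of "Suc n"] that by auto
    then show ?thesis using N[OF that] unfolding U(1) end_nbhd_def Let_def inner_points_def by blast
  qed
  then show ?thesis by blast
qed

lemma star_inner_iff: "Inner e s \<in> open_star G v \<epsilon> \<longleftrightarrow>
   e \<in> edges G \<and> v \<in> ends G e \<and> 0 < s \<and> s < 1 \<and> edge_dist G e s v < \<epsilon>"
  by (auto simp: open_star_def)

lemma nbhd_inner_cases:
  assumes "Inner e s \<in> end_nbhd G S \<omega> \<epsilon>"
  obtains "e \<in> edges G" "ends G e \<subseteq> end_component G S \<omega>"
  | x c where "e \<in> edges G" "x \<in> S" "c \<in> end_component G S \<omega>" "ends G e = {x, c}" "edge_dist G e s c < \<epsilon>"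
  using assms by (auto simp: end_nbhd_def Let_def inner_points_def)

text \<open>The pairs are treated by the types of the two points. For the cases with an end the
  deleted set \<open>S\<close> is chosen so that the other point is kept away from its
  component.\<close>

lemma Hausdorff_K: "Hausdorff_space K"
proof -
  define sepd where "sepd x y \<longleftrightarrow> (\<exists>U W. openin K U \<and> openin K W \<and> x \<in> U \<and> y \<in> W \<and> disjnt U W)" for x y
  have sepI: "sepd x y" if "openin K U" "openin K W" "x \<in> U" "y \<in> W" "\<And>z. z \<in> U \<Longrightarrow> z \<in> W \<Longrightarrow> False" for x y U W
    unfolding sepd_def disjnt_def using that by blast
  have sym: "sepd y x" if "sepd x y" for x y
    using that unfolding sepd_def by (meson disjnt_sym)
  have vv: "sepd (Vertex v) (Vertex w)" if v: "v \<in> V" and w: "w \<in> V" and ne: "v \<noteq> w" for v w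
  \<comment> \<open>The distances of an inner point to the two ends of its edge add up to 1, so
    radius \<open>1/2\<close> separates the stars.\<close>
  proof (rule sepI[OF open_star[OF v, of "1/2"] open_star[OF w, of "1/2"]])
    fix z assume z: "z \<in> open_star G v (1/2)" "z \<in> open_star G w (1/2)"
    then obtain e s where "z = Inner e s" using ne by (auto simp: open_star_def)
    then show False using z edge_dist_sum[of e v w s] ne by (auto simp: star_inner_iff)
  qed (auto simp: open_star_def)
  have vi: "sepd (Vertex v) (Inner e s)" if v: "v \<in> V" and e: "e \<in> edges G" "0 < s" "s < 1" for v e s
  \<comment> \<open>The minimum serves both orientations of the edge: \<open>v\<close> may be its
    endvertex at 0 or at 1.\<close>
  proof (rule sepI[OF open_star[OF v, of "min (s/2) ((1 - s)/2)"] open_segment[OF e(1), of "s/2" "(1 + s)/2"]])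
    fix z assume z: "z \<in> open_star G v (min (s/2) ((1 - s)/2))" "z \<in> open_segment_of e (s/2) ((1 + s)/2)"
    then obtain s' where "z = Inner e s'" "s/2 < s'" "s' < (1 + s)/2" by (auto simp: open_segment_of_def)
    then show False using z by (auto simp: star_inner_iff edge_dist_def field_simps split: if_splits)
  qed (use e in \<open>auto simp: open_star_def open_segment_of_def\<close>)
  have ii: "sepd (Inner e s) (Inner e' s')"
    if e: "e \<in> edges G" "0 < s" "s < 1" and e': "e' \<in> edges G" "0 < s'" "s' < 1"
      and ne: "e \<noteq> e' \<or> s < s'" for e s e' s'
  proof (cases "e = e'")
    case True
    then have "s < s'" using ne by simp
    then show ?thesis
      using e e' by (intro sepI[OF open_segment[OF e(1), of 0 "(s + s')/2"] open_segment[OF e'(1), of "(s + s')/2" 1]])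
        (auto simp: open_segment_of_def)
  next
    case False
    then show ?thesis
      using e e' by (intro sepI[OF open_segment[OF e(1), of 0 1] open_segment[OF e'(1), of 0 1]])
        (auto simp: open_segment_of_def)
  qed
  have ve: "sepd (Vertex v) (EndPoint \<omega>)" if v: "v \<in> V" and w: "\<omega> \<in> graph_ends G" for v \<omega>
  proof (rule sepI[OF open_star[OF v, of "1/2"] open_end_nbhd[OF _ _ w, of "{v}" "1/2"]])
    have C: "end_component G {v} \<omega> \<subseteq> V - {v}"
      using component_subset[OF end_component_props(1)[OF w]] v by simp
    fix z assume z: "z \<in> open_star G v (1/2)" "z \<in> end_nbhd G {v} \<omega> (1/2)"
    show False
    proof (cases "z = Vertex v")
      case True
      then show False using z(2) C by (auto simp: end_nbhd_def Let_def inner_points_def)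
    next
      case False
      then obtain e s where zi: "z = Inner e s" using z(1) by (auto simp: open_star_def)
      have e: "e \<in> edges G" "v \<in> ends G e" "edge_dist G e s v < 1/2" using z(1) zi by (auto simp: star_inner_iff)
      show False using z(2)[unfolded zi]
      proof (cases rule: nbhd_inner_cases)
        case 1
        then show False using e C by auto
      next
        case (2 x c)
        then have "v \<noteq> c" "c \<in> ends G e" using C by auto
        then show False using edge_dist_sum[OF e(1,2), of c s] 2 e by simp
      qed
    qed
  qed (use v w end_in_nbhd in \<open>auto simp: open_star_def\<close>)
  have ie: "sepd (Inner e s) (EndPoint \<omega>)" if e: "e \<in> edges G" "0 < s" "s < 1" and w: "\<omega> \<in> graph_ends G" for e s \<omega>
  proof -
    have fe: "finite (ends G e)" "ends G e \<subseteq> V" "ends G e \<noteq> {}"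
      using e(1) mg unfolding is_multigraph_def by fastforce+
    show ?thesis
    \<comment> \<open>With both endvertices of \<open>e\<close> deleted, no part of \<open>e\<close>
      belongs to the neighbourhood of the end.\<close>
    proof (rule sepI[OF open_segment[OF e(1), of 0 1] open_end_nbhd[OF fe(1,2) w, of 1]])
      have C: "end_component G (ends G e) \<omega> \<inter> ends G e = {}"
        using component_subset[OF end_component_props(1)[OF w fe(1,2)]] by blast
      fix z assume z: "z \<in> open_segment_of e 0 1" "z \<in> end_nbhd G (ends G e) \<omega> 1"
      then obtain s' where zi: "z = Inner e s'" by (auto simp: open_segment_of_def)
      show False using z(2)[unfolded zi]
        by (cases rule: nbhd_inner_cases) (use C fe in auto)
    qed (use e fe w end_in_nbhd in \<open>auto simp: open_segment_of_def\<close>)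
  qed
  have ee: "sepd (EndPoint \<omega>) (EndPoint \<eta>)" if w: "\<omega> \<in> graph_ends G" and h: "\<eta> \<in> graph_ends G" and ne: "\<omega> \<noteq> \<eta>" for \<omega> \<eta>
  proof -
    obtain R R' where R: "R \<in> \<omega>" "R' \<in> \<eta>" using ends_nonempty w h by blast
    have "(R, R') \<notin> ray_equiv G" using ends_disjoint[OF w h _ R(2)] ends_closed[OF w R(1)] ne by blast
    then obtain S where S: "finite S" "S \<subseteq> V"
      "\<And>C. C \<in> components_minus G S \<Longrightarrow> has_tail_in R C \<Longrightarrow> has_tail_in R' C \<Longrightarrow> False"
      using ends_rays[OF w R(1)] ends_rays[OF h R(2)] unfolding ray_equiv_def by blast
    let ?C = "end_component G S \<omega>" and ?C' = "end_component G S \<eta>"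
    have C: "?C \<in> components_minus G S" "?C' \<in> components_minus G S" using end_component_props(1) w h S by blast+
    have neC: "?C \<noteq> ?C'"
      using S(3)[OF C(1)] end_component_props(2)[OF w S(1,2) R(1)] end_component_props(2)[OF h S(1,2) R(2)] by auto
    then have dj: "?C \<inter> ?C' = {}" using component_unique[OF C] by blast
    have CS: "?C \<inter> S = {}" "?C' \<inter> S = {}" using component_subset C by blast+
    show ?thesis
    proof (rule sepI[OF open_end_nbhd[OF S(1,2) w, of 1] open_end_nbhd[OF S(1,2) h, of 1]])
      fix z assume z: "z \<in> end_nbhd G S \<omega> 1" "z \<in> end_nbhd G S \<eta> 1"
      show False
      proof (cases z)
        case (Vertex v)
        then show False using z dj by (auto simp: end_nbhd_def Let_def inner_points_def)
      next
        case (EndPoint \<xi>)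
        then have "\<xi> \<in> graph_ends G" "\<exists>R\<in>\<xi>. range (fst R) \<subseteq> ?C" "\<exists>R\<in>\<xi>. range (fst R) \<subseteq> ?C'"
          using z by (auto simp: end_nbhd_def Let_def inner_points_def)
        then show False using ray_in_component_iff[OF _ S(1,2)] C neC by metis
      next
        case (Inner e s)
        have ne: "ends G e \<noteq> {}" if "e \<in> edges G" using origin_in[OF that] by blast
        show False using z(1)[unfolded Inner]
        proof (cases rule: nbhd_inner_cases)
          case 1
          show False using z(2)[unfolded Inner]
            by (cases rule: nbhd_inner_cases) (use 1 dj CS ne in auto)
        next
          case (2 x c)
          show False using z(2)[unfolded Inner]
            by (cases rule: nbhd_inner_cases) (use 2 dj CS in \<open>auto simp: doubleton_eq_iff\<close>)
        qed
      qed
    qed (use S w h end_in_nbhd in auto)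
  qed
  have "sepd x y" if "x \<in> valid_points" "y \<in> valid_points" "x \<noteq> y" for x y
  proof -
    have xy: "z \<in> valid_points \<Longrightarrow> (\<exists>v\<in>V. z = Vertex v) \<or> (\<exists>e s. z = Inner e s \<and> e \<in> edges G \<and> 0 < s \<and> s < 1)
      \<or> (\<exists>\<omega>\<in>graph_ends G. z = EndPoint \<omega>)" for z by (auto simp: valid_points_def inner_points_def)
    have ii': "sepd (Inner e s) (Inner e' s')"
      if "e \<in> edges G" "0 < s" "s < 1" "e' \<in> edges G" "0 < s'" "s' < 1" "e \<noteq> e' \<or> s \<noteq> s'" for e s e' s'
      using ii[of e s e' s'] ii[of e' s' e s] sym that by (metis linorder_neqE_linordered_idom)
    show ?thesis
      using xy[OF that(1)] xy[OF that(2)] that(3)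
      by (elim disjE bexE exE conjE; hypsubst) (auto intro: vv vi ii' ve ie ee sym)
  qed
  then show ?thesis unfolding Hausdorff_space_def topspace_K sepd_def by blast
qed


text \<open>Constant-speed trace of a vertex and edge sequence: integers are sent to vertices, and
  the fractional part is reflected if the edge is traversed against its stored orientation.\<close>

definition ptrace :: "(nat \<Rightarrow> 'v) \<Rightarrow> (nat \<Rightarrow> 'e) \<Rightarrow> real \<Rightarrow> ('v, 'e) point" where
  "ptrace p f x = (let n = nat \<lfloor>x\<rfloor>; r = x - real n in
     if r = 0 then Vertex (p n) else Inner (f n) (if p n = origin G (f n) then r else 1 - r))"

lemma ptrace_nat [simp]: "ptrace p f (real n) = Vertex (p n)"
  by (simp add: ptrace_def)

lemma ptrace_inner:
  assumes "real n < x" "x < real n + 1"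
  shows "ptrace p f x = Inner (f n) (if p n = origin G (f n) then x - real n else 1 - (x - real n))"
proof -
  have "\<lfloor>x\<rfloor> = int n" using assms by (simp add: floor_unique)
  then show ?thesis using assms by (simp add: ptrace_def Let_def)
qed

lemma nonneg_real_cases:
  assumes "0 \<le> (x :: real)"
  obtains n where "x = real n" | n where "real n < x" "x < real n + 1"
proof -
  have "real (nat \<lfloor>x\<rfloor>) \<le> x" "x < real (nat \<lfloor>x\<rfloor>) + 1" using assms by linarith+
  then show thesis using that[of "nat \<lfloor>x\<rfloor>"] by linarith
qed

text \<open>Paths and initial parts of rays in common form, so that continuity and injectivity of
  the trace are shown only once.\<close>

definition segm :: "(nat \<Rightarrow> 'v) \<Rightarrow> (nat \<Rightarrow> 'e) \<Rightarrow> nat \<Rightarrow> bool" where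
  "segm p f M \<longleftrightarrow> (\<forall>n<M. f n \<in> edges G \<and> ends G (f n) = {p n, p (Suc n)}) \<and> (\<forall>n\<le>M. p n \<in> V) \<and> inj_on p {..M}"

lemma segmD:
  assumes "segm p f M" "n < M"
  shows "f n \<in> edges G" "ends G (f n) = {p n, p (Suc n)}" "p n \<noteq> p (Suc n)"
  using assms ends_neq[of "f n" "p n" "p (Suc n)"] by (auto simp: segm_def)

text \<open>Continuity tested on subbasic sets. At an integer both adjacent edges have to be
  considered, and their points near the common vertex lie in a small star.\<close>

lemma ptrace_local:
  assumes sg: "segm p f M" and U: "U \<in> subbasis" and x: "0 \<le> x" "x \<le> real M" and xU: "ptrace p f x \<in> U"
  shows "\<exists>\<delta>>0. \<forall>y. 0 \<le> y \<longrightarrow> y \<le> real M \<longrightarrow> \<bar>y - x\<bar> < \<delta> \<longrightarrow> ptrace p f y \<in> U"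
  using x(1)
proof (cases rule: nonneg_real_cases)
  case (1 n)
  then obtain \<epsilon> where \<epsilon>: "\<epsilon> > 0" "open_star G (p n) \<epsilon> \<subseteq> U" using nbhd_vertex[OF U, of "p n"] xU by auto
  have "ptrace p f y \<in> open_star G (p n) \<epsilon>" if y: "0 \<le> y" "y \<le> real M" "\<bar>y - x\<bar> < min 1 \<epsilon>" for y
  proof -
    consider "y = x" | "x < y" | "y < x" by linarith
    then show ?thesis
    proof cases
      case 1
      then show ?thesis using \<open>x = real n\<close> by (simp add: open_star_def)
    next
      case 2
      then have n: "real n < y" "y < real n + 1" "n < M" using y \<open>x = real n\<close> by linarith+
      note e = segmD[OF sg n(3)]
      have d: "y - real n < \<epsilon>" using y 2 \<open>x = real n\<close> by (simp add: abs_if)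
      have "p n \<in> ends G (f n)" using e(2) by simp
      then show ?thesis unfolding ptrace_inner[OF n(1,2)] star_inner_iff
        using e(1) n(1,2) d
        by (cases "p n = origin G (f n)") (simp_all add: edge_dist_def)
    next
      case 3
      then obtain m where m: "n = Suc m" using y \<open>x = real n\<close> by (cases n) auto
      then have n: "real m < y" "y < real m + 1" "m < M" using y 3 x \<open>x = real n\<close> by linarith+
      note e = segmD[OF sg n(3)]
      \<comment> \<open>Coming from the left, \<open>p n\<close> is the far end of the edge
        \<open>f m\<close>, so the orientation test has the opposite outcome from the one at
        \<open>p m\<close>.\<close>
      have o: "p n = origin G (f m) \<longleftrightarrow> p m \<noteq> origin G (f m)"
      proof -
        have "origin G (f m) = p m \<or> origin G (f m) = p (Suc m)" using origin_in[OF e(1)] unfolding e(2) by simp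
        then show ?thesis using e(3) unfolding m by metis
      qed
      have d: "real m + 1 - y < \<epsilon>" using y 3 \<open>x = real n\<close> m by (simp add: abs_if)
      have "p n \<in> ends G (f m)" using e(2) m by simp
      then show ?thesis unfolding ptrace_inner[OF n(1,2)] star_inner_iff
        using e(1) n(1,2) d o
        by (cases "p m = origin G (f m)") (simp_all add: edge_dist_def algebra_simps)
    qed
  qed
  then show ?thesis using \<epsilon> by (intro exI[of _ "min 1 \<epsilon>"]) auto
next
  case (2 n)
  have nM: "n < M" using 2 x by linarith
  note e = segmD[OF sg nM]
  define \<tau> where "\<tau> y = (if p n = origin G (f n) then y - real n else 1 - (y - real n))" for y
  have "Inner (f n) (\<tau> x) \<in> U" using xU unfolding ptrace_inner[OF 2] \<tau>_def .
  then obtain a b where ab: "0 \<le> a" "a < \<tau> x" "\<tau> x < b" "b \<le> 1" "open_segment_of (f n) a b \<subseteq> U"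
    using nbhd_inner[OF U] by blast
  have "ptrace p f y \<in> U" if y: "\<bar>y - x\<bar> < min (\<tau> x - a) (b - \<tau> x)" for y
  proof -
    have "\<bar>\<tau> y - \<tau> x\<bar> = \<bar>y - x\<bar>" by (simp add: \<tau>_def abs_minus_commute)
    then have t: "a < \<tau> y" "\<tau> y < b" using y by linarith+
    then have "real n < y" "y < real n + 1" using ab unfolding \<tau>_def by (auto split: if_splits)
    then have "ptrace p f y = Inner (f n) (\<tau> y)" unfolding \<tau>_def by (rule ptrace_inner)
    then show ?thesis using t ab(5) by (auto simp: open_segment_of_def)
  qed
  then show ?thesis using ab by (intro exI[of _ "min (\<tau> x - a) (b - \<tau> x)"]) auto
qed

lemma ptrace_inj:
  assumes sg: "segm p f M"
  shows "inj_on (ptrace p f) {0..real M}"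
proof (rule linorder_inj_onI')
  fix x y :: real assume x: "x \<in> {0..real M}" and y: "y \<in> {0..real M}" and xy: "x < y"
  have inj: "inj_on p {..M}" using sg by (simp add: segm_def)
  have "x \<ge> 0" "y \<ge> 0" using x y by auto
  show "ptrace p f x \<noteq> ptrace p f y"
  proof (rule nonneg_real_cases[OF \<open>x \<ge> 0\<close>]; rule nonneg_real_cases[OF \<open>y \<ge> 0\<close>])
    fix m n assume "x = real m" "y = real n"
    then show ?thesis using inj_onD[OF inj, of m n] x y xy by auto
  next
    fix m n assume m: "x = real m" and n: "real n < y" "y < real n + 1"
    show ?thesis unfolding m ptrace_inner[OF n] by simp
  next
    fix m n assume m: "real m < x" "x < real m + 1" and n: "y = real n"
    show ?thesis unfolding n ptrace_inner[OF m] by simp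
  next
    fix m n assume m: "real m < x" "x < real m + 1" and n: "real n < y" "y < real n + 1"
    have mM: "m < M" and nM: "n < M" using m n x y by auto
    show ?thesis
    proof
      assume eq: "ptrace p f x = ptrace p f y"
      then have fe: "f m = f n" unfolding ptrace_inner[OF m] ptrace_inner[OF n] by simp
      \<comment> \<open>The edge determines its index: equal edges have equal endvertex pairs, and
        \<open>p\<close> is injective.\<close>
      then have "{p m, p (Suc m)} = {p n, p (Suc n)}" using segmD(2)[OF sg mM] segmD(2)[OF sg nM] by simp
      then have "p ` {m, Suc m} = p ` {n, Suc n}" by simp
      then have "{m, Suc m} = {n, Suc n}" using inj_on_image_eq_iff[OF inj, of "{m, Suc m}" "{n, Suc n}"] mM nM by simp
      then have "m = n" by (auto simp: doubleton_eq_iff)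
      then show False using eq xy unfolding ptrace_inner[OF m] ptrace_inner[OF n] by (auto split: if_splits)
    qed
  qed
qed

lemma ptrace_image:
  assumes sg: "segm p f M"
  shows "ptrace p f ` {0..real M} = Vertex ` p ` {..M} \<union> inner_points (f ` {..<M})"
proof
  show "ptrace p f ` {0..real M} \<subseteq> Vertex ` p ` {..M} \<union> inner_points (f ` {..<M})"
  proof clarify
    fix x assume x: "x \<in> {0..real M}" "ptrace p f x \<notin> inner_points (f ` {..<M})"
    then have "x \<ge> 0" by simp
    then show "ptrace p f x \<in> Vertex ` p ` {..M}"
    proof (cases rule: nonneg_real_cases)
      case (1 n)
      then show ?thesis using x by simp
    next
      case (2 n)
      then have "n < M" using x by auto
      then have "ptrace p f x \<in> inner_points (f ` {..<M})" unfolding ptrace_inner[OF 2] inner_points_def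
        using 2 by auto
      then show ?thesis using x by simp
    qed
  qed
  show "Vertex ` p ` {..M} \<union> inner_points (f ` {..<M}) \<subseteq> ptrace p f ` {0..real M}"
  proof (intro Un_least subsetI)
    fix z :: "('v, 'e) point" assume "z \<in> Vertex ` p ` {..M}"
    then obtain n where "n \<le> M" "z = ptrace p f (real n)" by auto
    then show "z \<in> ptrace p f ` {0..real M}" by (intro image_eqI[of _ _ "real n"]) auto
  next
    fix z :: "('v, 'e) point" assume "z \<in> inner_points (f ` {..<M})"
    then obtain n s where n: "n < M" "0 < s" "s < 1" "z = Inner (f n) s" by (auto simp: inner_points_def)
    define x where "x = real n + (if p n = origin G (f n) then s else 1 - s)"
    have "real n < x" "x < real n + 1" using n by (auto simp: x_def)
    from ptrace_inner[OF this, of p f] have "ptrace p f x = z" using n by (auto simp: x_def)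
    moreover have "x \<in> {0..real M}" using \<open>real n < x\<close> \<open>x < real n + 1\<close> n by auto
    ultimately show "z \<in> ptrace p f ` {0..real M}" by blast
  qed
qed

text \<open>For a generated topology it is enough to test preimages of subbasic sets.\<close>

lemma continuous_map_local:
  fixes h :: "real \<Rightarrow> ('v, 'e) point"
  assumes "\<And>U s. \<lbrakk>U \<in> subbasis; s \<in> {0..1}; h s \<in> U\<rbrakk> \<Longrightarrow> \<exists>\<delta>>0. \<forall>s'\<in>{0..1}. \<bar>s' - s\<bar> < \<delta> \<longrightarrow> h s' \<in> U"
    and "h ` {0..1} \<subseteq> valid_points"
  shows "continuous_map (top_of_set {0..1}) K h"
  unfolding K_def
proof (rule continuous_on_generated_topo)
  fix U assume U: "U \<in> subbasis"
  show "openin (top_of_set {0..1}) (h -` U \<inter> topspace (top_of_set {0..1}))"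
    unfolding openin_euclidean_subtopology_iff dist_real_def using assms(1)[OF U] by fastforce
next
  show "h ` topspace (top_of_set {0..1}) \<subseteq> \<Union> subbasis"
    using assms(2) topspace_K unfolding K_def by simp
qed

lemma path_arc:
  assumes sg: "segm p f M" and M: "M > 0"
  shows "arc_with_endpoints K (Vertex (p 0)) (Vertex (p M)) (Vertex ` p ` {..M} \<union> inner_points (f ` {..<M}))"
proof -
  define h where "h s = ptrace p f (real M * s)" for s
  have rng: "real M * s \<in> {0..real M}" if "s \<in> {0..1}" for s
    using that M by (auto simp: mult_left_le)
  have img: "(\<lambda>s. real M * s) ` {0..1} = {0..real M}"
  proof
    show "{0..real M} \<subseteq> (\<lambda>s. real M * s) ` {0..1}"
    proof
      fix x assume "x \<in> {0..real M}"
      then show "x \<in> (\<lambda>s. real M * s) ` {0..1}" using M by (intro image_eqI[of _ _ "x / real M"]) auto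
    qed
  qed (use rng in blast)
  have him: "h ` {0..1} = Vertex ` p ` {..M} \<union> inner_points (f ` {..<M})"
    unfolding h_def using ptrace_image[OF sg] img by (metis image_image)
  have "continuous_map (top_of_set {0..1}) K h"
  proof (rule continuous_map_local)
    fix U s assume U: "U \<in> subbasis" and s: "s \<in> {0..1}" and hU: "h s \<in> U"
    obtain \<delta> where \<delta>: "\<delta> > 0" "\<And>y. \<lbrakk>0 \<le> y; y \<le> real M; \<bar>y - real M * s\<bar> < \<delta>\<rbrakk> \<Longrightarrow> ptrace p f y \<in> U"
      using ptrace_local[OF sg U, of "real M * s"] rng[OF s] hU unfolding h_def by auto
    have "h s' \<in> U" if "s' \<in> {0..1}" "\<bar>s' - s\<bar> < \<delta> / real M" for s'
    proof -
      have "\<bar>real M * s' - real M * s\<bar> = real M * \<bar>s' - s\<bar>" by (simp add: abs_mult flip: right_diff_distrib)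
      also have "\<dots> < \<delta>" using that(2) M by (simp add: field_simps)
      finally show ?thesis unfolding h_def using \<delta>(2) rng[OF that(1)] by simp
    qed
    then show "\<exists>\<delta>>0. \<forall>s'\<in>{0..1}. \<bar>s' - s\<bar> < \<delta> \<longrightarrow> h s' \<in> U"
      using \<delta>(1) M by (intro exI[of _ "\<delta> / real M"]) auto
  next
    show "h ` {0..1} \<subseteq> valid_points"
      unfolding him using sg by (auto simp: segm_def valid_points_def inner_points_def)
  qed
  moreover have "inj_on h {0..1}"
  proof (rule inj_onI)
    fix s t assume "s \<in> {0..1}" "t \<in> {0..1}" "h s = h t"
    then have "real M * s = real M * t" using inj_onD[OF ptrace_inj[OF sg]] rng unfolding h_def by blast
    then show "s = t" using M by simp
  qed
  ultimately have "arc_with_endpoints K (h 0) (h 1) (h ` {0..1})" using arc_of_map Hausdorff_K by blast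
  then show ?thesis unfolding him using ptrace_nat[of p f 0] ptrace_nat[of p f M] by (simp add: h_def)
qed

lemma ray_segm: "(p, f) \<in> rays G \<Longrightarrow> segm p f M"
  using raysD[of "(p, f)"] by (auto simp: segm_def intro: inj_on_subset)

text \<open>The half-open interval is stretched to the half-line by \<open>s / (1 - s)\<close> and
  traced along the ray, and the end is added at 1. Away from 1 all claims reduce to initial segments
  of the ray.\<close>

lemma ray_arc:
  assumes \<omega>: "\<omega> \<in> graph_ends G" and R: "(p, f) \<in> \<omega>"
  shows "arc_with_endpoints K (Vertex (p 0)) (EndPoint \<omega>)
    (Vertex ` range p \<union> inner_points (range f) \<union> {EndPoint \<omega>})"
proof -
  have ray: "(p, f) \<in> rays G" using ends_rays[OF \<omega> R] .
  note sg = ray_segm[OF ray]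
  define \<phi> where "\<phi> s = s / (1 - s)" for s :: real
  define h where "h s = (if s = 1 then EndPoint \<omega> else ptrace p f (\<phi> s))" for s
  have \<phi>0: "0 \<le> \<phi> s" if "s \<in> {0..<1}" for s using that by (auto simp: \<phi>_def)
  have \<phi>_inv: "\<phi> (x / (1 + x)) = x" "x / (1 + x) \<in> {0..<1}" if "0 \<le> x" for x
    using that by (auto simp: \<phi>_def field_simps)
  have \<phi>_inj: "s = t" if "\<phi> s = \<phi> t" "s \<in> {0..<1}" "t \<in> {0..<1}" for s t
    using that by (auto simp: \<phi>_def field_simps)
  have tr: "ptrace p f x \<in> Vertex ` range p \<union> inner_points (range f)" if x: "0 \<le> x" for x
  proof -
    obtain M where "x \<le> real M" using real_arch_simple by blast
    then have "ptrace p f x \<in> ptrace p f ` {0..real M}" using x by simp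
    then have "ptrace p f x \<in> Vertex ` p ` {..M} \<union> inner_points (f ` {..<M})"
      unfolding ptrace_image[OF sg[of M]] .
    then show ?thesis by (auto simp: inner_points_def)
  qed
  have him: "h ` {0..1} = Vertex ` range p \<union> inner_points (range f) \<union> {EndPoint \<omega>}"
  proof
    show "h ` {0..1} \<subseteq> Vertex ` range p \<union> inner_points (range f) \<union> {EndPoint \<omega>}"
    proof
      fix z assume "z \<in> h ` {0..1}"
      then obtain s where s: "s \<in> {0..1}" "z = h s" by blast
      show "z \<in> Vertex ` range p \<union> inner_points (range f) \<union> {EndPoint \<omega>}"
      proof (cases "s = 1")
        case True
        then show ?thesis using s by (simp add: h_def)
      next
        case False
        then show ?thesis using s tr[OF \<phi>0[of s]] by (simp add: h_def)
      qed
    qed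
    show "Vertex ` range p \<union> inner_points (range f) \<union> {EndPoint \<omega>} \<subseteq> h ` {0..1}"
    proof (intro Un_least subsetI)
      have *: "ptrace p f x \<in> h ` {0..1}" if "0 \<le> x" for x
        using \<phi>_inv[OF that] by (intro image_eqI[of _ _ "x / (1 + x)"]) (auto simp: h_def)
      show "z \<in> h ` {0..1}" if z: "z \<in> Vertex ` range p" for z
      proof -
        obtain n where "z = Vertex (p n)" using z by auto
        then show ?thesis using *[of "real n"] by simp
      qed
      show "z \<in> h ` {0..1}" if z: "z \<in> inner_points (range f)" for z
      proof -
        obtain n s where "z = Inner (f n) s" "0 < s" "s < 1" using z by (auto simp: inner_points_def)
        then have "z \<in> inner_points (f ` {..<Suc n})" by (auto simp: inner_points_def)
        then obtain x where "x \<in> {0..real (Suc n)}" "z = ptrace p f x" using ptrace_image[OF sg[of "Suc n"]] by blast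
        then show ?thesis using * by auto
      qed
      show "z \<in> h ` {0..1}" if "z \<in> {EndPoint \<omega>}" for z
        using that by (intro image_eqI[of _ _ 1]) (auto simp: h_def)
    qed
  qed
  have "continuous_map (top_of_set {0..1}) K h"
  proof (rule continuous_map_local)
    fix U s assume U: "U \<in> subbasis" and s: "s \<in> {0..1}" and hU: "h s \<in> U"
    show "\<exists>\<delta>>0. \<forall>s'\<in>{0..1}. \<bar>s' - s\<bar> < \<delta> \<longrightarrow> h s' \<in> U"
    proof (cases "s = 1")
      case True
      then obtain N where N: "\<And>n. n \<ge> N \<Longrightarrow> Vertex (p n) \<in> U"
        "\<And>n s. \<lbrakk>n \<ge> N; 0 < s; s < 1\<rbrakk> \<Longrightarrow> Inner (f n) s \<in> U"
        using nbhd_end[OF U _ \<omega> R] hU unfolding h_def by auto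
      have late: "ptrace p f x \<in> U" if x: "real N \<le> x" for x
      proof -
        have "0 \<le> x" using x by linarith
        then show ?thesis
        proof (cases rule: nonneg_real_cases)
          case (1 n)
          then show ?thesis using N(1) x by simp
        next
          case (2 n)
          then have "n \<ge> N" using x by linarith
          then show ?thesis unfolding ptrace_inner[OF 2] using N(2) 2 by simp
        qed
      qed
      \<comment> \<open>The radius is chosen so that \<open>1 - s' < 1 / (N + 1)\<close> gives
        \<open>\<phi> s' \<ge> N\<close>, beyond which the ray stays in \<open>U\<close>.\<close>
      have "h s' \<in> U" if s': "s' \<in> {0..1}" "\<bar>s' - s\<bar> < 1 / (real N + 1)" for s'
      proof (cases "s' = 1")
        case True
        then show ?thesis using hU \<open>s = 1\<close> by simp
      next
        case False
        then have lt: "s' < 1" "1 - s' < 1 / (real N + 1)" using s' \<open>s = 1\<close> by auto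
        then have "(1 - s') * (real N + 1) < 1" by (simp add: field_simps)
        then have "real N \<le> \<phi> s'" using lt by (simp add: \<phi>_def field_simps)
        then show ?thesis using late False by (simp add: h_def)
      qed
      then show ?thesis by (intro exI[of _ "1 / (real N + 1)"]) auto
    next
      case False
      then have s1: "s \<in> {0..<1}" using s by auto
      \<comment> \<open>The extra 1 leaves room to the right of \<open>\<phi> s\<close>, so that
        nearby parameters stay in the same initial segment.\<close>
      obtain M where M: "\<phi> s + 1 \<le> real M" using real_arch_simple by blast
      have "ptrace p f (\<phi> s) \<in> U" using hU False by (simp add: h_def)
      then obtain \<delta> where \<delta>: "\<delta> > 0" "\<And>y. \<lbrakk>0 \<le> y; y \<le> real M; \<bar>y - \<phi> s\<bar> < \<delta>\<rbrakk> \<Longrightarrow> ptrace p f y \<in> U"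
        using ptrace_local[OF sg[of M] U, of "\<phi> s"] \<phi>0[OF s1] M by auto
      have "isCont \<phi> s" unfolding \<phi>_def using s1 by (auto intro!: continuous_intros)
      then obtain d where d: "d > 0" "\<And>y. \<bar>y - s\<bar> < d \<Longrightarrow> \<bar>\<phi> y - \<phi> s\<bar> < min \<delta> 1"
        unfolding continuous_at_eps_delta dist_real_def using \<delta>(1) by (metis min_less_iff_conj zero_less_one)
      have "h y \<in> U" if y: "y \<in> {0..1}" "\<bar>y - s\<bar> < min d (1 - s)" for y
      proof -
        have y1: "y \<in> {0..<1}" using y by auto
        have "\<bar>\<phi> y - \<phi> s\<bar> < min \<delta> 1" using d y by simp
        then have "ptrace p f (\<phi> y) \<in> U" using \<delta>(2)[of "\<phi> y"] \<phi>0[OF y1] M by linarith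
        then show ?thesis using y1 by (simp add: h_def)
      qed
      then show ?thesis using d(1) s1 by (intro exI[of _ "min d (1 - s)"]) auto
    qed
  next
    show "h ` {0..1} \<subseteq> valid_points"
      unfolding him using raysD[OF ray] \<omega> by (auto simp: valid_points_def inner_points_def)
  qed
  moreover have "inj_on h {0..1}"
  proof (rule inj_onI)
    fix s t assume st: "s \<in> {0..1}" "t \<in> {0..1}" "h s = h t"
    have ne: "ptrace p f x \<noteq> EndPoint \<omega>" if "0 \<le> x" for x using tr[OF that] by (auto simp: inner_points_def)
    show "s = t"
    proof (cases "s = 1 \<or> t = 1")
      case True
      then show ?thesis using st ne[OF \<phi>0[of s]] ne[OF \<phi>0[of t]] by (auto simp: h_def split: if_splits)
    next
      case False
      then have s1: "s \<in> {0..<1}" "t \<in> {0..<1}" using st by auto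
      obtain M where M: "max (\<phi> s) (\<phi> t) \<le> real M" using real_arch_simple by blast
      have "ptrace p f (\<phi> s) = ptrace p f (\<phi> t)" using st False by (simp add: h_def)
      then have "\<phi> s = \<phi> t" using inj_onD[OF ptrace_inj[OF sg[of M]], of "\<phi> s" "\<phi> t"] M \<phi>0 s1 by auto
      then show ?thesis using \<phi>_inj s1 by blast
    qed
  qed
  ultimately have "arc_with_endpoints K (h 0) (h 1) (h ` {0..1})" using arc_of_map Hausdorff_K by blast
  then show ?thesis unfolding him using ptrace_nat[of p f 0] by (simp add: h_def \<phi>_def)
qed

lemma walk_arc:
  assumes "walkG u ps" "simple u ps" "ps \<noteq> []"
  shows "arc_with_endpoints K (Vertex u) (Vertex (wend u ps)) (Vertex ` pverts u ps \<union> inner_points (pedges ps))"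
    and "is_graphic G (Vertex ` pverts u ps \<union> inner_points (pedges ps))"
proof -
  define vs where "vs = u # map snd ps"
  define es where "es = map fst ps"
  have nth: "es ! n \<in> edges G \<and> ends G (es ! n) = {vs ! n, vs ! Suc n}" if "n < length ps" for n
    using walk_nth[OF assms(1) that] that by (simp add: vs_def es_def)
  have dist: "distinct vs" using assms(2) by (simp add: vs_def simple_def)
  have len: "length vs = Suc (length ps)" by (simp add: vs_def)
  have vV: "vs ! n \<in> V" if "n \<le> length ps" for n
  proof (cases n)
    case 0
    then show ?thesis using nth[of 0] ends_subset assms(3) by (metis insert_subset length_greater_0_conv)
  next
    case (Suc m)
    then show ?thesis using nth[of m] ends_subset that by (metis Suc_le_eq insert_subset)
  qed
  have "segm (\<lambda>n. vs ! n) (\<lambda>n. es ! n) (length ps)"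
    unfolding segm_def using nth vV dist len by (auto simp: inj_on_def nth_eq_iff_index_eq)
  moreover have "wend u ps = vs ! length ps"
    unfolding vs_def by (induction u ps rule: wend.induct) auto
  moreover have "(\<lambda>n. vs ! n) ` {..length ps} = pverts u ps"
  proof -
    have "(\<lambda>n. vs ! n) ` {..length ps} = set vs" using len by (auto simp: set_conv_nth less_Suc_eq_le)
    then show ?thesis by (simp add: vs_def)
  qed
  moreover have "(\<lambda>n. es ! n) ` {..<length ps} = pedges ps"
  proof -
    have "(\<lambda>n. es ! n) ` {..<length es} = set es" by (auto simp: set_conv_nth)
    then have "(\<lambda>n. es ! n) ` {..<length ps} = set es" by (simp add: es_def)
    then show ?thesis by (simp add: es_def)
  qed
  ultimately show "arc_with_endpoints K (Vertex u) (Vertex (wend u ps)) (Vertex ` pverts u ps \<union> inner_points (pedges ps))"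
    using path_arc[of "\<lambda>n. vs ! n" "\<lambda>n. es ! n" "length ps"] assms(3) by (simp add: vs_def)
  have "set vs \<subseteq> V" using vV len by (auto simp: set_conv_nth less_Suc_eq_le)
  then have "is_path G vs es" unfolding is_path_def using nth dist len walk_edges[OF assms(1)]
    by (simp add: es_def)
  moreover have "set vs = pverts u ps" "set es = pedges ps" by (simp_all add: vs_def es_def)
  ultimately show "is_graphic G (Vertex ` pverts u ps \<union> inner_points (pedges ps))"
    unfolding is_graphic_def by metis
qed


section \<open>Gluing paths and rays\<close>

lemma disjoint_from_singleton: "x \<notin> X \<Longrightarrow> X \<inter> Y \<subseteq> {x} \<Longrightarrow> X \<inter> Y = {}"
  by blast

lemma ray_Cons:
  assumes \<omega>: "\<omega> \<in> graph_ends G" and R: "(p, f) \<in> \<omega>" and e: "e \<in> edges G" "ends G e = {u, p 0}" and u: "u \<notin> range p"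
  shows "(case_nat u p, case_nat e f) \<in> \<omega>"
proof (rule ends_closed[OF \<omega> R])
  have ray: "(p, f) \<in> rays G" by (rule ends_rays[OF \<omega> R])
  have "inj (case_nat u p)"
  proof (rule injI)
    fix i j assume "case_nat u p i = case_nat u p j"
    then show "i = j" using u raysD(1)[OF ray] by (cases i; cases j) (auto dest: injD)
  qed
  moreover have "case_nat u p i \<in> V" for i
    using raysD(2)[OF ray] ends_subset[OF e(1)] e(2) by (cases i) auto
  moreover have "case_nat e f i \<in> edges G \<and> ends G (case_nat e f i) = {case_nat u p i, case_nat u p (Suc i)}" for i
    using raysD(3,4)[OF ray] e by (cases i) auto
  ultimately have "(case_nat u p, case_nat e f) \<in> rays G" unfolding rays_def by blast
  then show "((p, f), (case_nat u p, case_nat e f)) \<in> ray_equiv G"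
    by (intro ray_equiv_shift[of _ _ 1 0] ray) auto
qed

lemma range_case_nat: "range (case_nat a h) = insert a (range h)"
proof
  show "range (case_nat a h) \<subseteq> insert a (range h)" by (auto split: nat.splits)
  have "a = case_nat a h 0" "h i = case_nat a h (Suc i)" for i by simp_all
  then show "insert a (range h) \<subseteq> range (case_nat a h)" by blast
qed

text \<open>Adding one edge at a time keeps the ray in its end, so the glued ray needs no fresh
  equivalence proof.\<close>

lemma ray_prepend:
  assumes "\<omega> \<in> graph_ends G" "(p, f) \<in> \<omega>" "walkG u ps" "simple u ps" "wend u ps = p 0"
    "pverts u ps \<inter> range p = {p 0}"
  shows "\<exists>p' f'. (p', f') \<in> \<omega> \<and> p' 0 = u \<and> range p' = pverts u ps \<union> range p \<and> range f' = pedges ps \<union> range f"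
  using assms(3-6)
proof (induction ps arbitrary: u)
  case Nil
  then show ?case using assms(2) by (intro exI[of _ p] exI[of _ f]) auto
next
  case (Cons q ps)
  obtain e v where q: "q = (e, v)" by (cases q)
  have wv: "wend v ps = p 0" using Cons.prems q by simp
  then have "p 0 \<in> pverts v ps" using wend_in_pverts[of v ps] by simp
  moreover have "u \<notin> pverts v ps" using Cons.prems(2) q by simp
  ultimately have "p 0 \<noteq> u" by metis
  have int: "insert u (pverts v ps) \<inter> range p = {p 0}" using Cons.prems(4) q by simp
  have "u \<notin> range p"
  proof
    assume "u \<in> range p"
    then have "u \<in> insert u (pverts v ps) \<inter> range p" by blast
    then show False unfolding int using \<open>p 0 \<noteq> u\<close> by simp
  qed
  then have u: "u \<notin> range p" "pverts v ps \<inter> range p = {p 0}"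
    using int Int_insert_left_if0[of u "range p" "pverts v ps"] by simp_all
  obtain p' f' where pf: "(p', f') \<in> \<omega>" "p' 0 = v" "range p' = pverts v ps \<union> range p"
    "range f' = pedges ps \<union> range f"
    using Cons.IH[of v] Cons.prems q wv u by auto
  have "u \<notin> range p'" unfolding pf(3) using u \<open>u \<notin> pverts v ps\<close> by blast
  then have "(case_nat u p', case_nat e f') \<in> \<omega>"
    using ray_Cons[OF assms(1) pf(1), of e u] Cons.prems(1) q pf(2) by simp
  then show ?case using pf q
    by (intro exI[of _ "case_nat u p'"] exI[of _ "case_nat e f'"]) (auto simp: range_case_nat)
qed

definition pts where "pts t t' W F = Vertex ` W \<union> inner_points F \<union> {t, t'}"

text \<open>The vertex and edge sets are kept as parameters so that gluing amounts to taking
  unions.\<close>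

definition conn where
  "conn t t' W F \<longleftrightarrow> is_graphic G (pts t t' W F) \<and> arc_with_endpoints K t t' (pts t t' W F)"

lemma conn_sym: "conn t t' W F \<Longrightarrow> conn t' t W F"
  using arc_reverse[OF _ Hausdorff_K] unfolding conn_def pts_def by (simp add: insert_commute)

lemma conn_walk:
  assumes "walkG u ps" "simple u ps" "ps \<noteq> []"
  shows "conn (Vertex u) (Vertex (wend u ps)) (pverts u ps) (pedges ps)"
proof -
  have "pts (Vertex u) (Vertex (wend u ps)) (pverts u ps) (pedges ps) = Vertex ` pverts u ps \<union> inner_points (pedges ps)"
    unfolding pts_def using wend_in_pverts[of u ps] by blast
  then show ?thesis using walk_arc[OF assms] unfolding conn_def by simp
qed

lemma conn_ray:
  assumes "\<omega> \<in> graph_ends G" "(p, f) \<in> \<omega>"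
  shows "conn (Vertex (p 0)) (EndPoint \<omega>) (range p) (range f)"
proof -
  have eq: "pts (Vertex (p 0)) (EndPoint \<omega>) (range p) (range f) = Vertex ` range p \<union> inner_points (range f) \<union> {EndPoint \<omega>}"
    unfolding pts_def by blast
  show ?thesis using ray_arc[OF assms] assms unfolding conn_def eq is_graphic_def by blast
qed

text \<open>Graphicness is witnessed by the double ray, while the arc itself is obtained by joining
  the two ray arcs at their common first vertex; no trace over the integers is needed.\<close>

lemma conn_double_ray:
  assumes \<omega>: "\<omega> \<in> graph_ends G" "(p, f) \<in> \<omega>" and \<eta>: "\<eta> \<in> graph_ends G" "(q, g) \<in> \<eta>" and ne: "\<omega> \<noteq> \<eta>"
    and pq: "p 0 = q 0" "range p \<inter> range q = {p 0}"
  shows "conn (EndPoint \<omega>) (EndPoint \<eta>) (range p \<union> range q) (range f \<union> range g)"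
proof -
  have p: "(p, f) \<in> rays G" and q: "(q, g) \<in> rays G" using ends_rays \<omega> \<eta> by blast+
  have injp: "inj p" and injq: "inj q" using raysD(1)[OF p] raysD(1)[OF q] by simp_all
  have fg: "f i \<noteq> g j" for i j
  proof
    assume "f i = g j"
    then have "{p i, p (Suc i)} = {q j, q (Suc j)}" using raysD(4)[OF p, of i] raysD(4)[OF q, of j] by simp
    then have "{p i, p (Suc i)} \<subseteq> range p \<inter> range q" by auto
    then have "p i = p (Suc i)" unfolding pq(2) by auto
    then show False using injD[OF injp] by (metis n_not_Suc_n)
  qed
  define P where "P i = (if 0 \<le> i then p (nat i) else q (nat (- i)))" for i :: int
  \<comment> \<open>The edge with index -1 joins the positions -1 and 0, so it is the edge 0 of the
    second ray; hence the shift by one.\<close>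
  define F where "F i = (if 0 \<le> i then f (nat i) else g (nat (- i - 1)))" for i :: int
  have Pneg: "P (- int n) = q n" for n using pq(1) by (cases "n = 0") (auto simp: P_def)
  have Ppos: "P (int n) = p n" for n by (simp add: P_def)
  have Fneg: "F (- int n - 1) = g n" for n by (simp add: F_def)
  have Fpos: "F (int n) = f n" for n by (simp add: F_def)
  have PF: "F i \<in> edges G \<and> ends G (F i) = {P i, P (i + 1)}" for i
  proof (cases "0 \<le> i")
    case True
    then obtain n where n: "i = int n" using nonneg_int_cases by blast
    then have "i + 1 = int (Suc n)" by simp
    then have "P (i + 1) = p (Suc n)" using Ppos by metis
    then show ?thesis using raysD(3,4)[OF p, of n] n Ppos[of n] Fpos[of n] by simp
  next
    case False
    define n where "n = nat (- i - 1)"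
    have i: "i = - int n - 1" "i = - int (Suc n)" "i + 1 = - int n" using False by (auto simp: n_def)
    have "F i = g n" "P i = q (Suc n)" "P (i + 1) = q n" using Fneg[of n] Pneg[of "Suc n"] Pneg[of n] i by metis+
    then show ?thesis using raysD(3,4)[OF q, of n] by (simp add: insert_commute)
  qed
  have cross: "p m = q n \<Longrightarrow> m = 0 \<and> n = 0" for m n
  proof -
    assume eq: "p m = q n"
    then have "p m \<in> range p \<inter> range q" by (metis IntI rangeI)
    then have "p m = p 0" unfolding pq(2) by simp
    moreover then have "q n = q 0" using eq pq(1) by simp
    ultimately show "m = 0 \<and> n = 0" using injD[OF injp] injD[OF injq] by blast
  qed
  have "inj P"
  proof (rule injI)
    fix i j assume eq: "P i = P j"
    consider "0 \<le> i" "0 \<le> j" | "i < 0" "j < 0" | "0 \<le> i" "j < 0" | "i < 0" "0 \<le> j" by linarith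
    then show "i = j"
    proof cases
      case 1
      then show ?thesis using eq injD[OF injp, of "nat i" "nat j"] by (simp add: P_def)
    next
      case 2
      then show ?thesis using eq injD[OF injq, of "nat (- i)" "nat (- j)"] by (simp add: P_def)
    next
      case 3
      then show ?thesis using eq cross[of "nat i" "nat (- j)"] by (simp add: P_def)
    next
      case 4
      then show ?thesis using eq cross[of "nat j" "nat (- i)"] by (simp add: P_def)
    qed
  qed
  moreover have rP: "range P = range p \<union> range q"
  proof
    show "range P \<subseteq> range p \<union> range q" by (auto simp: P_def)
    show "range p \<union> range q \<subseteq> range P" using Ppos Pneg by (metis Un_least image_subsetI rangeI)
  qed
  moreover have rF: "range F = range f \<union> range g"
  proof
    show "range F \<subseteq> range f \<union> range g" by (auto simp: F_def)
    show "range f \<union> range g \<subseteq> range F" using Fpos Fneg by (metis Un_least image_subsetI rangeI)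
  qed
  moreover have "range F \<subseteq> edges G" using PF by blast
  moreover have "range p \<union> range q \<subseteq> V" using raysD(2)[OF p] raysD(2)[OF q] by auto
  ultimately have "is_double_ray G P F" unfolding is_double_ray_def using PF by simp
  moreover have "(\<lambda>n. P (int n), \<lambda>n. F (int n)) \<in> \<omega>" using \<omega>(2) by (simp add: Ppos Fpos)
  moreover have "(\<lambda>n. P (- int n), \<lambda>n. F (- int n - 1)) \<in> \<eta>" using \<eta>(2) by (simp add: Pneg Fneg)
  ultimately have gr: "is_graphic G (pts (EndPoint \<omega>) (EndPoint \<eta>) (range p \<union> range q) (range f \<union> range g))"
    unfolding is_graphic_def pts_def rP[symmetric] rF[symmetric] using \<omega>(1) \<eta>(1) ne by blast
  let ?A = "pts (EndPoint \<omega>) (Vertex (p 0)) (range p) (range f)"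
  let ?B = "pts (Vertex (p 0)) (EndPoint \<eta>) (range q) (range g)"
  have a: "arc_with_endpoints K (EndPoint \<omega>) (Vertex (p 0)) ?A"
    using conn_sym[OF conn_ray[OF \<omega>]] by (simp add: conn_def)
  have b: "arc_with_endpoints K (Vertex (p 0)) (EndPoint \<eta>) ?B"
    using conn_ray[OF \<eta>] pq by (simp add: conn_def)
  have "?A \<inter> ?B \<subseteq> {Vertex (p 0)}"
  proof
    fix z assume z: "z \<in> ?A \<inter> ?B"
    show "z \<in> {Vertex (p 0)}"
    proof (cases z)
      case (Vertex v)
      then have "v \<in> range p \<or> v = p 0" "v \<in> range q \<or> v = p 0"
        using z unfolding pts_def inner_points_def by blast+
      then have "v \<in> range p" "v \<in> range q" using pq(1) by (metis rangeI)+
      then have "v \<in> range p \<inter> range q" by (rule IntI)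
      then show ?thesis unfolding pq(2) using Vertex by simp
    next
      case (Inner e s)
      then show ?thesis using z fg by (auto simp: pts_def inner_points_def)
    next
      case (EndPoint \<xi>)
      then show ?thesis using z ne by (auto simp: pts_def inner_points_def)
    qed
  qed
  moreover have "Vertex (p 0) \<in> ?A \<inter> ?B" by (simp add: pts_def)
  ultimately have ab: "?A \<inter> ?B = {Vertex (p 0)}" by blast
  have un: "?A \<union> ?B = pts (EndPoint \<omega>) (EndPoint \<eta>) (range p \<union> range q) (range f \<union> range g)"
    unfolding pts_def inner_points_def by blast
  from arc_join[OF a b ab Hausdorff_K] show ?thesis unfolding conn_def un using gr by blast
qed

text \<open>Treats both kinds of terminal alike: what runs from the vertex \<open>w\<close> to
  \<open>t\<close> inside a side is a path if \<open>t\<close> is a vertex and a ray if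
  \<open>t\<close> is an end. A path may be trivial.\<close>

definition tail where
  "tail t w W F \<longleftrightarrow>
     (\<exists>ps. t = Vertex (wend w ps) \<and> walkG w ps \<and> simple w ps \<and> W = pverts w ps \<and> F = pedges ps)
   \<or> (\<exists>\<omega> p f. t = EndPoint \<omega> \<and> \<omega> \<in> graph_ends G \<and> (p, f) \<in> \<omega> \<and> p 0 = w \<and> W = range p \<and> F = range f)"

lemma conn_walk_tail:
  assumes w: "walkG u ps" "simple u ps" "ps \<noteq> []" and tl: "tail t (wend u ps) W F"
    and W: "pverts u ps \<inter> W = {wend u ps}"
  shows "conn (Vertex u) t (pverts u ps \<union> W) (pedges ps \<union> F)"
  using tl unfolding tail_def
proof (elim disjE exE conjE)
  fix qs assume qs: "t = Vertex (wend (wend u ps) qs)" "walkG (wend u ps) qs" "simple (wend u ps) qs"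
    "W = pverts (wend u ps) qs" "F = pedges qs"
  have "wend u ps \<notin> snd ` set qs" using qs(3) by (simp add: simple_def)
  moreover have "snd ` set qs \<inter> pverts u ps \<subseteq> {wend u ps}" unfolding W[symmetric] qs(4) by blast
  ultimately have "snd ` set qs \<inter> pverts u ps = {}" by (rule disjoint_from_singleton)
  then have "conn (Vertex u) (Vertex (wend u (ps @ qs))) (pverts u (ps @ qs)) (pedges (ps @ qs))"
    using conn_walk[of u "ps @ qs"] w qs by (simp add: simple_append)
  moreover have "pverts u (ps @ qs) = pverts u ps \<union> W" using wend_in_pverts[of u ps] by (auto simp: qs)
  moreover have "pedges (ps @ qs) = pedges ps \<union> F" by (auto simp: qs)
  ultimately show ?thesis using qs(1) by simp
next
  fix \<omega> p f assume r: "t = EndPoint \<omega>" "\<omega> \<in> graph_ends G" "(p, f) \<in> \<omega>" "p 0 = wend u ps" "W = range p" "F = range f"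
  obtain p' f' where pf: "(p', f') \<in> \<omega>" "p' 0 = u" "range p' = pverts u ps \<union> range p" "range f' = pedges ps \<union> range f"
    using ray_prepend[OF r(2,3) w(1,2)] r W by auto
  show ?thesis using conn_ray[OF r(2) pf(1)] unfolding pf r by simp
qed

text \<open>If one tail is a path, it is absorbed into the walk, if necessary after reversing the
  direction. Two rays remain as the only other case and give a double ray.\<close>

lemma conn_tails:
  assumes w: "walkG u ps" "simple u ps" "ps \<noteq> []" and tl: "tail t u W F" "tail t' (wend u ps) W' F'"
    and W: "pverts u ps \<inter> W = {u}" "pverts u ps \<inter> W' = {wend u ps}" "W \<inter> W' = {}" and ne: "t \<noteq> t'"
  shows "conn t t' (W \<union> pverts u ps \<union> W') (F \<union> pedges ps \<union> F')"
proof -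
  have vertex: "conn t t' (W \<union> pverts u ps \<union> W') (F \<union> pedges ps \<union> F')"
    if w: "walkG u ps" "simple u ps" "ps \<noteq> []" and tl: "tail t' (wend u ps) W' F'"
      and W: "pverts u ps \<inter> W = {u}" "pverts u ps \<inter> W' = {wend u ps}" "W \<inter> W' = {}"
      and qs: "t = Vertex (wend u qs)" "walkG u qs" "simple u qs" "W = pverts u qs" "F = pedges qs"
    for t t' u ps W W' F F' qs
  proof -
    let ?r = "prev u qs @ ps"
    have "u \<notin> snd ` set ps" using w(2) by (simp add: simple_def)
    moreover have "snd ` set ps \<inter> pverts u qs \<subseteq> {u}" unfolding W(1)[symmetric] qs(4) by blast
    ultimately have "snd ` set ps \<inter> pverts u qs = {}" by (rule disjoint_from_singleton)
    then have "simple (wend u qs) ?r" using simple_prev[OF qs(3)] w(2) by (simp add: simple_append)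
    moreover have "walkG (wend u qs) ?r" using walk_prev[OF qs(2)] w(1) by simp
    moreover have v: "pverts (wend u qs) ?r = W \<union> pverts u ps"
    proof -
      have "pverts (wend u qs) ?r = pverts (wend u qs) (prev u qs) \<union> snd ` set ps"
        unfolding set_append image_Un by blast
      then show ?thesis unfolding pverts_prev using qs(4) by blast
    qed
    moreover have "(W \<union> pverts u ps) \<inter> W' = {wend u ps}" using W by blast
    ultimately have "conn (Vertex (wend u qs)) t' (W \<union> pverts u ps \<union> W') (pedges ?r \<union> F')"
      using conn_walk_tail[of "wend u qs" ?r t' W' F'] w(3) tl by simp
    moreover have "pedges ?r = F \<union> pedges ps" using pedges_prev[of u qs] qs(5) by (simp add: image_Un)
    ultimately show ?thesis using qs(1) by simp
  qed
  consider qs where "t = Vertex (wend u qs)" "walkG u qs" "simple u qs" "W = pverts u qs" "F = pedges qs"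
    | qs where "t' = Vertex (wend (wend u ps) qs)" "walkG (wend u ps) qs" "simple (wend u ps) qs"
        "W' = pverts (wend u ps) qs" "F' = pedges qs"
    | \<omega> p f \<eta> q g where "t = EndPoint \<omega>" "\<omega> \<in> graph_ends G" "(p, f) \<in> \<omega>" "p 0 = u" "W = range p" "F = range f"
        "t' = EndPoint \<eta>" "\<eta> \<in> graph_ends G" "(q, g) \<in> \<eta>" "q 0 = wend u ps" "W' = range q" "F' = range g"
    using tl unfolding tail_def by metis
  then show ?thesis
  proof cases
    case 1
    show ?thesis by (rule vertex[OF w tl(2) W 1])
  next
    case 2
    have "conn t' t (W' \<union> pverts (wend u ps) (prev u ps) \<union> W) (F' \<union> pedges (prev u ps) \<union> F)"
      by (rule vertex[OF walk_prev[OF w(1)] simple_prev[OF w(2)] _ _ _ _ _ 2]) (use w tl W in auto)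
    then show ?thesis using conn_sym unfolding pverts_prev pedges_prev by (simp add: Un_ac)
  next
    case 3
    \<comment> \<open>The middle walk is attached to the second ray, so that both rays start at
      \<open>u\<close>.\<close>
    obtain q' g' where q: "(q', g') \<in> \<eta>" "q' 0 = u" "range q' = pverts u ps \<union> range q" "range g' = pedges ps \<union> range g"
      using ray_prepend[OF 3(8,9) w(1,2)] W(2) 3 by auto
    have "range p \<inter> pverts u ps = {p 0}" "range p \<inter> range q = {}"
      using W(1,3) unfolding 3 by (simp_all only: Int_commute)
    then have "range p \<inter> range q' = {p 0}" unfolding q(3) Int_Un_distrib by simp
    then have "conn t t' (range p \<union> range q') (range f \<union> range g')"
      using conn_double_ray[OF 3(2,3,8) q(1)] ne 3 q(2) by simp
    then show ?thesis unfolding q 3 by (simp add: Un_ac)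
  qed
qed

text \<open>The side \<open>A t\<close> is minimum among its separating subsets, since the other
  terminals still live outside a smaller set. This is what the linkage to a vertex and the rays to
  an end require.\<close>

lemma tails_exist:
  assumes T: "T \<subseteq> vhat G" and sp: "separators T A" and t: "t \<in> T"
  shows "\<exists>W F. (\<forall>e\<in>bdG (A t). (\<exists>w. w \<in> ends G e \<inter> A t \<and> tail t w (W e) (F e)) \<and> W e \<subseteq> A t
      \<and> (\<forall>h\<in>F e. h \<in> edges G \<and> ends G h \<subseteq> A t))
    \<and> (\<forall>e\<in>bdG (A t). \<forall>e'\<in>bdG (A t). e \<noteq> e' \<longrightarrow> F e \<inter> F e' = {})"
proof -
  have ms: "minsep T t (A t)" using sp t by (simp add: separators_def)
  then have At: "A t \<subseteq> V" "finite (bdG (A t))" "lives_in {t} (A t)" "lives_in (T - {t}) (V - A t)"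
    by (auto simp: minsep_def sep_def)
  have min: "card (bdG (A t)) \<le> card (bdG Y)" if "lives_in {t} Y" "Y \<subseteq> A t" "finite (bdG Y)" for Y
  proof -
    have "lives_in (T - {t}) (V - Y)" by (rule lives_in_mono[OF At(4)]) (use that in auto)
    then have "sep T t Y" using that At by (auto simp: sep_def)
    then show ?thesis using cut_lambda_le ms by (auto simp: minsep_def)
  qed
  have "t \<in> vhat G" using t T by auto
  then show ?thesis
  proof (cases rule: vhat_cases)
    case (1 x)
    have "{x} \<subseteq> A t" using At(3) 1 by simp
    have "\<exists>v ps. (\<forall>e\<in>bdG (A t). v e \<in> ends G e \<inter> A t \<and> walkG (v e) (ps e) \<and> simple (v e) (ps e)
        \<and> pverts (v e) (ps e) \<subseteq> A t \<and> pverts (v e) (ps e) \<inter> {x} = {wend (v e) (ps e)})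
      \<and> (\<forall>e\<in>bdG (A t). \<forall>e'\<in>bdG (A t). e \<noteq> e' \<longrightarrow> insert e (pedges (ps e)) \<inter> insert e' (pedges (ps e')) = {})"
      by (rule cut_linkage[OF graphlike_G At(2) \<open>{x} \<subseteq> A t\<close>]) (use min 1(1) in simp)
    then obtain v ps where
      H: "\<forall>e\<in>bdG (A t). v e \<in> ends G e \<inter> A t \<and> walkG (v e) (ps e) \<and> simple (v e) (ps e)
        \<and> pverts (v e) (ps e) \<subseteq> A t \<and> pverts (v e) (ps e) \<inter> {x} = {wend (v e) (ps e)}"
      "\<forall>e\<in>bdG (A t). \<forall>e'\<in>bdG (A t). e \<noteq> e' \<longrightarrow> insert e (pedges (ps e)) \<inter> insert e' (pedges (ps e')) = {}"
      by (elim exE conjE)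
    have vp: "\<And>e. e \<in> bdG (A t) \<Longrightarrow> v e \<in> ends G e \<inter> A t \<and> walkG (v e) (ps e) \<and> simple (v e) (ps e)
        \<and> pverts (v e) (ps e) \<subseteq> A t \<and> pverts (v e) (ps e) \<inter> {x} = {wend (v e) (ps e)}"
      and dj: "\<And>e e'. \<lbrakk>e \<in> bdG (A t); e' \<in> bdG (A t); e \<noteq> e'\<rbrakk>
        \<Longrightarrow> insert e (pedges (ps e)) \<inter> insert e' (pedges (ps e')) = {}"
      using H by blast+
    have "tail t (v e) (pverts (v e) (ps e)) (pedges (ps e))" if "e \<in> bdG (A t)" for e
    proof -
      have "wend (v e) (ps e) = x" using vp[OF that] by blast
      then show ?thesis using vp[OF that] 1 unfolding tail_def by blast
    qed
    moreover have "h \<in> edges G \<and> ends G h \<subseteq> A t" if "e \<in> bdG (A t)" "h \<in> pedges (ps e)" for e h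
    proof -
      have v: "walkG (v e) (ps e)" "pverts (v e) (ps e) \<subseteq> A t" using vp[OF that(1)] by simp_all
      show ?thesis using walk_edges[OF v(1)] walk_edge_verts[OF v(1) that(2)] v(2) that(2)
        by (meson order_trans subsetD)
    qed
    moreover have "pedges (ps e) \<inter> pedges (ps e') = {}" if "e \<in> bdG (A t)" "e' \<in> bdG (A t)" "e \<noteq> e'" for e e'
      using dj[OF that] by blast
    ultimately show ?thesis using vp
      by (intro exI[of _ "\<lambda>e. pverts (v e) (ps e)"] exI[of _ "\<lambda>e. pedges (ps e)"]) blast
  next
    case (2 \<omega>)
    have L: "lives_in {EndPoint \<omega>} (A t)" using At(3) 2(1) by simp
    have "\<exists>p f. (\<forall>e\<in>bdG (A t). p e 0 \<in> ends G e \<and> (p e, f e) \<in> \<omega> \<and> range (p e) \<subseteq> A t)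
      \<and> (\<forall>e\<in>bdG (A t). \<forall>e'\<in>bdG (A t). e \<noteq> e' \<longrightarrow> range (f e) \<inter> range (f e') = {})"
      by (rule end_tails[OF 2(2) At(1,2) L]) (use min 2(1) in simp)
    then obtain p f where
      H: "\<forall>e\<in>bdG (A t). p e 0 \<in> ends G e \<and> (p e, f e) \<in> \<omega> \<and> range (p e) \<subseteq> A t"
      "\<forall>e\<in>bdG (A t). \<forall>e'\<in>bdG (A t). e \<noteq> e' \<longrightarrow> range (f e) \<inter> range (f e') = {}"
      by (elim exE conjE)
    have pf: "\<And>e. e \<in> bdG (A t) \<Longrightarrow> p e 0 \<in> ends G e \<and> (p e, f e) \<in> \<omega> \<and> range (p e) \<subseteq> A t"
      and dj: "\<And>e e'. \<lbrakk>e \<in> bdG (A t); e' \<in> bdG (A t); e \<noteq> e'\<rbrakk> \<Longrightarrow> range (f e) \<inter> range (f e') = {}"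
      using H by blast+
    have tl: "tail t (p e 0) (range (p e)) (range (f e))" if "e \<in> bdG (A t)" for e
      unfolding tail_def using pf[OF that] 2 by blast
    have pA: "p e i \<in> A t" if "e \<in> bdG (A t)" for e i using pf[OF that] by blast
    have fA: "h \<in> edges G \<and> ends G h \<subseteq> A t" if e: "e \<in> bdG (A t)" and h: "h \<in> range (f e)" for e h
    proof -
      have "(p e, f e) \<in> rays G" using pf[OF e] ends_rays[OF 2(2)] by blast
      then show ?thesis using raysD(3,4)[of "(p e, f e)"] h pA[OF e] by auto
    qed
    show ?thesis
    proof (intro exI[of _ "\<lambda>e. range (p e)"] exI[of _ "\<lambda>e. range (f e)"] conjI ballI impI)
      fix e assume e: "e \<in> bdG (A t)"
      show "\<exists>w. w \<in> ends G e \<inter> A t \<and> tail t w (range (p e)) (range (f e))"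
        using pf[OF e] pA[OF e, of 0] tl[OF e] by (intro exI[of _ "p e 0"]) simp
      show "range (p e) \<subseteq> A t" using pf[OF e] by simp
      show "h \<in> edges G" "ends G h \<subseteq> A t" if "h \<in> range (f e)" for h using fA[OF e that] by simp_all
      show "range (f e) \<inter> range (f e') = {}" if "e' \<in> bdG (A t)" "e \<noteq> e'" for e' by (rule dj[OF e that])
    qed
  qed
qed

section \<open>Uniting the components and lifting contracted paths to arcs\<close>

lemma bd_cends_terminal:
  assumes "T \<subseteq> vhat G" "separators T A" "t \<in> T"
  shows "bd (cends T A) (edges G) {t} = bdG (A t)"
proof -
  have "bd (cends T A) (edges G) {t} = bdG (contract T A -` {t})" by (auto simp: bd_def cends_def)
  also have "contract T A -` {t} = A t" using contract_terminal_iff[OF assms(2,1,3)] by auto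
  finally show ?thesis .
qed

lemma walk_pverts_edge:
  assumes "walk g E u ps" "ps \<noteq> []" "x \<in> pverts u ps"
  shows "\<exists>e\<in>pedges ps. x \<in> g e"
  using assms
proof (induction g E u ps rule: walk.induct)
  case (2 g E u e v ps)
  then show ?case by (cases "ps = []") auto
qed simp

lemma component_terminal:
  assumes T: "T \<subseteq> vhat G" and sp: "separators T A" and t: "t \<in> T" and v: "v \<in> A t" "v \<in> D"
    and D: "D \<in> components_minus G {}"
  shows "lives_in {t} D"
proof -
  have "t \<in> vhat G" using t T by auto
  then obtain C where C: "C \<in> components_minus G {}" "lives_in {t} C" using lives_in_component by blast
  then have "A t \<subseteq> C" using sp t by (auto simp: separators_def)
  then have "C = D" using component_unique[OF C(1) D] v by blast
  then show ?thesis using C by simp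
qed

text \<open>There may be uncountably many components, so the enumeration of terminals is possible
  only within each of them; the systems are independent and can be united.\<close>

lemma global_system:
  assumes T: "T \<subseteq> vhat G" and sp: "separators T A"
    and par: "\<And>A B. \<lbrakk>is_bipartition G A B; finite (cut_edges G A B); lives_in T A \<or> lives_in T B\<rbrakk>
           \<Longrightarrow> even (card (cut_edges G A B))"
  shows "\<exists>\<P>. tsystem (cends T A) (edges G) T \<P> \<and> (\<forall>t\<in>T. bdG (A t) \<subseteq> pe \<P>)"
proof -
  let ?T = "\<lambda>D. {t \<in> T. lives_in {t} D}"
  have sep: "sep T t (A t)" if "t \<in> T" for t using sp that by (auto simp: separators_def minsep_def)
  define Q where "Q D \<P> \<longleftrightarrow> tsystem (cends T A) (comp_edges D) (?T D) \<P>
    \<and> (\<forall>t\<in>?T D. bd (cends T A) (comp_edges D) {t} \<subseteq> pe \<P>)" for D \<P>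
  have "\<exists>\<P>. Q D \<P>" if D: "D \<in> components_minus G {}" for D
    unfolding Q_def by (rule tsystem_exists[OF good_contract(1)[OF T sp D par] countable_terminals[OF T sep D]])
  then obtain P where "\<And>D. D \<in> components_minus G {} \<Longrightarrow> Q D (P D)" by metis
  then have P: "tsystem (cends T A) (comp_edges D) (?T D) (P D)"
    "\<And>t. t \<in> ?T D \<Longrightarrow> bd (cends T A) (comp_edges D) {t} \<subseteq> pe (P D)"
    if "D \<in> components_minus G {}" for D using that unfolding Q_def by blast+
  define \<P> where "\<P> = (\<Union>D\<in>components_minus G {}. P D)"
  have tpD: "tpath (cends T A) (comp_edges D) (?T D) (fst q) (snd q)"
    if "D \<in> components_minus G {}" "q \<in> P D" for D q
    using P(1)[OF that(1)] that(2) unfolding tsystem_def by (cases q) auto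
  have tp: "tpath (cends T A) (edges G) T (fst q) (snd q)" if D: "D \<in> components_minus G {}" and q: "q \<in> P D" for D q
  proof -
    note tq = tpD[OF D q]
    have E: "pedges (snd q) \<subseteq> comp_edges D" by (rule tpath_edges[OF tq])
    have wk: "walk (cends T A) (comp_edges D) (fst q) (snd q)" "snd q \<noteq> []" using tq by (auto simp: tpath_def)
    have "walk (cends T A) (edges G) (fst q) (snd q)"
      by (rule walk_cong[OF wk(1)]) (use E in \<open>auto simp: comp_edges_def\<close>)
    \<comment> \<open>A terminal on a path inside \<open>D\<close> is incident with an edge of
      \<open>D\<close>, so its side meets \<open>D\<close> and the terminal lives there.\<close>
    moreover have "x \<in> ?T D" if x: "x \<in> pverts (fst q) (snd q)" "x \<in> T" for x
    proof -
      obtain e where e: "e \<in> pedges (snd q)" "x \<in> cends T A e" using walk_pverts_edge[OF wk x(1)] by blast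
      then obtain v where v: "v \<in> ends G e" "x = contract T A v" by (auto simp: cends_def)
      then have "v \<in> D" using E e by (auto simp: comp_edges_def)
      moreover have "v \<in> A x" using contract_terminal_iff[OF sp T x(2), of v] v(2) by blast
      ultimately show ?thesis using component_terminal[OF T sp x(2) _ _ D] x(2) by simp
    qed
    then have "pverts (fst q) (snd q) \<inter> T = pverts (fst q) (snd q) \<inter> ?T D" by blast
    ultimately show ?thesis using tq unfolding tpath_def by simp
  qed
  have "tsystem (cends T A) (edges G) T \<P>"
    unfolding tsystem_def
  proof (intro conjI ballI impI)
    fix q assume "q \<in> \<P>"
    then show "case q of (u, ps) \<Rightarrow> tpath (cends T A) (edges G) T u ps" using tp unfolding \<P>_def by (cases q) auto
  next
    fix q r assume "q \<in> \<P>" "r \<in> \<P>" "q \<noteq> r"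
    then obtain D D' where D: "D \<in> components_minus G {}" "q \<in> P D" "D' \<in> components_minus G {}" "r \<in> P D'"
      unfolding \<P>_def by blast
    show "pedges (snd q) \<inter> pedges (snd r) = {}"
    proof (cases "D = D'")
      case True
      then show ?thesis using P(1)[OF D(1)] D(2,4) \<open>q \<noteq> r\<close> unfolding tsystem_def by blast
    next
      case False
      then have dj: "D \<inter> D' = {}" using component_unique[OF D(1,3)] by blast
      have "ends G e \<noteq> {}" if "e \<in> edges G" for e using origin_in[OF that] by blast
      then have "comp_edges D \<inter> comp_edges D' = {}" using dj unfolding comp_edges_def by blast
      then show ?thesis using tpath_edges[OF tpD[OF D(1,2)]] tpath_edges[OF tpD[OF D(3,4)]] by blast
    qed
  qed
  moreover have "bdG (A t) \<subseteq> pe \<P>" if t: "t \<in> T" for t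
  proof -
    have "t \<in> vhat G" using t T by auto
    then obtain D where D: "D \<in> components_minus G {}" "lives_in {t} D" using lives_in_component by blast
    have "bdG (A t) \<subseteq> pe (P D)" using P(2)[OF D(1), of t] good_contract(2)[OF T sp D(1) par t D(2)] t D(2) by simp
    also have "\<dots> \<subseteq> pe \<P>" using D(1) unfolding pe_def \<P>_def by blast
    finally show ?thesis .
  qed
  ultimately show ?thesis by blast
qed

text \<open>Inner vertices of a terminal path are no terminals, so each has a single preimage and
  consecutive lifted edges fit together. Only the first and last vertices may come from larger
  sides, and there the first and last edges choose the preimages.\<close>

lemma lift_walk:
  assumes sp: "separators T A" and "walk (cends T A) (edges G) u ps" "simple u ps" "ps \<noteq> []" "pverts u ps \<inter> T \<subseteq> {u, wend u ps}"
  shows "\<exists>w qs. walkG w qs \<and> contract T A w = u \<and> map (\<lambda>(e, v). (e, contract T A v)) qs = ps"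
  using assms(2-)
proof (induction ps arbitrary: u)
  case (Cons q ps)
  obtain e y where q: "q = (e, y)" by (cases q)
  have e: "e \<in> edges G" "cends T A e = {u, y}" and wk: "walk (cends T A) (edges G) y ps" and sm: "u \<notin> pverts y ps" "simple y ps"
    using Cons.prems q by auto
  obtain a b where ab0: "ends G e = {a, b}" using e(1) graphlike_G unfolding graphlike_def by blast
  then have "{contract T A a, contract T A b} = {u, y}" using e by (simp add: cends_def)
  then obtain a b where ab: "ends G e = {a, b}" "contract T A a = u" "contract T A b = y"
    using ab0 unfolding doubleton_eq_iff by (metis insert_commute)
  show ?case
  proof (cases "ps = []")
    case True
    then show ?thesis using ab e q by (intro exI[of _ a] exI[of _ "[(e, b)]"]) auto
  next
    case False
    have pT: "pverts y ps \<inter> T \<subseteq> {wend y ps}" using Cons.prems(4) sm q by auto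
    then obtain w qs where IH: "walkG w qs" "contract T A w = y" "map (\<lambda>(e, v). (e, contract T A v)) qs = ps"
      using Cons.IH[OF wk sm(2) False] by blast
    have "y \<noteq> wend y ps" using simple_wend_neq[OF sm(2) False] by simp
    then have "y \<notin> T" using pT by auto
    have uniq: "contract T A v = Vertex v" if "contract T A v = y" for v
    proof (rule contract_out)
      show "v \<notin> A t" if "t \<in> T" for t
        using contract_in[OF sp that, of v] \<open>contract T A v = y\<close> \<open>y \<notin> T\<close> that by blast
    qed
    then have "(Vertex b :: ('v, 'e) point) = Vertex w" using uniq[OF ab(3)] uniq[OF IH(2)] ab(3) IH(2) by metis
    then have "b = w" by simp
    then show ?thesis using IH ab e q by (intro exI[of _ a] exI[of _ "(e, b) # qs"]) auto
  qed
qed simp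


lemma wend_map: "wend (h u) (map (\<lambda>(e, v). (e, h v)) ps) = h (wend u ps)"
  by (induction u ps rule: wend.induct) auto

lemma tail_start: "tail t w W F \<Longrightarrow> w \<in> W"
  unfolding tail_def by auto

definition tails where
  "tails T A W F \<longleftrightarrow> (\<forall>t\<in>T. (\<forall>e\<in>bdG (A t). (\<exists>w. w \<in> ends G e \<inter> A t \<and> tail t w (W t e) (F t e))
      \<and> W t e \<subseteq> A t \<and> (\<forall>h\<in>F t e. h \<in> edges G \<and> ends G h \<subseteq> A t))
    \<and> (\<forall>e\<in>bdG (A t). \<forall>e'\<in>bdG (A t). e \<noteq> e' \<longrightarrow> F t e \<inter> F t e' = {}))"

lemma tailsD:
  assumes "tails T A W F" "t \<in> T" "e \<in> bdG (A t)"
  shows "\<exists>w. w \<in> ends G e \<inter> A t \<and> tail t w (W t e) (F t e)" "W t e \<subseteq> A t"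
    "h \<in> F t e \<Longrightarrow> h \<in> edges G \<and> ends G h \<subseteq> A t"
    "\<lbrakk>e' \<in> bdG (A t); e \<noteq> e'\<rbrakk> \<Longrightarrow> F t e \<inter> F t e' = {}"
  using assms(1)[unfolded tails_def, rule_format, OF assms(2)] assms(3) by simp_all

text \<open>The lifted walk meets \<open>A t\<close> and \<open>A t'\<close> only in its first and
  last vertex. Its boundary edges \<open>e\<close> and \<open>e'\<close> select the two tails, which
  lie in disjoint sides, so the pieces form one arc.\<close>

lemma realize:
  assumes T: "T \<subseteq> vhat G" and sp: "separators T A" and tl: "tails T A W F"
    and tp: "tpath (cends T A) (edges G) T t ps"
  defines "t' \<equiv> wend t ps"
  shows "\<exists>e e' U. e \<in> pedges ps \<inter> bdG (A t) \<and> e' \<in> pedges ps \<inter> bdG (A t')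
    \<and> conn t t' U (F t e \<union> pedges ps \<union> F t' e') \<and> pts t t' U (F t e \<union> pedges ps \<union> F t' e') \<inter> T = {t, t'}"
proof -
  have wk: "walk (cends T A) (edges G) t ps" "simple t ps" "ps \<noteq> []" and pT: "pverts t ps \<inter> T = {t, t'}"
    using tp by (auto simp: tpath_def t'_def)
  have tT: "t \<in> T" "t' \<in> T" using pT by blast+
  have ne: "t \<noteq> t'" using simple_wend_neq[OF wk(2,3)] by (simp add: t'_def)
  have "pverts t ps \<inter> T \<subseteq> {t, wend t ps}" using pT by (simp add: t'_def)
  then obtain w qs where q: "walkG w qs" "contract T A w = t" "map (\<lambda>(e, v). (e, contract T A v)) qs = ps"
    using lift_walk[OF sp wk] by blast
  define w' where "w' = wend w qs"
  have w': "contract T A w' = t'" using wend_map[of "contract T A" w qs] q by (simp add: w'_def t'_def)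
  have ped: "pedges qs = pedges ps" unfolding q(3)[symmetric] by force
  have snd: "map snd ps = map (contract T A) (map snd qs)" unfolding q(3)[symmetric] by (induction qs) auto
  have "distinct (map (contract T A) (w # map snd qs))" using wk(2) q(2) snd by (simp add: simple_def)
  then have "distinct (w # map snd qs)" "inj_on (contract T A) (set (w # map snd qs))"
    unfolding distinct_map by blast+
  then have "simple w qs" and inj: "inj_on (contract T A) (pverts w qs)"
    unfolding simple_def by (simp_all only: list.set set_map)
  have con: "contract T A v \<in> pverts t ps" if v: "v \<in> pverts w qs" for v
  proof -
    have "set (t # map snd ps) = contract T A ` set (w # map snd qs)" using snd q(2) by (simp add: image_image)
    moreover have "pverts t ps = set (t # map snd ps)" "pverts w qs = set (w # map snd qs)" by simp_all
    ultimately show ?thesis using v by blast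
  qed
  have qne: "qs \<noteq> []" using q(3) wk(3) by auto
  have ww': "w \<in> pverts w qs" "w' \<in> pverts w qs" using wend_in_pverts[of w qs] by (simp_all add: w'_def)
  have wA: "w \<in> A t" "w' \<in> A t'" using contract_terminal_iff[OF sp T] tT q(2) w' by blast+
  \<comment> \<open>Contraction is injective on the vertices of the lift, and the whole side
    \<open>A t\<close> is mapped to \<open>t\<close>.\<close>
  have At: "pverts w qs \<inter> A t = {w}"
  proof -
    have "v = w" if "v \<in> pverts w qs" "v \<in> A t" for v
      using inj_onD[OF inj _ that(1) ww'(1)] contract_in[OF sp tT(1) that(2)] q(2) by simp
    then show ?thesis using ww' wA by blast
  qed
  have At': "pverts w qs \<inter> A t' = {w'}"
  proof -
    have "v = w'" if "v \<in> pverts w qs" "v \<in> A t'" for v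
      using inj_onD[OF inj _ that(1) ww'(2)] contract_in[OF sp tT(2) that(2)] w' by simp
    then show ?thesis using ww' wA by blast
  qed
  obtain e' where e': "e' \<in> pedges qs" "e' \<in> bdG (A t')" "w' \<in> ends G e'"
    using walk_last[OF q(1) At'[unfolded w'_def] \<open>simple w qs\<close> qne] unfolding w'_def by blast
  have "pverts w' (prev w qs) \<inter> A t = {wend w' (prev w qs)}" using At by (simp add: w'_def)
  then obtain e where "e \<in> pedges (prev w qs)" "e \<in> bdG (A t)" "wend w' (prev w qs) \<in> ends G e"
    using walk_last[of "ends G" "edges G" w' "prev w qs" "A t"] walk_prev[OF q(1)] simple_prev[OF \<open>simple w qs\<close>] qne
    unfolding w'_def by auto
  then have e: "e \<in> pedges qs" "e \<in> bdG (A t)" "w \<in> ends G e" by (simp_all add: w'_def)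
  \<comment> \<open>A boundary edge has one endvertex in the side, so the tail assigned to
    \<open>e\<close> starts exactly where the lifted walk does.\<close>
  obtain x where "x \<in> ends G e \<inter> A t" "tail t x (W t e) (F t e)" using tailsD(1)[OF tl tT(1) e(2)] by (elim exE conjE)
  moreover have "x = w" using bd_one_end[OF e(2) calculation(1)] e(3) wA by blast
  ultimately have t1: "tail t w (W t e) (F t e)" by simp
  obtain x' where "x' \<in> ends G e' \<inter> A t'" "tail t' x' (W t' e') (F t' e')" using tailsD(1)[OF tl tT(2) e'(2)] by (elim exE conjE)
  moreover have "x' = w'" using bd_one_end[OF e'(2) calculation(1)] e'(3) wA by blast
  ultimately have t2: "tail t' w' (W t' e') (F t' e')" by simp
  have WA: "W t e \<subseteq> A t" "W t' e' \<subseteq> A t'" using tailsD(2)[OF tl tT(1) e(2)] tailsD(2)[OF tl tT(2) e'(2)] by simp_all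
  have AA: "A t \<inter> A t' = {}" using sp tT ne unfolding separators_def by blast
  let ?U = "W t e \<union> pverts w qs \<union> W t' e'" and ?F = "F t e \<union> pedges ps \<union> F t' e'"
  have "conn t t' ?U (F t e \<union> pedges qs \<union> F t' e')"
  proof (rule conn_tails[OF q(1) \<open>simple w qs\<close> qne t1 _ _ _ _ ne])
    show "tail t' (wend w qs) (W t' e') (F t' e')" using t2 by (simp add: w'_def)
    show "pverts w qs \<inter> W t e = {w}" using At WA(1) tail_start[OF t1] by blast
    show "pverts w qs \<inter> W t' e' = {wend w qs}"
      using At' WA(2) tail_start[OF t2] unfolding w'_def by blast
    show "W t e \<inter> W t' e' = {}" using AA WA by blast
  qed
  then have cn: "conn t t' ?U ?F" unfolding ped .
  \<comment> \<open>A terminal vertex in a tail lies in the side of \<open>t\<close> or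
    \<open>t'\<close>, so it is that terminal; one on the lifted walk is contracted to itself and
    thus lies on the given terminal path. No further ends are added.\<close>
  have "pts t t' ?U ?F \<inter> T \<subseteq> {t, t'}"
  proof
    fix z assume z: "z \<in> pts t t' ?U ?F \<inter> T"
    then have zT: "z \<in> T" by simp
    have "z \<in> vhat G" using zT T by auto
    then show "z \<in> {t, t'}"
    proof (cases rule: vhat_cases)
      case (1 v)
      have vA: "v \<in> A z" using sp zT 1 by (auto simp: separators_def minsep_def sep_def)
      have dj: "s = z" if "s \<in> T" "v \<in> A s" for s
        using sp that zT vA unfolding separators_def by blast
      have "v \<in> ?U \<or> z \<in> {t, t'}" using z 1 unfolding pts_def inner_points_def by auto
      then consider "v \<in> A t" | "v \<in> A t'" | "v \<in> pverts w qs" | "z \<in> {t, t'}" using WA by blast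
      then show ?thesis
      proof cases
        case 3
        have "contract T A v = z" using contract_in[OF sp zT vA] .
        then have "z \<in> pverts t ps \<inter> T" using con[OF 3] zT by simp
        then show ?thesis unfolding pT .
      qed (use dj tT in auto)
    next
      case (2 \<omega>)
      then show ?thesis using z unfolding pts_def inner_points_def by auto
    qed
  qed
  moreover have "{t, t'} \<subseteq> pts t t' ?U ?F \<inter> T" using tT unfolding pts_def by blast
  ultimately have "pts t t' ?U ?F \<inter> T = {t, t'}" by (rule subset_antisym)
  then show ?thesis using cn e e' unfolding ped by blast
qed

text \<open>Together with the absence of loops on simple walks this shows that edges of tails never
  occur on terminal paths.\<close>

lemma cends_loop:
  assumes "separators T A" "s \<in> T" "e \<in> edges G" "ends G e \<subseteq> A s"
  shows "cends T A e = {s}"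
proof -
  have "contract T A v = s" if "v \<in> ends G e" for v using contract_in[OF assms(1,2)] that assms(4) by blast
  moreover have "ends G e \<noteq> {}" using origin_in[OF assms(3)] by blast
  ultimately show ?thesis unfolding cends_def by blast
qed

lemma walk_no_loop:
  assumes "walk g E u ps" "simple u ps" "e \<in> pedges ps"
  shows "g e \<noteq> {s}"
  using assms
proof (induction g E u ps rule: walk.induct)
  case (2 g E u e' v ps)
  show ?case
  proof (cases "e = e'")
    case True
    have "u \<noteq> v" "g e' = {u, v}" using 2 by auto
    then show ?thesis using True by auto
  next
    case False
    then show ?thesis using 2 by auto
  qed
qed simp

end

lemma singleton_parts:
  "\<lbrakk>Z \<inter> T = {x, y}; x \<noteq> y\<rbrakk> \<Longrightarrow> Z \<inter> {x} = {x} \<and> Z \<inter> (T - {x}) = {y}"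
  by blast

theorem theorem1:
  fixes G :: "('v, 'e) multigraph" and T :: "('v, 'e) point set"
  assumes "is_multigraph G" and "locally_finite G"
    and "T \<subseteq> vhat G"
    and "subtopology (end_compactification G) T = discrete_topology T"
    and "\<And>A B. \<lbrakk>is_bipartition G A B; finite (cut_edges G A B); lives_in T A \<or> lives_in T B\<rbrakk>
           \<Longrightarrow> even (card (cut_edges G A B))"
  shows "\<exists>\<A>. (\<forall>A\<in>\<A>. is_T_arc (end_compactification G) T A \<and> is_graphic G A) \<and>
             pairwise (edge_disjoint G) \<A> \<and>
             (\<forall>t\<in>T. finite {A\<in>\<A>. is_arc_between (end_compactification G) {t} (T - {t}) A} \<and>
                    card {A\<in>\<A>. is_arc_between (end_compactification G) {t} (T - {t}) A}
                      = cut_lambda G t (T - {t}))"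
proof -
  interpret lf_graph G using assms(1,2) by unfold_locales
  note T = assms(3)
  obtain A where sp: "separators T A" using separators_exist[OF T] sep_exists[OF T assms(4)] by blast
  have "\<forall>t\<in>T. \<exists>WF. (\<forall>e\<in>bdG (A t). (\<exists>w. w \<in> ends G e \<inter> A t \<and> tail t w (fst WF e) (snd WF e)) \<and> fst WF e \<subseteq> A t
      \<and> (\<forall>h\<in>snd WF e. h \<in> edges G \<and> ends G h \<subseteq> A t))
    \<and> (\<forall>e\<in>bdG (A t). \<forall>e'\<in>bdG (A t). e \<noteq> e' \<longrightarrow> snd WF e \<inter> snd WF e' = {})"
    using tails_exist[OF T sp] by simp
  from bchoice[OF this] obtain WF where WF: "\<forall>t\<in>T. (\<forall>e\<in>bdG (A t). (\<exists>w. w \<in> ends G e \<inter> A t \<and> tail t w (fst (WF t) e) (snd (WF t) e)) \<and> fst (WF t) e \<subseteq> A t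
      \<and> (\<forall>h\<in>snd (WF t) e. h \<in> edges G \<and> ends G h \<subseteq> A t))
    \<and> (\<forall>e\<in>bdG (A t). \<forall>e'\<in>bdG (A t). e \<noteq> e' \<longrightarrow> snd (WF t) e \<inter> snd (WF t) e' = {})" by (elim exE)
  define W where "W t = fst (WF t)" for t
  define F where "F t = snd (WF t)" for t
  have tl: "tails T A W F" unfolding tails_def W_def F_def by (rule WF)
  obtain \<P> where ts: "tsystem (cends T A) (edges G) T \<P>" and cover: "\<And>t. t \<in> T \<Longrightarrow> bdG (A t) \<subseteq> pe \<P>"
    using global_system[OF T sp assms(5)] by blast
  define src where "src q = fst q" for q :: "('v, 'e) point \<times> ('e \<times> ('v, 'e) point) list"
  define dst where "dst q = wend (fst q) (snd q)" for q :: "('v, 'e) point \<times> ('e \<times> ('v, 'e) point) list"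
  define E where "E q = pedges (snd q)" for q :: "('v, 'e) point \<times> ('e \<times> ('v, 'e) point) list"
  have tp: "tpath (cends T A) (edges G) T (src q) (snd q)" if "q \<in> \<P>" for q
    using ts that unfolding tsystem_def src_def by (cases q) auto
  have disj: "E q \<inter> E r = {}" if "q \<in> \<P>" "r \<in> \<P>" "q \<noteq> r" for q r
    using ts that unfolding tsystem_def E_def by blast
  have "\<forall>q\<in>\<P>. \<exists>x. fst x \<in> E q \<inter> bdG (A (src q)) \<and> fst (snd x) \<in> E q \<inter> bdG (A (dst q))
    \<and> conn (src q) (dst q) (snd (snd x)) (F (src q) (fst x) \<union> E q \<union> F (dst q) (fst (snd x)))
    \<and> pts (src q) (dst q) (snd (snd x)) (F (src q) (fst x) \<union> E q \<union> F (dst q) (fst (snd x))) \<inter> T = {src q, dst q}"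
    using realize[OF T sp tl tp] unfolding E_def dst_def src_def by simp
  from bchoice[OF this] obtain x where x: "\<forall>q\<in>\<P>. fst (x q) \<in> E q \<inter> bdG (A (src q)) \<and> fst (snd (x q)) \<in> E q \<inter> bdG (A (dst q))
    \<and> conn (src q) (dst q) (snd (snd (x q))) (F (src q) (fst (x q)) \<union> E q \<union> F (dst q) (fst (snd (x q))))
    \<and> pts (src q) (dst q) (snd (snd (x q))) (F (src q) (fst (x q)) \<union> E q \<union> F (dst q) (fst (snd (x q)))) \<inter> T = {src q, dst q}"
    by (elim exE)
  define a where "a q = fst (x q)" for q
  define b where "b q = fst (snd (x q))" for q
  \<comment> \<open>All edges of the arc: the contracted path with its own boundary edges, and the
    two tails that these boundary edges select.\<close>
  define EF where "EF q = F (src q) (a q) \<union> E q \<union> F (dst q) (b q)" for q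
  define Z where "Z q = pts (src q) (dst q) (snd (snd (x q))) (EF q)" for q
  have ab: "a q \<in> E q" "a q \<in> bdG (A (src q))" "b q \<in> E q" "b q \<in> bdG (A (dst q))"
    and cn: "conn (src q) (dst q) (snd (snd (x q))) (EF q)" and ZT: "Z q \<inter> T = {src q, dst q}" if "q \<in> \<P>" for q
    using x that unfolding a_def b_def EF_def Z_def by simp_all
  have sdT: "src q \<in> T" "dst q \<in> T" if "q \<in> \<P>" for q using ZT[OF that] by blast+
  have arc: "arc_with_endpoints K (src q) (dst q) (Z q)" and gr: "is_graphic G (Z q)" if "q \<in> \<P>" for q
    using cn[OF that] unfolding conn_def Z_def by simp_all
  have FA: "h \<in> edges G \<and> ends G h \<subseteq> A t" if "t \<in> T" "e \<in> bdG (A t)" "h \<in> F t e" for t e h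
    by (rule tailsD(3)[OF tl that])
  have FF: "F t e \<inter> F t e' = {}" if "t \<in> T" "e \<in> bdG (A t)" "e' \<in> bdG (A t)" "e \<noteq> e'" for t e e'
    by (rule tailsD(4)[OF tl that])
  \<comment> \<open>Tails at different terminals lie inside disjoint sides; at the same terminal
    they belong to one disjoint linkage.\<close>
  have F_F: "F s e \<inter> F t e' = {}" if st: "s \<in> T" "t \<in> T" "e \<in> bdG (A s)" "e' \<in> bdG (A t)" "e \<noteq> e'" for s t e e'
  proof (cases "s = t")
    case True
    then show ?thesis using FF st by blast
  next
    case False
    show ?thesis
    proof (rule ccontr)
      assume "F s e \<inter> F t e' \<noteq> {}"
      then obtain h where h: "h \<in> F s e" "h \<in> F t e'" by blast
      have "origin G h \<in> A s \<inter> A t" using FA[OF st(1,3) h(1)] FA[OF st(2,4) h(2)] origin_in[of h] by blast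
      then show False using sp st False unfolding separators_def by blast
    qed
  qed
  have F_E: "F t e \<inter> E q = {}" if t: "t \<in> T" "e \<in> bdG (A t)" and q: "q \<in> \<P>" for t e q
  proof (rule ccontr)
    assume "F t e \<inter> E q \<noteq> {}"
    then obtain h where h: "h \<in> F t e" "h \<in> pedges (snd q)" unfolding E_def by blast
    have "cends T A h = {t}" using cends_loop[OF sp t(1)] FA[OF t h(1)] by blast
    moreover have "walk (cends T A) (edges G) (src q) (snd q)" "simple (src q) (snd q)"
      using tp[OF q] by (auto simp: tpath_def)
    ultimately show False using walk_no_loop h(2) by metis
  qed
  have EF_disj: "EF q \<inter> EF r = {}" if qr: "q \<in> \<P>" "r \<in> \<P>" "q \<noteq> r" for q r
  proof -
    \<comment> \<open>Distinct terminal paths are edge-disjoint, so they select distinct boundary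
      edges and hence disjoint tails, even at a common terminal.\<close>
    have ne: "a q \<noteq> a r" "a q \<noteq> b r" "b q \<noteq> a r" "b q \<noteq> b r"
      using disj[OF qr] ab(1,3)[OF qr(1)] ab(1,3)[OF qr(2)] by auto
    note s = sdT[OF qr(1)] sdT[OF qr(2)] and c = ab(2,4)[OF qr(1)] ab(2,4)[OF qr(2)]
    have "F (src q) (a q) \<inter> F (src r) (a r) = {}" "F (src q) (a q) \<inter> F (dst r) (b r) = {}"
      "F (dst q) (b q) \<inter> F (src r) (a r) = {}" "F (dst q) (b q) \<inter> F (dst r) (b r) = {}"
      using F_F[OF s(1) s(3) c(1) c(3) ne(1)] F_F[OF s(1) s(4) c(1) c(4) ne(2)]
        F_F[OF s(2) s(3) c(2) c(3) ne(3)] F_F[OF s(2) s(4) c(2) c(4) ne(4)] by simp_all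
    moreover have "F (src q) (a q) \<inter> E r = {}" "F (dst q) (b q) \<inter> E r = {}"
      "E q \<inter> F (src r) (a r) = {}" "E q \<inter> F (dst r) (b r) = {}"
      using F_E[OF s(1) c(1) qr(2)] F_E[OF s(2) c(2) qr(2)] F_E[OF s(3) c(3) qr(1)] F_E[OF s(4) c(4) qr(1)]
      by (simp_all add: Int_commute)
    ultimately show ?thesis using disj[OF qr] unfolding EF_def by (simp add: Int_Un_distrib Int_Un_distrib2)
  qed
  have inner: "e \<in> EF q" if "Inner e s \<in> Z q" "q \<in> \<P>" for e s q
  proof -
    have "src q \<in> vhat G" "dst q \<in> vhat G" using sdT[OF that(2)] T by blast+
    then show ?thesis using that(1) unfolding Z_def pts_def vhat_def inner_points_def by auto
  qed
  have ed: "edge_disjoint G (Z q) (Z r)" if qr: "q \<in> \<P>" "r \<in> \<P>" "q \<noteq> r" for q r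
    unfolding edge_disjoint_def
  proof (rule ccontr)
    assume "Z q \<inter> Z r \<inter> inner_points (edges G) \<noteq> {}"
    then obtain e s where "Inner e s \<in> Z q" "Inner e s \<in> Z r" by (auto simp: inner_points_def)
    then show False using inner qr EF_disj[OF qr] by blast
  qed
  \<comment> \<open>Different paths must not yield the same arc, or the count would be too small.
    The midpoint of the boundary edge \<open>a q\<close> distinguishes them.\<close>
  have inj: "inj_on Z \<P>"
  proof (rule inj_onI, rule ccontr)
    fix q r assume qr: "q \<in> \<P>" "r \<in> \<P>" "Z q = Z r" "q \<noteq> r"
    have "a q \<in> edges G" using ab(2)[OF qr(1)] by (simp add: bd_def)
    moreover have half: "0 < (1/2 :: real) \<and> (1/2 :: real) < 1" by simp
    moreover have "Inner (a q) (1/2) \<in> Z q"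
      using ab(1)[OF qr(1)] half unfolding Z_def pts_def EF_def inner_points_def by blast
    ultimately have "Inner (a q) (1/2) \<in> Z q \<inter> Z r \<inter> inner_points (edges G)"
      using qr(3) unfolding inner_points_def by blast
    then show False using ed[OF qr(1,2,4)] unfolding edge_disjoint_def by blast
  qed
  have between: "is_arc_between K {t} (T - {t}) (Z q) \<longleftrightarrow> t = src q \<or> t = dst q" if q: "q \<in> \<P>" and t: "t \<in> T" for q t
  proof
    assume "is_arc_between K {t} (T - {t}) (Z q)"
    then obtain y where "Z q \<inter> {t} = {y}" unfolding is_arc_between_def by (elim exE conjE)
    then have "t \<in> Z q" by (metis Int_iff insertI1 singletonD)
    then have "t \<in> Z q \<inter> T" using t by (rule IntI)
    then show "t = src q \<or> t = dst q" unfolding ZT[OF q] by simp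
  next
    have ne: "src q \<noteq> dst q"
      using simple_wend_neq[of "src q" "snd q"] tp[OF q] by (auto simp: tpath_def dst_def src_def)
    assume "t = src q \<or> t = dst q"
    then show "is_arc_between K {t} (T - {t}) (Z q)"
    proof
      assume ts: "t = src q"
      have "Z q \<inter> {t} = {src q}" "Z q \<inter> (T - {t}) = {dst q}"
        using ZT[OF q] ts ne singleton_parts[of "Z q" T "src q" "dst q"] by simp_all
      then show ?thesis using arc[OF q] unfolding is_arc_between_def by (intro exI conjI)
    next
      assume td: "t = dst q"
      have "Z q \<inter> {t} = {dst q}" "Z q \<inter> (T - {t}) = {src q}"
        using ZT[OF q] td ne singleton_parts[of "Z q" T "dst q" "src q"] by (simp_all add: insert_commute)
      then show ?thesis using arc_reverse[OF arc[OF q] Hausdorff_K] unfolding is_arc_between_def by (intro exI conjI)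
    qed
  qed
  have count: "finite {B\<in>Z ` \<P>. is_arc_between K {t} (T - {t}) B} \<and>
      card {B\<in>Z ` \<P>. is_arc_between K {t} (T - {t}) B} = cut_lambda G t (T - {t})" if t: "t \<in> T" for t
  proof -
    define Q where "Q = {q\<in>\<P>. t = src q \<or> t = dst q}"
    have eq: "{B\<in>Z ` \<P>. is_arc_between K {t} (T - {t}) B} = Z ` Q"
      unfolding Q_def using between t by blast
    have bt: "bd (cends T A) (edges G) {t} = bdG (A t)" by (rule bd_cends_terminal[OF T sp t])
    \<comment> \<open>A path with end \<open>t\<close> uses exactly one edge of the boundary of
      \<open>A t\<close>. As the paths are edge-disjoint and cover this boundary, they correspond
      bijectively to its edges, whose number is \<open>cut_lambda\<close>.\<close>
    define \<phi> where "\<phi> q = the_elem (bdG (A t) \<inter> E q)" for q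
    have \<phi>: "bdG (A t) \<inter> E q = {\<phi> q}" if q: "q \<in> Q" for q
    proof -
      have "\<exists>e. bdG (A t) \<inter> E q = {e}"
        using tpath_start[OF tp[of q]] tpath_end[OF tp[of q]] q bt unfolding Q_def E_def dst_def src_def by auto
      then obtain e where e: "bdG (A t) \<inter> E q = {e}" ..
      then show ?thesis unfolding \<phi>_def e by simp
    qed
    have "bij_betw \<phi> Q (bdG (A t))"
      unfolding bij_betw_def
    proof
      show "inj_on \<phi> Q"
      proof (rule inj_onI, rule ccontr)
        fix q r assume qr: "q \<in> Q" "r \<in> Q" "\<phi> q = \<phi> r" "q \<noteq> r"
        then have "\<phi> q \<in> E q \<inter> E r" using \<phi>[OF qr(1)] \<phi>[OF qr(2)] by blast
        then show False using disj qr unfolding Q_def by blast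
      qed
      show "\<phi> ` Q = bdG (A t)"
      proof
        show "\<phi> ` Q \<subseteq> bdG (A t)" using \<phi> by blast
        show "bdG (A t) \<subseteq> \<phi> ` Q"
        proof
          fix e assume e: "e \<in> bdG (A t)"
          then have "e \<in> pe \<P>" using cover[OF t] by blast
          then obtain q where q: "q \<in> \<P>" "e \<in> E q" unfolding pe_def E_def case_prod_unfold by blast
          have "bd (cends T A) (edges G) {t} \<inter> pedges (snd q) \<noteq> {}" using e q bt by (auto simp: E_def)
          moreover have "finite (pedges (snd q))" by simp
          ultimately have "card (bd (cends T A) (edges G) {t} \<inter> pedges (snd q)) \<noteq> 0" by simp
          then have "t = src q \<or> t = dst q"
            using tpath_degree[OF tp[OF q(1)] t] unfolding dst_def src_def by (auto split: if_splits)
          then have "q \<in> Q" using q by (simp add: Q_def)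
          then show "e \<in> \<phi> ` Q" using \<phi>[of q] e q by blast
        qed
      qed
    qed
    moreover have "finite (bdG (A t))" "card (bdG (A t)) = cut_lambda G t (T - {t})"
      using sp t by (auto simp: separators_def minsep_def sep_def)
    ultimately have "finite Q" "card Q = cut_lambda G t (T - {t})"
      using bij_betw_finite bij_betw_same_card by metis+
    moreover have "card (Z ` Q) = card Q" by (rule card_image[OF inj_on_subset[OF inj]]) (auto simp: Q_def)
    ultimately show ?thesis unfolding eq by simp
  qed
  have "is_T_arc K T B \<and> is_graphic G B" if B: "B \<in> Z ` \<P>" for B
  proof -
    obtain q where q: "q \<in> \<P>" "B = Z q" using B by blast
    have "(Z q - {src q, dst q}) \<inter> T = {}" using ZT[OF q(1)] by blast
    then show ?thesis using arc[OF q(1)] gr[OF q(1)] sdT[OF q(1)] unfolding q(2) is_T_arc_def by blast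
  qed
  moreover have "pairwise (edge_disjoint G) (Z ` \<P>)"
    unfolding pairwise_def using ed by blast
  ultimately show ?thesis using count by (intro exI[of _ "Z ` \<P>"]) blast
qed

end
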